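(* The Double Row Problem in which all cost functions are convex piecewise quadratic with a total of $N$ kinks (summed over all cost functions) can be solved in time $\mathcal{O}\big((|\mathcal{C}|+|\mathcal{B}|+|\mathcal{T}|+N)\cdot\log(|\mathcal{C}|+|\mathcal{B}|+|\mathcal{T}|+N)\big)$.
   Context: Double Row Problem: an instance consists of a nonempty set $\mathcal{C}=\{C_1,\dots,C_k\}$ of double-row cells; for $i=0,\dots,k$ nonnegative integers $m_i,n_i$ and single-row cells $b_{i1},\dots,b_{im_i}$ (bottom row) and $t_{i1},\dots,t_{in_i}$ (top row), with $\mathcal{B}$ and $\mathcal{T}$ the sets of all $b_{ij}$ resp. $t_{ij}$; widths $w:\mathcal{C}\cup\mathcal{B}\cup\mathcal{T}\to\mathbb{R}_{>0}$; reals $x_{min},x_{max}$ with $x_{min}+\sum_{i=1}^k w(C_i)+\sum_{i=0}^k\max\{\sum_{j=1}^{m_i}w(b_{ij}),\sum_{j=1}^{n_i}w(t_{ij})\}\le x_{max}$; and convex continuous cost functions $f_i$ ($i=1,\dots,k$), $g_{ij}$ ($i=0,\dots,k$, $j=1,\dots,m_i$), $h_{ij}$ ($i=0,\dots,k$, $j=1,\dots,n_i$), all $\mathbb{R}\to\mathbb{R}$. A feasible solution consists of reals $(x_i)_{i=1}^k$, $(y_{ij})$, $(z_{ij})$ satisfying, with $x_0:=x_{min}$, $w(C_0):=0$, $x_{k+1}:=x_{max}$: $x_i+w(C_i)\le x_{i+1}$ ($i=0,\dots,k$); $x_i+w(C_i)\le y_{i1}$, $y_{ij}+w(b_{ij})\le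 y_{i,j+1}$ ($j=1,\dots,m_i-1$), $y_{im_i}+w(b_{im_i})\le x_{i+1}$; $x_i+w(C_i)\le z_{i1}$, $z_{ij}+w(t_{ij})\le z_{i,j+1}$ ($j=1,\dots,n_i-1$), $z_{in_i}+w(t_{in_i})\le x_{i+1}$ (all for $i=0,\dots,k$); each constraint applies only if all its variables exist. The task is to find a feasible solution minimizing $\sum_{i=1}^k f_i(x_i)+\sum_{i=0}^k(\sum_{j=1}^{m_i}g_{ij}(y_{ij})+\sum_{j=1}^{n_i}h_{ij}(z_{ij}))$. A function $\mathbb{R}\to\mathbb{R}$ is piecewise quadratic if it is continuous and there are finitely many points $p_1<\dots<p_r$ (its kinks, chosen so that adjacent pieces differ) such that on each of the intervals $(-\infty,p_1],[p_1,p_2],\dots,[p_r,\infty)$ it coincides with a quadratic polynomial $x\mapsto ax^2+bx+c$. Each cost function is given as input by its list of kinks and the coefficient triples of its pieces; arithmetic operations and comparisons on reals take constant time. *)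

theory Defs
  imports "HOL-Analysis.Analysis" "HOL-Library.Landau_Symbols"
begin

section \<open>The Double Row Problem\<close>

text \<open>
  Cells are identified by their indices: \<open>C\<^sub>i\<close> is \<open>i \<in> {1..num_C}\<close>; \<open>b\<^sub>i\<^sub>j\<close> and \<open>t\<^sub>i\<^sub>j\<close> are the pairs
  \<open>(i, j)\<close> with \<open>i \<in> {0..num_C}\<close> and \<open>j \<in> {1..num_b i}\<close>, respectively \<open>j \<in> {1..num_t i}\<close>.
  Values of the fields outside these index ranges are irrelevant.
\<close>

record instance_drp =
  num_C :: nat
  num_b :: "nat \<Rightarrow> nat"
  num_t :: "nat \<Rightarrow> nat"
  width_C :: "nat \<Rightarrow> real"
  width_b :: "nat \<Rightarrow> nat \<Rightarrow> real"
  width_t :: "nat \<Rightarrow> nat \<Rightarrow> real"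
  x_min :: real
  x_max :: real
  cost_C :: "nat \<Rightarrow> real \<Rightarrow> real"
  cost_b :: "nat \<Rightarrow> nat \<Rightarrow> real \<Rightarrow> real"
  cost_t :: "nat \<Rightarrow> nat \<Rightarrow> real \<Rightarrow> real"

definition cost_function :: "(real \<Rightarrow> real) \<Rightarrow> bool" where
  "cost_function f \<longleftrightarrow> convex_on UNIV f \<and> continuous_on UNIV f"

definition double_row_instance :: "instance_drp \<Rightarrow> bool" where
  "double_row_instance I \<longleftrightarrow>
     num_C I \<ge> 1 \<and>
     (\<forall>i\<in>{1..num_C I}. width_C I i > 0 \<and> cost_function (cost_C I i)) \<and>
     (\<forall>i\<in>{0..num_C I}. \<forall>j\<in>{1..num_b I i}. width_b I i j > 0 \<and> cost_function (cost_b I i j)) \<and>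
     (\<forall>i\<in>{0..num_C I}. \<forall>j\<in>{1..num_t I i}. width_t I i j > 0 \<and> cost_function (cost_t I i j)) \<and>
     x_min I + (\<Sum>i=1..num_C I. width_C I i) +
       (\<Sum>i=0..num_C I. max (\<Sum>j=1..num_b I i. width_b I i j) (\<Sum>j=1..num_t I i. width_t I i j))
       \<le> x_max I"

text \<open>The conventions \<open>x\<^sub>0 = x\<^sub>m\<^sub>i\<^sub>n\<close>, \<open>x\<^sub>k\<^sub>+\<^sub>1 = x\<^sub>m\<^sub>a\<^sub>x\<close> and \<open>w(C\<^sub>0) = 0\<close>.\<close>

definition x_ext :: "instance_drp \<Rightarrow> (nat \<Rightarrow> real) \<Rightarrow> nat \<Rightarrow> real" where
  "x_ext I x i = (if i = 0 then x_min I else if i = Suc (num_C I) then x_max I else x i)"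

definition width_C_ext :: "instance_drp \<Rightarrow> nat \<Rightarrow> real" where
  "width_C_ext I i = (if i = 0 then 0 else width_C I i)"

text \<open>Cells \<open>1..n\<close> with widths \<open>w\<close>, placed at \<open>p\<close>, from left to right inside \<open>[l, r]\<close>;
  vacuous if \<open>n = 0\<close>.\<close>

definition row_feasible ::
    "real \<Rightarrow> real \<Rightarrow> nat \<Rightarrow> (nat \<Rightarrow> real) \<Rightarrow> (nat \<Rightarrow> real) \<Rightarrow> bool" where
  "row_feasible l r n w p \<longleftrightarrow>
     (n \<ge> 1 \<longrightarrow> l \<le> p 1) \<and>
     (\<forall>j. 1 \<le> j \<and> j + 1 \<le> n \<longrightarrow> p j + w j \<le> p (j + 1)) \<and>
     (n \<ge> 1 \<longrightarrow> p n + w n \<le> r)"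

definition feasible_solution ::
    "instance_drp \<Rightarrow> (nat \<Rightarrow> real) \<Rightarrow> (nat \<Rightarrow> nat \<Rightarrow> real) \<Rightarrow> (nat \<Rightarrow> nat \<Rightarrow> real) \<Rightarrow> bool" where
  "feasible_solution I x y z \<longleftrightarrow>
     (\<forall>i\<in>{0..num_C I}.
        x_ext I x i + width_C_ext I i \<le> x_ext I x (i + 1) \<and>
        row_feasible (x_ext I x i + width_C_ext I i) (x_ext I x (i + 1))
          (num_b I i) (width_b I i) (y i) \<and>
        row_feasible (x_ext I x i + width_C_ext I i) (x_ext I x (i + 1))
          (num_t I i) (width_t I i) (z i))"

definition total_cost ::
    "instance_drp \<Rightarrow> (nat \<Rightarrow> real) \<Rightarrow> (nat \<Rightarrow> nat \<Rightarrow> real) \<Rightarrow> (nat \<Rightarrow> nat \<Rightarrow> real) \<Rightarrow> real" where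
  "total_cost I x y z =
     (\<Sum>i=1..num_C I. cost_C I i (x i)) +
     (\<Sum>i=0..num_C I. (\<Sum>j=1..num_b I i. cost_b I i j (y i j)) +
                      (\<Sum>j=1..num_t I i. cost_t I i j (z i j)))"

definition optimal_solution ::
    "instance_drp \<Rightarrow> (nat \<Rightarrow> real) \<Rightarrow> (nat \<Rightarrow> nat \<Rightarrow> real) \<Rightarrow> (nat \<Rightarrow> nat \<Rightarrow> real) \<Rightarrow> bool" where
  "optimal_solution I x y z \<longleftrightarrow>
     feasible_solution I x y z \<and>
     (\<forall>x' y' z'. feasible_solution I x' y' z' \<longrightarrow> total_cost I x y z \<le> total_cost I x' y' z')"

definition num_cells :: "instance_drp \<Rightarrow> nat" where
  "num_cells I = num_C I + (\<Sum>i=0..num_C I. num_b I i) + (\<Sum>i=0..num_C I. num_t I i)"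


section \<open>Piecewise quadratic cost functions\<close>

text \<open>A list of kinks and the list of the coefficient triples \<open>(a, b, c)\<close> of the pieces.\<close>

type_synonym pq_data = "real list \<times> (real \<times> real \<times> real) list"

text \<open>Piece \<open>j\<close> lives on the closed interval between \<open>ps ! (j - 1)\<close> and \<open>ps ! j\<close>, unbounded to the
  left for \<open>j = 0\<close> and to the right for \<open>j = length ps\<close>.\<close>

fun pq_represents :: "pq_data \<Rightarrow> (real \<Rightarrow> real) \<Rightarrow> bool" where
  "pq_represents (ps, qs) f \<longleftrightarrow>
     continuous_on UNIV f \<and>
     sorted_wrt (<) ps \<and>
     length qs = length ps + 1 \<and>
     (\<forall>j<length ps. qs ! j \<noteq> qs ! (j + 1)) \<and>
     (\<forall>j\<le>length ps. \<forall>u.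
        (0 < j \<longrightarrow> ps ! (j - 1) \<le> u) \<and> (j < length ps \<longrightarrow> u \<le> ps ! j) \<longrightarrow>
        (case qs ! j of (a, b, c) \<Rightarrow> f u = a * u^2 + b * u + c))"

definition num_kinks :: "pq_data \<Rightarrow> nat" where
  "num_kinks d = length (fst d)"

record costs_pq =
  data_C :: "nat \<Rightarrow> pq_data"
  data_b :: "nat \<Rightarrow> nat \<Rightarrow> pq_data"
  data_t :: "nat \<Rightarrow> nat \<Rightarrow> pq_data"

definition costs_represented :: "costs_pq \<Rightarrow> instance_drp \<Rightarrow> bool" where
  "costs_represented D I \<longleftrightarrow>
     (\<forall>i\<in>{1..num_C I}. pq_represents (data_C D i) (cost_C I i)) \<and>
     (\<forall>i\<in>{0..num_C I}. \<forall>j\<in>{1..num_b I i}. pq_represents (data_b D i j) (cost_b I i j)) \<and>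
     (\<forall>i\<in>{0..num_C I}. \<forall>j\<in>{1..num_t I i}. pq_represents (data_t D i j) (cost_t I i j))"

definition total_kinks :: "instance_drp \<Rightarrow> costs_pq \<Rightarrow> nat" where
  "total_kinks I D =
     (\<Sum>i=1..num_C I. num_kinks (data_C D i)) +
     (\<Sum>i=0..num_C I. (\<Sum>j=1..num_b I i. num_kinks (data_b D i j)) +
                      (\<Sum>j=1..num_t I i. num_kinks (data_t D i j)))"


section \<open>Unit-cost real RAM\<close>

text \<open>
  The memory consists of arrays of natural numbers and arrays of reals, all of them unbounded.
  Array names occur in programs only as literals, so a program uses finitely many arrays, whereas
  indices are computed at run time (indirect addressing). Naturals can be added and subtracted
  (truncated at 0), but not multiplied, divided or obtained by rounding reals, and real literals
  are integers; thus no computational power is hidden in the unit-cost assumption.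
  Division of reals by zero yields zero, as in HOL; a program can always test for it beforehand.
\<close>

record ram_state =
  nats :: "nat \<Rightarrow> nat \<Rightarrow> nat"
  reals :: "nat \<Rightarrow> nat \<Rightarrow> real"

datatype nexp =
    NLit nat
  | NLoad nat nexp
  | NAdd nexp nexp
  | NSub nexp nexp

datatype rexp =
    RLit int
  | RLoad nat nexp
  | RAdd rexp rexp
  | RSub rexp rexp
  | RMul rexp rexp
  | RDiv rexp rexp

datatype bexp =
    NLess nexp nexp
  | RLess rexp rexp
  | BNot bexp
  | BAnd bexp bexp

datatype com =
    Skip
  | NStore nat nexp nexp
  | RStore nat nexp rexp
  | Seq com com
  | Cond bexp com com
  | While bexp com

primrec nval :: "nexp \<Rightarrow> ram_state \<Rightarrow> nat" where
  "nval (NLit n) s = n"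
| "nval (NLoad a e) s = nats s a (nval e s)"
| "nval (NAdd e e') s = nval e s + nval e' s"
| "nval (NSub e e') s = nval e s - nval e' s"

primrec rval :: "rexp \<Rightarrow> ram_state \<Rightarrow> real" where
  "rval (RLit n) s = of_int n"
| "rval (RLoad a e) s = reals s a (nval e s)"
| "rval (RAdd e e') s = rval e s + rval e' s"
| "rval (RSub e e') s = rval e s - rval e' s"
| "rval (RMul e e') s = rval e s * rval e' s"
| "rval (RDiv e e') s = rval e s / rval e' s"

primrec bval :: "bexp \<Rightarrow> ram_state \<Rightarrow> bool" where
  "bval (NLess e e') s \<longleftrightarrow> nval e s < nval e' s"
| "bval (RLess e e') s \<longleftrightarrow> rval e s < rval e' s"
| "bval (BNot b) s \<longleftrightarrow> \<not> bval b s"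
| "bval (BAnd b b') s \<longleftrightarrow> bval b s \<and> bval b' s"

primrec ntime :: "nexp \<Rightarrow> nat" where
  "ntime (NLit n) = 1"
| "ntime (NLoad a e) = 1 + ntime e"
| "ntime (NAdd e e') = 1 + ntime e + ntime e'"
| "ntime (NSub e e') = 1 + ntime e + ntime e'"

primrec rtime :: "rexp \<Rightarrow> nat" where
  "rtime (RLit n) = 1"
| "rtime (RLoad a e) = 1 + ntime e"
| "rtime (RAdd e e') = 1 + rtime e + rtime e'"
| "rtime (RSub e e') = 1 + rtime e + rtime e'"
| "rtime (RMul e e') = 1 + rtime e + rtime e'"
| "rtime (RDiv e e') = 1 + rtime e + rtime e'"

primrec btime :: "bexp \<Rightarrow> nat" where
  "btime (NLess e e') = 1 + ntime e + ntime e'"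
| "btime (RLess e e') = 1 + rtime e + rtime e'"
| "btime (BNot b) = 1 + btime b"
| "btime (BAnd b b') = 1 + btime b + btime b'"

text \<open>\<open>exec c s t s'\<close>: started in state \<open>s\<close>, the program \<open>c\<close> halts after time \<open>t\<close> in state \<open>s'\<close>.\<close>

inductive exec :: "com \<Rightarrow> ram_state \<Rightarrow> nat \<Rightarrow> ram_state \<Rightarrow> bool" where
  Skip: "exec Skip s 1 s"
| NStore: "exec (NStore a e v) s (1 + ntime e + ntime v)
    (s\<lparr>nats := (nats s)(a := (nats s a)(nval e s := nval v s))\<rparr>)"
| RStore: "exec (RStore a e v) s (1 + ntime e + rtime v)
    (s\<lparr>reals := (reals s)(a := (reals s a)(nval e s := rval v s))\<rparr>)"
| Seq: "exec c s t s' \<Longrightarrow> exec c' s' t' s'' \<Longrightarrow> exec (Seq c c') s (t + t') s''"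
| CondTrue: "bval b s \<Longrightarrow> exec c s t s' \<Longrightarrow> exec (Cond b c c') s (1 + btime b + t) s'"
| CondFalse: "\<not> bval b s \<Longrightarrow> exec c' s t s' \<Longrightarrow> exec (Cond b c c') s (1 + btime b + t) s'"
| WhileFalse: "\<not> bval b s \<Longrightarrow> exec (While b c) s (1 + btime b) s"
| WhileTrue: "bval b s \<Longrightarrow> exec c s t s' \<Longrightarrow> exec (While b c) s' t' s'' \<Longrightarrow>
    exec (While b c) s (1 + btime b + t + t') s''"

inductive_cases exec_elims:
  "exec Skip s t s'"
  "exec (NStore a e v) s t s'"
  "exec (RStore a e v) s t s'"
  "exec (Seq c c') s t s'"
  "exec (Cond b c c') s t s'"
  "exec (While b c) s t s'"

lemma exec_deterministic:
  "exec c s t s' \<Longrightarrow> exec c s u s'' \<Longrightarrow> t = u \<and> s' = s''"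
proof (induction arbitrary: u s'' rule: exec.induct)
  case Skip then show ?case by (elim exec_elims(1)) simp_all
next
  case NStore then show ?case by (elim exec_elims(2)) simp_all
next
  case RStore then show ?case by (elim exec_elims(3)) simp_all
next
  case (Seq c s t s' c' t' s'' u r)
  from Seq.prems obtain t1 s1 t2 where "exec c s t1 s1" "exec c' s1 t2 r" "u = t1 + t2"
    by (rule exec_elims(4))
  then show ?case using Seq.IH by metis
next
  case (CondTrue b s c t s' c' u r)
  from CondTrue.prems CondTrue.hyps(1) obtain t1 where "exec c s t1 r" "u = 1 + btime b + t1"
    by (elim exec_elims(5)) simp_all
  then show ?case using CondTrue.IH by metis
next
  case (CondFalse b s c' t s' c u r)
  from CondFalse.prems CondFalse.hyps(1) obtain t1 where "exec c' s t1 r" "u = 1 + btime b + t1"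
    by (elim exec_elims(5)) simp_all
  then show ?case using CondFalse.IH by metis
next
  case (WhileFalse b s c u r)
  show ?case
    by (rule exec_elims(6)[OF WhileFalse.prems]) (use WhileFalse.hyps in simp_all)
next
  case (WhileTrue b s c t s' t' s'' u r)
  obtain t1 s1 t2 where "exec c s t1 s1" "exec (While b c) s1 t2 r" "u = 1 + btime b + t1 + t2"
    by (rule exec_elims(6)[OF WhileTrue.prems]) (use WhileTrue.hyps(1) in simp_all)
  then show ?case using WhileTrue.IH by metis
qed


section \<open>Input and output\<close>

text \<open>One entry per cell: double-row cells, then bottom cells, then top cells, the single-row cells
  in lexicographic order of their indices.\<close>

definition cell_list ::
    "instance_drp \<Rightarrow> (nat \<Rightarrow> 'a) \<Rightarrow> (nat \<Rightarrow> nat \<Rightarrow> 'a) \<Rightarrow> (nat \<Rightarrow> nat \<Rightarrow> 'a) \<Rightarrow> 'a list" where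
  "cell_list I p q r =
     map p [1..<num_C I + 1] @
     concat (map (\<lambda>i. map (q i) [1..<num_b I i + 1]) [0..<num_C I + 1]) @
     concat (map (\<lambda>i. map (r i) [1..<num_t I i + 1]) [0..<num_C I + 1])"

definition pq_reals :: "pq_data \<Rightarrow> real list" where
  "pq_reals d = fst d @ concat (map (\<lambda>(a, b, c). [a, b, c]) (snd d))"

definition input_nats :: "instance_drp \<Rightarrow> costs_pq \<Rightarrow> nat list" where
  "input_nats I D =
     [num_C I] @ map (num_b I) [0..<num_C I + 1] @ map (num_t I) [0..<num_C I + 1] @
     cell_list I (\<lambda>i. num_kinks (data_C D i))
       (\<lambda>i j. num_kinks (data_b D i j)) (\<lambda>i j. num_kinks (data_t D i j))"

definition input_reals :: "instance_drp \<Rightarrow> costs_pq \<Rightarrow> real list" where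
  "input_reals I D =
     [x_min I, x_max I] @
     cell_list I (width_C I) (width_b I) (width_t I) @
     concat (cell_list I (\<lambda>i. pq_reals (data_C D i))
       (\<lambda>i j. pq_reals (data_b D i j)) (\<lambda>i j. pq_reals (data_t D i j)))"

text \<open>The input occupies the arrays with name 0; everything else is initially zero.\<close>

definition array_of :: "'a::zero list \<Rightarrow> nat \<Rightarrow> 'a" where
  "array_of xs l = (if l < length xs then xs ! l else 0)"

definition initial_state :: "instance_drp \<Rightarrow> costs_pq \<Rightarrow> ram_state" where
  "initial_state I D =
     \<lparr>nats = (\<lambda>_ _. 0)(0 := array_of (input_nats I D)),
      reals = (\<lambda>_ _. 0)(0 := array_of (input_reals I D))\<rparr>"

text \<open>The output is the beginning of the array of reals with name 1.\<close>

definition outputs_solution ::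
    "instance_drp \<Rightarrow> ram_state \<Rightarrow> (nat \<Rightarrow> real) \<Rightarrow> (nat \<Rightarrow> nat \<Rightarrow> real) \<Rightarrow> (nat \<Rightarrow> nat \<Rightarrow> real) \<Rightarrow> bool" where
  "outputs_solution I s x y z \<longleftrightarrow>
     map (reals s 1) [0..<num_cells I] = cell_list I x y z"

end

theory Submission imports Defs "HOL-Real_Asymp.Real_Asymp" begin

text \<open>
  Subtracting the widths of the preceding cells turns the order constraints of a row into
  \<open>u\<^sub>1 \<le> \<dots> \<le> u\<^sub>m\<close> with common bounds \<open>l \<le> u\<^sub>j \<le> r\<close> given by the neighbouring double-row cells. If
  \<open>u\<close> is optimal for \<open>[x_min, x_max]\<close>, then clipping \<open>u\<close> to \<open>[l, r]\<close> is optimal for every smaller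
  interval. As \<open>f (clip l r u) = f (max l u) + f (min r u) - f u\<close> for \<open>l \<le> r\<close>, the optimal cost of the
  rows is a sum of functions of a single double-row position each, and it is jointly convex; so the
  double-row cells form one more chain with convex costs.

  A chain with convex piecewise quadratic costs is solved by dynamic programming: if \<open>V\<close> is the
  optimal cost of a prefix as a function of its last position and \<open>m\<close> the minimiser of \<open>V\<close>, then the
  next stage starts from \<open>x \<mapsto> V (min x m)\<close>. A sum of terms \<open>a y\<^sup>2 + b y\<close> with \<open>y = min x p\<close> represents
  \<open>V\<close>; the keys \<open>p\<close> to the right of \<open>m\<close> are removed and replaced by the single key \<open>m\<close>. With the keys in
  a tournament tree every insertion and every removal costs logarithmic time.
\<close>

text \<open>The clipping identity separates the two sides of a row, but it does not make the two
  halves convex. Convexity comes from optimality: if one side is fixed at the end of a large box, a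
  half is the optimal cost of a row whose bounds are affine in one parameter, hence a partial
  minimum of a jointly convex function. One solution \<open>U\<close> serves all parameters, so the
  rows are solved only once.

  A half is a sum of terms \<open>f (clip a b x + o)\<close>. Such a term enters the queue straight
  from the stored data of \<open>f\<close>, with three real parameters, and each row cell yields at
  most two of them; so the second chain has linear size and the same solver handles both.

  The double-row cells form a chain with common bounds after subtracting
  \<open>double_offset\<close>, the least space needed to the left of a cell.

  The queue drops additive constants, so costs are tracked only up to constants. The time is charged
  to queue slots: two per quadratic piece and one per stage, each prepaying its own removal. As the
  machine neither multiplies nor halves naturals, parents in the tree are tabulated and the tree
  size is a sum of input sizes.\<close>

definition clip :: "real \<Rightarrow> real \<Rightarrow> real \<Rightarrow> real" where
  "clip a b x = max a (min b x)"

section \<open>Exchange and truncation for convex functions on an interval\<close>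

lemma convex_on_exchange:
  fixes f :: "real \<Rightarrow> real"
  assumes "convex_on {a..b} f" "a \<le> x" "y \<le> b" "x \<le> p" "p \<le> y" "p + q = x + y"
  shows "f p + f q \<le> f x + f y"
proof (cases "x = y")
  case False
  \<comment> \<open>\<open>p\<close> and \<open>q\<close> are convex combinations of
    \<open>x\<close> and \<open>y\<close> with the two weights interchanged, so the two convexity
    inequalities add up.\<close>
  define t where "t = (p - x) / (y - x)"
  have "x < y" using False assms by linarith
  have t: "0 \<le> t" "t \<le> 1" using assms \<open>x < y\<close> unfolding t_def by (simp_all add: field_simps)
  have mem: "x \<in> {a..b}" "y \<in> {a..b}" using assms by auto
  have tt: "t * (y - x) = p - x" using \<open>x < y\<close> unfolding t_def by simp
  have p: "p = (1 - t) * x + t * y" using tt by (simp add: algebra_simps)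
  have q: "q = (1 - (1 - t)) * x + (1 - t) * y" using tt assms(6) by (simp add: algebra_simps)
  have "f p \<le> (1 - t) * f x + t * f y"
    using convex_onD[OF assms(1) t mem] p by simp
  moreover have "f q \<le> (1 - (1 - t)) * f x + (1 - t) * f y"
    using convex_onD[OF assms(1) _ _ mem, of "1 - t"] t q by simp
  ultimately show ?thesis by (simp add: algebra_simps)
next
  case True
  then have "p = x" "q = x" using assms by auto
  then show ?thesis using True by simp
qed

text \<open>The pair \<open>x\<close>, \<open>m\<close> is exchanged for \<open>y\<close>,
  \<open>x + m - y\<close>, and the value at the latter point is at least
  \<open>f m\<close>.\<close>

lemma convex_on_antimono_left_of_argmin:
  fixes f :: "real \<Rightarrow> real"
  assumes "convex_on {a..b} f" "m \<in> {a..b}" "\<And>x. x \<in> {a..b} \<Longrightarrow> f m \<le> f x"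
    and "a \<le> x" "x \<le> y" "y \<le> m"
  shows "f y \<le> f x"
proof -
  have "f y + f (x + m - y) \<le> f x + f m"
    by (rule convex_on_exchange[OF assms(1)]) (use assms in auto)
  moreover have "f m \<le> f (x + m - y)" by (rule assms(3)) (use assms in auto)
  ultimately show ?thesis by simp
qed

text \<open>To the left of a minimiser the function is antitone, so continuing it by its minimum
  keeps it convex. The result holds on the whole ray because the box of the next stage may extend
  beyond \<open>b\<close>.\<close>

lemma convex_on_min_argmin:
  fixes f :: "real \<Rightarrow> real"
  assumes cv: "convex_on {a..b} f" and m: "m \<in> {a..b}" and opt: "\<And>x. x \<in> {a..b} \<Longrightarrow> f m \<le> f x"
  shows "convex_on {a..} (\<lambda>x. f (min x m))"
proof (rule convex_onI)
  fix t x y :: real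
  assume t: "0 < t" "t < 1" and xy: "x \<in> {a..}" "y \<in> {a..}"
  let ?z = "(1 - t) * min x m + t * min y m"
  have le: "?z \<le> (1 - t) * x + t * y" using t by (intro add_mono mult_left_mono) auto
  have lem: "?z \<le> (1 - t) * m + t * m" using t by (intro add_mono mult_left_mono) auto
  have ge: "(1 - t) * a + t * a \<le> ?z" using t xy m by (intro add_mono mult_left_mono) auto
  have "?z \<le> min ((1 - t) * x + t * y) m" using le lem by (simp add: algebra_simps)
  \<comment> \<open>\<open>?z\<close>, the combination of the truncated points, lies to the left of
    the truncated combination, and \<open>f\<close> is antitone there.\<close>
  then have "f (min ((1 - t) * x + t * y) m) \<le> f ?z"
    by (intro convex_on_antimono_left_of_argmin[OF cv m opt]) (use ge in \<open>auto simp: algebra_simps\<close>)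
  also have "\<dots> \<le> (1 - t) * f (min x m) + t * f (min y m)"
    using convex_onD[OF cv, of t "min x m" "min y m"] t xy m by auto
  finally show "f (min ((1 - t) *\<^sub>R x + t *\<^sub>R y) m) \<le> (1 - t) * f (min x m) + t * f (min y m)"
    by simp
qed simp

section \<open>Isotonic chains\<close>

definition chain_feasible :: "nat \<Rightarrow> (nat \<Rightarrow> real) \<Rightarrow> (nat \<Rightarrow> real) \<Rightarrow> (nat \<Rightarrow> real) \<Rightarrow> bool" where
  "chain_feasible S lo hi u \<longleftrightarrow>
     (\<forall>s<S. lo s \<le> u s \<and> u s \<le> hi s) \<and> (\<forall>s. Suc s < S \<longrightarrow> u s \<le> u (Suc s))"

definition chain_optimal :: "nat \<Rightarrow> (nat \<Rightarrow> real) \<Rightarrow> (nat \<Rightarrow> real) \<Rightarrow> (nat \<Rightarrow> real \<Rightarrow> real) \<Rightarrow>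
    (nat \<Rightarrow> real) \<Rightarrow> bool" where
  "chain_optimal S lo hi F u \<longleftrightarrow> chain_feasible S lo hi u \<and>
     (\<forall>w. chain_feasible S lo hi w \<longrightarrow> (\<Sum>s<S. F s (u s)) \<le> (\<Sum>s<S. F s (w s)))"

text \<open>If every \<open>m t\<close> minimises its stage function on its box, this is the least
  cost of the first \<open>s\<close> elements when the last one is at most \<open>x\<close> (for
  \<open>x\<close> not left of its box). The minimisers are a parameter, so that the array filled by
  the program can be inserted for them.\<close>

fun value_fun :: "(nat \<Rightarrow> real \<Rightarrow> real) \<Rightarrow> (nat \<Rightarrow> real) \<Rightarrow> nat \<Rightarrow> real \<Rightarrow> real" where
  "value_fun F m 0 x = 0"
| "value_fun F m (Suc s) x = value_fun F m s (min x (m s)) + F s (min x (m s))"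

definition argmin_on :: "real \<Rightarrow> real \<Rightarrow> (real \<Rightarrow> real) \<Rightarrow> real \<Rightarrow> bool" where
  "argmin_on a b f m \<longleftrightarrow> a \<le> m \<and> m \<le> b \<and> (\<forall>x. a \<le> x \<and> x \<le> b \<longrightarrow> f m \<le> f x)"

definition chain_boxes :: "nat \<Rightarrow> (nat \<Rightarrow> real) \<Rightarrow> (nat \<Rightarrow> real) \<Rightarrow> (nat \<Rightarrow> real \<Rightarrow> real) \<Rightarrow> bool" where
  "chain_boxes S lo hi F \<longleftrightarrow>
     (\<forall>s<S. lo s \<le> hi s \<and> convex_on {lo s..hi s} (F s)) \<and>
     (\<forall>s. Suc s < S \<longrightarrow> lo s \<le> lo (Suc s) \<and> hi s \<le> hi (Suc s))"

text \<open>The objective before truncation; up to a constant, the queue represents it when all jobs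
  of stage \<open>s\<close> have been inserted.\<close>

definition stage_fun :: "(nat \<Rightarrow> real \<Rightarrow> real) \<Rightarrow> (nat \<Rightarrow> real) \<Rightarrow> nat \<Rightarrow> real \<Rightarrow> real" where
  "stage_fun F m s x = value_fun F m s x + F s x"

lemma value_fun_Suc_stage: "value_fun F m (Suc s) x = stage_fun F m s (min x (m s))"
  by (simp add: stage_fun_def)

lemma value_fun_cong: "(\<And>t. t < s \<Longrightarrow> m t = m' t) \<Longrightarrow> value_fun F m s x = value_fun F m' s x"
  by (induction s arbitrary: x) auto

lemma stage_fun_cong: "(\<And>t. t < s \<Longrightarrow> m t = m' t) \<Longrightarrow> stage_fun F m s x = stage_fun F m' s x"
  unfolding stage_fun_def using value_fun_cong[of s m m'] by simp

lemma stage_fun_convex: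
  assumes bx: "chain_boxes S lo hi F" and "s < S"
    and opt: "\<And>t. t < s \<Longrightarrow> argmin_on (lo t) (hi t) (stage_fun F m t) (m t)"
  shows "convex_on {lo s..hi s} (stage_fun F m s)"
  using assms(2,3)
proof (induction s)
  case 0
  then show ?case using bx by (simp add: stage_fun_def chain_boxes_def)
next
  case (Suc s)
  have cv: "convex_on {lo s..hi s} (stage_fun F m s)" using Suc by simp
  have "convex_on {lo s..} (\<lambda>x. stage_fun F m s (min x (m s)))"
    by (rule convex_on_min_argmin[OF cv]) (use Suc.prems(2)[of s] in \<open>auto simp: argmin_on_def\<close>)
  then have "convex_on {lo (Suc s)..hi (Suc s)} (\<lambda>x. stage_fun F m s (min x (m s)))"
    by (rule convex_on_subset) (use bx Suc.prems(1) in \<open>fastforce simp: chain_boxes_def\<close>)+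
  moreover have "convex_on {lo (Suc s)..hi (Suc s)} (F (Suc s))"
    using bx Suc.prems(1) by (simp add: chain_boxes_def)
  ultimately have "convex_on {lo (Suc s)..hi (Suc s)} (\<lambda>x. stage_fun F m s (min x (m s)) + F (Suc s) x)"
    by (rule convex_on_add)
  then show ?case by (simp add: stage_fun_def[of F m "Suc s", abs_def] value_fun_Suc_stage del: value_fun.simps)
qed

text \<open>Induction along the chain. If \<open>m s \<le> x\<close>, the minimum of the stage is a
  lower bound; otherwise \<open>w s \<le> x \<le> m s\<close>, where the stage function is
  antitone.\<close>

lemma value_fun_lower_bound:
  assumes bx: "chain_boxes S lo hi F" and w: "chain_feasible S lo hi w"
    and opt: "\<And>t. t < S \<Longrightarrow> argmin_on (lo t) (hi t) (stage_fun F m t) (m t)"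
    and "s < S" "w s \<le> x"
  shows "value_fun F m (Suc s) x \<le> (\<Sum>t<Suc s. F t (w t))"
  using assms(4,5)
proof (induction s arbitrary: x)
  case (0 x)
  have ar: "argmin_on (lo 0) (hi 0) (stage_fun F m 0) (m 0)" using opt 0 by simp
  have cv: "convex_on {lo 0..hi 0} (stage_fun F m 0)" using stage_fun_convex[OF bx] 0 by simp
  have w0: "lo 0 \<le> w 0" "w 0 \<le> hi 0" using w 0 by (auto simp: chain_feasible_def)
  have "stage_fun F m 0 (min x (m 0)) \<le> stage_fun F m 0 (w 0)"
  proof (cases "m 0 \<le> x")
    case True then show ?thesis using ar w0 by (simp add: argmin_on_def min_absorb2)
  next
    case False then show ?thesis
      using convex_on_antimono_left_of_argmin[OF cv, of "m 0" "w 0" x] ar w0 0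
      by (auto simp: argmin_on_def min_absorb1)
  qed
  then show ?case by (simp add: stage_fun_def)
next
  case (Suc s x)
  let ?s = "Suc s"
  have ar: "argmin_on (lo ?s) (hi ?s) (stage_fun F m ?s) (m ?s)" using opt Suc by blast
  have cv: "convex_on {lo ?s..hi ?s} (stage_fun F m ?s)"
    by (rule stage_fun_convex[OF bx]) (use opt Suc in auto)
  have ws: "lo ?s \<le> w ?s" "w ?s \<le> hi ?s" "w s \<le> w ?s" using w Suc by (auto simp: chain_feasible_def)
  have "stage_fun F m ?s (min x (m ?s)) \<le> stage_fun F m ?s (w ?s)"
  proof (cases "m ?s \<le> x")
    case True then show ?thesis using ar ws by (simp add: argmin_on_def min_absorb2)
  next
    case False then show ?thesis
      using convex_on_antimono_left_of_argmin[OF cv, of "m ?s" "w ?s" x] ar ws Suc.prems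
      by (auto simp: argmin_on_def min_absorb1)
  qed
  also have "\<dots> \<le> (\<Sum>t<Suc s. F t (w t)) + F ?s (w ?s)"
    using Suc.IH[of "w ?s"] Suc.prems ws by (simp add: stage_fun_def del: value_fun.simps)
  finally show ?case by (simp add: value_fun_Suc_stage del: value_fun.simps)
qed

text \<open>Along \<open>u\<close> every truncation inside \<open>value_fun\<close> already has the
  right value, so the lower bound of \<open>value_fun_lower_bound\<close> is attained.\<close>

lemma backtrack_optimal:
  assumes bx: "chain_boxes S lo hi F"
    and opt: "\<And>t. t < S \<Longrightarrow> argmin_on (lo t) (hi t) (stage_fun F m t) (m t)"
    and last: "\<And>s. Suc s = S \<Longrightarrow> u s = m s"
    and step: "\<And>s. Suc s < S \<Longrightarrow> u s = min (m s) (u (Suc s))"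
  shows "chain_optimal S lo hi F u"
proof -
  have um: "u s \<le> m s" if "s < S" for s
  proof (cases "Suc s = S")
    case False then show ?thesis using step[of s] that by simp
  qed (use last[of s] in simp)
  have lob: "lo s \<le> u s" if "s < S" for s
    using that
  proof (induction "S - s" arbitrary: s)
    case (Suc d s)
    show ?case
    proof (cases "Suc s = S")
      case True then show ?thesis using last[of s] opt[of s] Suc by (simp add: argmin_on_def)
    next
      case False
      then have "lo (Suc s) \<le> u (Suc s)" "lo s \<le> lo (Suc s)" "lo s \<le> m s"
        using Suc bx opt[of s] by (auto simp: chain_boxes_def argmin_on_def)
      then show ?thesis using step[of s] False Suc.prems by simp
    qed
  qed simp
  have fe: "chain_feasible S lo hi u"
    unfolding chain_feasible_def
  proof (intro conjI allI impI)
    fix s assume "s < S"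
    then show "lo s \<le> u s" "u s \<le> hi s" using lob um[of s] opt[of s] by (auto simp: argmin_on_def)
  next
    fix s assume "Suc s < S" then show "u s \<le> u (Suc s)" using step by simp
  qed
  have att: "(\<Sum>t<Suc s. F t (u t)) = value_fun F m (Suc s) (u s)" if "s < S" for s
    using that
  proof (induction s)
    case 0 then show ?case using um[of 0] by (simp add: min_absorb1)
  next
    case (Suc s)
    have a: "min (u (Suc s)) (m s) = u s" using step[of s] Suc.prems by (simp add: min.commute)
    have b: "min (u s) (m s) = u s" using um[of s] Suc.prems by (simp add: min_absorb1)
    have c: "value_fun F m (Suc s) (u (Suc s)) = value_fun F m (Suc s) (u s)"
      by (simp add: a b)
    have "value_fun F m (Suc (Suc s)) (u (Suc s)) = value_fun F m (Suc s) (u s) + F (Suc s) (u (Suc s))"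
      using c um[OF Suc.prems] by (subst value_fun.simps(2)) (simp add: min_absorb1 del: value_fun.simps)
    then show ?case using Suc by (simp del: value_fun.simps)
  qed
  show ?thesis
  proof (cases S)
    case 0 then show ?thesis by (simp add: chain_optimal_def chain_feasible_def)
  next
    case (Suc s)
    have "(\<Sum>t<S. F t (u t)) \<le> (\<Sum>t<S. F t (w t))" if w: "chain_feasible S lo hi w" for w
    proof -
      \<comment> \<open>The lower bound needs an argument to the right of \<open>w s\<close>. As the
        last \<open>u s\<close> is the minimiser \<open>m s\<close>, \<open>value_fun\<close> is
        constant from \<open>u s\<close> on, so the maximum changes nothing.\<close>
      have "value_fun F m (Suc s) (max (u s) (w s)) \<le> (\<Sum>t<Suc s. F t (w t))"
        by (rule value_fun_lower_bound[OF bx w opt]) (use Suc in auto)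
      moreover have "value_fun F m (Suc s) (max (u s) (w s)) = value_fun F m (Suc s) (u s)"
        using last[of s] Suc by simp
      ultimately show ?thesis using att[of s] Suc by simp
    qed
    then show ?thesis using fe by (simp add: chain_optimal_def)
  qed
qed

text \<open>Adjacent chain elements are either restricted to the same interval or, as members of different
  blocks, separated by their boxes.\<close>

definition block_bounds :: "nat \<Rightarrow> (nat \<Rightarrow> real) \<Rightarrow> (nat \<Rightarrow> real) \<Rightarrow> (nat \<Rightarrow> real) \<Rightarrow> (nat \<Rightarrow> real) \<Rightarrow> bool" where
  "block_bounds S lo hi l r \<longleftrightarrow>
     (\<forall>s<S. lo s \<le> l s \<and> l s \<le> r s \<and> r s \<le> hi s) \<and>
     (\<forall>s. Suc s < S \<longrightarrow> hi s \<le> lo (Suc s) \<or> (l s = l (Suc s) \<and> r s = r (Suc s)))"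

text \<open>Exchange argument. The amount that clipping takes away from \<open>u\<close> is added to
  a competitor \<open>v\<close>. The result \<open>v'\<close> is feasible for the large boxes, and
  elementwise the costs of the clipped \<open>u\<close> and of \<open>v'\<close> together do not
  exceed those of \<open>u\<close> and \<open>v\<close>. Optimality of \<open>u\<close> against
  \<open>v'\<close> then cancels the rest.\<close>

lemma clip_optimal:
  assumes bx: "chain_boxes S lo hi F" and u: "chain_optimal S lo hi F u"
    and bb: "block_bounds S lo hi l r"
  shows "chain_optimal S l r F (\<lambda>s. clip (l s) (r s) (u s))"
proof -
  let ?c = "\<lambda>s. clip (l s) (r s) (u s)"
  have uf: "chain_feasible S lo hi u" using u by (simp add: chain_optimal_def)
  have fe: "chain_feasible S l r ?c"
    unfolding chain_feasible_def
  proof (intro conjI allI impI)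
    fix s assume "s < S"
    then show "l s \<le> ?c s" "?c s \<le> r s" using bb by (auto simp: block_bounds_def clip_def)
  next
    fix s assume s: "Suc s < S"
    have "u s \<le> u (Suc s)" using uf s by (simp add: chain_feasible_def)
    moreover have "l s \<le> r s" "r s \<le> hi s" "lo (Suc s) \<le> l (Suc s)"
      using bb s by (auto simp: block_bounds_def)
    moreover have "hi s \<le> lo (Suc s) \<or> (l s = l (Suc s) \<and> r s = r (Suc s))"
      using bb s by (simp add: block_bounds_def)
    ultimately show "?c s \<le> ?c (Suc s)" unfolding clip_def by (auto simp: max_def min_def)
  qed
  have "(\<Sum>s<S. F s (?c s)) \<le> (\<Sum>s<S. F s (v s))" if v: "chain_feasible S l r v" for v
  proof -
    define v' where "v' s = v s + (u s - ?c s)" for s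
    have btw: "F s (?c s) + F s (v' s) \<le> F s (u s) + F s (v s) \<and> lo s \<le> v' s \<and> v' s \<le> hi s"
      if s: "s < S" for s
    proof -
      have b: "lo s \<le> l s" "l s \<le> r s" "r s \<le> hi s" "l s \<le> v s" "v s \<le> r s" "lo s \<le> u s" "u s \<le> hi s"
        using bb v uf s by (auto simp: block_bounds_def chain_feasible_def)
      have cv: "convex_on {lo s..hi s} (F s)" using bx s by (simp add: chain_boxes_def)
      consider "u s > r s" | "u s < l s" | "l s \<le> u s" "u s \<le> r s" by linarith
      then show ?thesis
      proof cases
        case 1
        have c: "?c s = r s" using 1 b by (simp add: clip_def)
        have "F s (r s) + F s (v' s) \<le> F s (v s) + F s (u s)"
          by (rule convex_on_exchange[OF cv]) (use b 1 c in \<open>auto simp: v'_def\<close>)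
        then show ?thesis using b 1 c by (auto simp: v'_def)
      next
        case 2
        have c: "?c s = l s" using 2 b by (simp add: clip_def)
        have "F s (l s) + F s (v' s) \<le> F s (u s) + F s (v s)"
          by (rule convex_on_exchange[OF cv]) (use b 2 c in \<open>auto simp: v'_def\<close>)
        then show ?thesis using b 2 c by (auto simp: v'_def)
      next
        case 3
        then have "?c s = u s" by (simp add: clip_def)
        then show ?thesis using b by (simp add: v'_def)
      qed
    qed
    have "chain_feasible S lo hi v'"
      unfolding chain_feasible_def
    proof (intro conjI allI impI)
      fix s assume "s < S" then show "lo s \<le> v' s" "v' s \<le> hi s" using btw by auto
    next
      fix s assume s: "Suc s < S"
      have uu: "u s \<le> u (Suc s)" "v s \<le> v (Suc s)" using uf v s by (auto simp: chain_feasible_def)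
      have "hi s \<le> lo (Suc s) \<or> (l s = l (Suc s) \<and> r s = r (Suc s))"
        using bb s by (simp add: block_bounds_def)
      then show "v' s \<le> v' (Suc s)"
      proof
        assume "hi s \<le> lo (Suc s)"
        then show ?thesis using btw[of s] btw[of "Suc s"] s by auto
      next
        \<comment> \<open>For common bounds the amount removed by clipping is monotone in
          \<open>u\<close>, so adding it preserves the order of \<open>v\<close>.\<close>
        assume e: "l s = l (Suc s) \<and> r s = r (Suc s)"
        then show ?thesis using uu unfolding v'_def clip_def by (auto simp: max_def min_def)
      qed
    qed
    then have "(\<Sum>s<S. F s (u s)) \<le> (\<Sum>s<S. F s (v' s))" using u by (simp add: chain_optimal_def)
    moreover have "(\<Sum>s<S. F s (?c s) + F s (v' s)) \<le> (\<Sum>s<S. F s (u s) + F s (v s))"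
      by (rule sum_mono) (use btw in auto)
    ultimately show ?thesis by (simp add: sum.distrib)
  qed
  then show ?thesis using fe by (simp add: chain_optimal_def)
qed

text \<open>A partial minimum of a jointly convex function: by \<open>clip_optimal\<close> the sum
  is the optimal value for the parameter \<open>x\<close>. As the bounds are affine in
  \<open>x\<close>, the combination of the optima for two parameters is a competitor for the
  combined parameter.\<close>

lemma clipped_cost_convex:
  assumes bx: "chain_boxes S lo hi F" and u: "chain_optimal S lo hi F u"
    and l: "\<And>s t x y. s < S \<Longrightarrow> l s ((1 - t) * x + t * y) = (1 - t) * l s x + t * l s y"
    and r: "\<And>s t x y. s < S \<Longrightarrow> r s ((1 - t) * x + t * y) = (1 - t) * r s x + t * r s y"
    and bb: "\<And>x. x \<in> {a..b} \<Longrightarrow> block_bounds S lo hi (\<lambda>s. l s x) (\<lambda>s. r s x)"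
  shows "convex_on {a..b} (\<lambda>x. \<Sum>s<S. F s (clip (l s x) (r s x) (u s)))"
proof (rule convex_onI)
  fix t x y :: real
  assume t: "0 < t" "t < 1" and xy: "x \<in> {a..b}" "y \<in> {a..b}"
  let ?z = "(1 - t) * x + t * y" and ?c = "\<lambda>x s. clip (l s x) (r s x) (u s)"
  let ?w = "\<lambda>s. (1 - t) * ?c x s + t * ?c y s"
  have z: "?z \<in> {a..b}"
    using convexD_alt[of "{a..b}" x y t] t xy by simp
  have op: "chain_optimal S (\<lambda>s. l s x) (\<lambda>s. r s x) F (?c x)" if "x \<in> {a..b}" for x
    by (rule clip_optimal[OF bx u bb[OF that]])
  have fe: "chain_feasible S (\<lambda>s. l s x) (\<lambda>s. r s x) (?c x)" if "x \<in> {a..b}" for x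
    using op[OF that] by (simp add: chain_optimal_def)
  have "chain_feasible S (\<lambda>s. l s ?z) (\<lambda>s. r s ?z) ?w"
    using fe[OF xy(1)] fe[OF xy(2)] t unfolding chain_feasible_def
    by (auto simp: l r intro!: add_mono mult_left_mono)
  then have "(\<Sum>s<S. F s (?c ?z s)) \<le> (\<Sum>s<S. F s (?w s))"
    using op[OF z] by (simp add: chain_optimal_def)
  also have "\<dots> \<le> (\<Sum>s<S. (1 - t) * F s (?c x s) + t * F s (?c y s))"
  proof (rule sum_mono)
    fix s assume "s \<in> {..<S}"
    then have s: "s < S" by simp
    have cv: "convex_on {lo s..hi s} (F s)" using bx s by (simp add: chain_boxes_def)
    have "?c x s \<in> {lo s..hi s}" if "x \<in> {a..b}" for x
      using fe[OF that] bb[OF that] s by (fastforce simp: chain_feasible_def block_bounds_def)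
    then show "F s (?w s) \<le> (1 - t) * F s (?c x s) + t * F s (?c y s)"
      using convex_onD[OF cv, of t "?c x s" "?c y s"] t xy by simp
  qed
  finally show "(\<Sum>s<S. F s (?c ((1 - t) *\<^sub>R x + t *\<^sub>R y) s)) \<le>
      (1 - t) * (\<Sum>s<S. F s (?c x s)) + t * (\<Sum>s<S. F s (?c y s))"
    by (simp add: sum.distrib sum_distrib_left)
qed simp

section \<open>Running programs\<close>

definition set_nat :: "ram_state \<Rightarrow> nat \<Rightarrow> nat \<Rightarrow> nat \<Rightarrow> ram_state" where
  "set_nat s a i v = s\<lparr>nats := (nats s)(a := (nats s a)(i := v))\<rparr>"

definition set_real :: "ram_state \<Rightarrow> nat \<Rightarrow> nat \<Rightarrow> real \<Rightarrow> ram_state" where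
  "set_real s a i v = s\<lparr>reals := (reals s)(a := (reals s a)(i := v))\<rparr>"

lemma nats_set_nat [simp]: "nats (set_nat s a i v) = (nats s)(a := (nats s a)(i := v))"
  and reals_set_nat [simp]: "reals (set_nat s a i v) = reals s"
  and nats_set_real [simp]: "nats (set_real s a i x) = nats s"
  and reals_set_real [simp]: "reals (set_real s a i x) = (reals s)(a := (reals s a)(i := x))"
  by (simp_all add: set_nat_def set_real_def)

text \<open>\<open>t\<close> is the time elapsed before the program starts, so that amortised bounds become ordinary
  invariants that relate the clock to the state.\<close>

definition run :: "com \<Rightarrow> ram_state \<Rightarrow> nat \<Rightarrow> (nat \<Rightarrow> ram_state \<Rightarrow> bool) \<Rightarrow> bool" where
  "run c s t Q \<longleftrightarrow> (\<exists>t' s'. exec c s t' s' \<and> Q (t + t') s')"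

lemma run_Skip: "Q (t + 1) s \<Longrightarrow> run Skip s t Q"
  unfolding run_def using exec.Skip by blast

lemma run_NStore: "Q (t + (1 + ntime e + ntime v)) (set_nat s a (nval e s) (nval v s)) \<Longrightarrow>
    run (NStore a e v) s t Q"
  unfolding run_def set_nat_def using exec.NStore by blast

lemma run_RStore: "Q (t + (1 + ntime e + rtime v)) (set_real s a (nval e s) (rval v s)) \<Longrightarrow>
    run (RStore a e v) s t Q"
  unfolding run_def set_real_def using exec.RStore by blast

lemma run_Seq: "run c s t (\<lambda>t' s'. run c' s' t' Q) \<Longrightarrow> run (Seq c c') s t Q"
  unfolding run_def by (metis add.assoc exec.Seq)

lemma run_Cond:
  assumes "bval b s \<Longrightarrow> run c s (t + (1 + btime b)) Q" "\<not> bval b s \<Longrightarrow> run c' s (t + (1 + btime b)) Q"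
  shows "run (Cond b c c') s t Q"
  using assms exec.CondTrue[of b s c _ _ c'] exec.CondFalse[of b s c' _ _ c] unfolding run_def
  by (metis add.assoc)

lemma run_While_unfold:
  assumes "bval b s \<Longrightarrow> run c s (t + (1 + btime b)) (\<lambda>t' s'. run (While b c) s' t' Q)"
    and "\<not> bval b s \<Longrightarrow> Q (t + (1 + btime b)) s"
  shows "run (While b c) s t Q"
proof (cases "bval b s")
  case True
  then obtain t1 s1 t2 s2 where "exec c s t1 s1" "exec (While b c) s1 t2 s2"
      "Q (t + (1 + btime b) + t1 + t2) s2"
    using assms(1) unfolding run_def by blast
  then show ?thesis using exec.WhileTrue[OF True] unfolding run_def by (metis add.assoc)
next
  case False then show ?thesis using assms(2) exec.WhileFalse[OF False] unfolding run_def by blast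
qed

lemma run_mono: "run c s t Q \<Longrightarrow> (\<And>t' s'. Q t' s' \<Longrightarrow> R t' s') \<Longrightarrow> run c s t R"
  unfolding run_def by blast

text \<open>The measure only secures termination. Time bounds are part of \<open>I\<close>, which
  may relate the clock to the state.\<close>

lemma run_While:
  fixes \<mu> :: "ram_state \<Rightarrow> nat"
  assumes "I t s"
    and body: "\<And>t s. I t s \<Longrightarrow> bval b s \<Longrightarrow> run c s (t + (1 + btime b)) (\<lambda>t' s'. I t' s' \<and> \<mu> s' < \<mu> s)"
    and exit: "\<And>t s. I t s \<Longrightarrow> \<not> bval b s \<Longrightarrow> Q (t + (1 + btime b)) s"
  shows "run (While b c) s t Q"
  using assms(1)
proof (induction "\<mu> s" arbitrary: s t rule: less_induct)
  case less
  show ?case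
  proof (rule run_While_unfold)
    assume "bval b s"
    from body[OF less.prems this]
    show "run c s (t + (1 + btime b)) (\<lambda>t' s'. run (While b c) s' t' Q)"
      by (rule run_mono) (use less.hyps in blast)
  qed (use exit[OF less.prems] in blast)
qed

text \<open>Symbolic execution may end in any state expression; the proof that it equals a named
  state is postponed to a separate goal.\<close>

lemma run_state: "s = s' \<Longrightarrow> run c s' t Q \<Longrightarrow> run c s t Q"
  by simp

text \<open>The frame condition of a program: the sets list the arrays of naturals and the arrays of
  reals that it may write. The two kinds have separate name spaces, so equal numbers do not
  clash.\<close>

definition unchanged :: "nat set \<Rightarrow> nat set \<Rightarrow> ram_state \<Rightarrow> ram_state \<Rightarrow> bool" where
  "unchanged A B s s' \<longleftrightarrow> (\<forall>a. a \<notin> A \<longrightarrow> nats s' a = nats s a) \<and> (\<forall>b. b \<notin> B \<longrightarrow> reals s' b = reals s b)"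

lemma unchanged_refl [simp]: "unchanged A B s s"
  by (simp add: unchanged_def)

lemma unchanged_trans: "unchanged A B s s' \<Longrightarrow> unchanged A' B' s' s'' \<Longrightarrow> A \<subseteq> C \<Longrightarrow> B \<subseteq> D \<Longrightarrow>
    A' \<subseteq> C \<Longrightarrow> B' \<subseteq> D \<Longrightarrow> unchanged C D s s''"
  unfolding unchanged_def by (metis subsetD)

lemma unchanged_set_nat: "unchanged A B s s' \<Longrightarrow> a \<in> A \<Longrightarrow> unchanged A B s (set_nat s' a i v)"
  and unchanged_set_real: "unchanged A B s s' \<Longrightarrow> b \<in> B \<Longrightarrow> unchanged A B s (set_real s' b i x)"
  unfolding unchanged_def by auto

lemma unchanged_nats: "unchanged A B s s' \<Longrightarrow> a \<notin> A \<Longrightarrow> nats s' a = nats s a"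
  and unchanged_reals: "unchanged A B s s' \<Longrightarrow> b \<notin> B \<Longrightarrow> reals s' b = reals s b"
  unfolding unchanged_def by auto

abbreviation nvar :: "nat \<Rightarrow> nexp" where "nvar a \<equiv> NLoad a (NLit 0)"
abbreviation rvar :: "nat \<Rightarrow> rexp" where "rvar a \<equiv> RLoad a (NLit 0)"
abbreviation nassign :: "nat \<Rightarrow> nexp \<Rightarrow> com" where "nassign a e \<equiv> NStore a (NLit 0) e"
abbreviation rassign :: "nat \<Rightarrow> rexp \<Rightarrow> com" where "rassign a e \<equiv> RStore a (NLit 0) e"

fun seq :: "com list \<Rightarrow> com" where
  "seq [] = Skip"
| "seq [c] = c"
| "seq (c # c' # cs) = Seq c (seq (c' # cs))"

section \<open>A priority queue as a tournament tree\<close>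

text \<open>Array names. A scalar variable is the entry 0 of an array of its own: names \<open>v\<dots>\<close> are natural
  numbers and names \<open>x\<dots>\<close> reals.\<close>

abbreviation (input) "WIN \<equiv> 10 :: nat"
abbreviation (input) "PAR \<equiv> 11 :: nat"
abbreviation (input) "vV \<equiv> 20 :: nat"
abbreviation (input) "vNX \<equiv> 21 :: nat"
abbreviation (input) "vM \<equiv> 22 :: nat"
abbreviation (input) "vW \<equiv> 23 :: nat"
abbreviation (input) "KEY \<equiv> 12 :: nat"
abbreviation (input) "AL \<equiv> 13 :: nat"
abbreviation (input) "BE \<equiv> 14 :: nat"
abbreviation (input) "xK \<equiv> 20 :: nat"
abbreviation (input) "xA \<equiv> 21 :: nat"
abbreviation (input) "xB \<equiv> 22 :: nat"

text \<open>Node \<open>v\<close> has the children \<open>2 * v\<close> and \<open>2 * v + 1\<close>, slot \<open>i < M\<close> is the leaf \<open>M + i\<close>, and \<open>WIN\<close>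
  stores the slot with the largest key below a node; 0 means that there is none.\<close>

definition better :: "(nat \<Rightarrow> real) \<Rightarrow> nat \<Rightarrow> nat \<Rightarrow> nat" where
  "better key a b = (if 0 < b \<and> \<not> (0 < a \<and> \<not> key a < key b) then b else a)"

definition replay :: com where
  "replay = While (NLess (NLit 1) (nvar vV))
    (seq [nassign vV (NLoad PAR (nvar vV)),
      Cond (BAnd (NLess (NLit 0) (NLoad WIN (NAdd (NAdd (nvar vV) (nvar vV)) (NLit 1))))
             (BNot (BAnd (NLess (NLit 0) (NLoad WIN (NAdd (nvar vV) (nvar vV))))
                (BNot (RLess (RLoad KEY (NLoad WIN (NAdd (nvar vV) (nvar vV))))
                   (RLoad KEY (NLoad WIN (NAdd (NAdd (nvar vV) (nvar vV)) (NLit 1)))))))))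
        (NStore WIN (nvar vV) (NLoad WIN (NAdd (NAdd (nvar vV) (nvar vV)) (NLit 1))))
        (NStore WIN (nvar vV) (NLoad WIN (NAdd (nvar vV) (nvar vV))))])"

definition node_ok :: "ram_state \<Rightarrow> nat \<Rightarrow> bool" where
  "node_ok s w \<longleftrightarrow> nats s WIN w =
     better (reals s KEY) (nats s WIN (2 * w)) (nats s WIN (2 * w + 1))"

text \<open>Halving is no operation of the machine, so parents are looked up in a table.
  \<open>M\<close> need not be a power of two.\<close>

definition pars_ok :: "nat \<Rightarrow> ram_state \<Rightarrow> bool" where
  "pars_ok M s \<longleftrightarrow> (\<forall>v. 1 < v \<and> v < 2 * M \<longrightarrow> nats s PAR v = v div 2)"

text \<open>Induction on a bound \<open>L\<close> for the depth of \<open>v\<close>. Before each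
  round only proper ancestors of \<open>v\<close> may store a wrong winner; once the parent is
  recomputed, only proper ancestors of the parent may.\<close>

lemma run_replay:
  assumes "v = nats s vV 0" "1 \<le> v" "v < 2 * M" "v < 2 ^ L" "pars_ok M s"
    and "\<And>w. 1 \<le> w \<Longrightarrow> w < M \<Longrightarrow> (\<And>j. 1 \<le> j \<Longrightarrow> w \<noteq> v div 2 ^ j) \<Longrightarrow> node_ok s w"
    and "\<And>t' s'. t' \<le> t + 80 * (L + 1) \<Longrightarrow> unchanged {WIN, vV} {} s s' \<Longrightarrow>
        (\<And>w. M \<le> w \<Longrightarrow> nats s' WIN w = nats s WIN w) \<Longrightarrow>
        (\<And>w. 1 \<le> w \<Longrightarrow> w < M \<Longrightarrow> node_ok s' w) \<Longrightarrow> Q t' s'"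
  shows "run replay s t Q"
  using assms
proof (induction L arbitrary: v s t)
  case 0
  then show ?case by simp
next
  case (Suc L v s t)
  note pars = Suc.prems(5) and ok = Suc.prems(6) and Q = Suc.prems(7)
  define v' where "v' = v div 2"
  define s' where "s' = set_nat (set_nat s vV 0 v') WIN v'
      (better (reals s KEY) (nats s WIN (2 * v')) (nats s WIN (2 * v' + 1)))"
  show ?case
    unfolding replay_def
  proof (rule run_While_unfold, goal_cases)
    case 1
    have v: "1 < v" using 1 Suc.prems(1) by simp
    have pv: "nats s PAR v = v'" using pars v Suc.prems(3) by (simp add: pars_ok_def v'_def)
    have v'1: "1 \<le> v'" "v' < M" "v' < 2 ^ L" using v Suc.prems(3,4) by (auto simp: v'_def)
    have a: "unchanged {WIN, vV} {} s s'"
      unfolding s'_def by (intro unchanged_set_nat) auto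
    have ok': "node_ok s' w"
      if w: "1 \<le> w" "w < M" "\<And>j. 1 \<le> j \<Longrightarrow> w \<noteq> v' div 2 ^ j" for w
    proof (cases "w = v'")
      case True
      then show ?thesis using v'1 by (simp add: node_ok_def s'_def)
    next
      case False
      have "w \<noteq> v div 2 ^ j" if "1 \<le> j" for j
      proof (cases "j = 1")
        case False
        define i where "i = j - 1"
        have i: "j = Suc i" "1 \<le> i" using False that by (simp_all add: i_def)
        show ?thesis using w(3)[of i] i by (simp add: v'_def div_mult2_eq)
      qed (use \<open>w \<noteq> v'\<close> in \<open>simp add: v'_def\<close>)
      then have "node_ok s w" using ok w by blast
      \<comment> \<open>The new winner of \<open>v'\<close> is read only by the parent of
        \<open>v'\<close>, and this node is still among the exceptions.\<close>
      moreover have "w \<noteq> v' div 2" using w(3)[of 1] by simp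
      then have "2 * w \<noteq> v'" "Suc (2 * w) \<noteq> v'" by auto
      ultimately show ?thesis using False by (simp add: node_ok_def s'_def)
    qed
    have fin: "run replay s' t' Q" if "t' \<le> t + 80" for t'
    proof (rule Suc.IH[of v' s' t'])
      show "v' = nats s' vV 0" by (simp add: s'_def)
      show "pars_ok M s'" using pars by (simp add: pars_ok_def s'_def)
      show "v' < 2 * M" using v'1 by simp
      fix t'' s''
      assume b: "t'' \<le> t' + 80 * (L + 1)" "unchanged {WIN, vV} {} s' s''"
        "\<And>w. M \<le> w \<Longrightarrow> nats s'' WIN w = nats s' WIN w"
        "\<And>w. 1 \<le> w \<Longrightarrow> w < M \<Longrightarrow> node_ok s'' w"
      show "Q t'' s''"
      proof (rule Q)
        show "t'' \<le> t + 80 * (Suc L + 1)" using b that by simp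
        show "unchanged {WIN, vV} {} s s''" by (rule unchanged_trans[OF a b(2)]) auto
        show "nats s'' WIN w = nats s WIN w" if "M \<le> w" for w
          using b(3)[OF that] that v'1 by (simp add: s'_def)
      qed (use b in auto)
    qed (use v'1 ok' in auto)
    show ?case
      unfolding seq.simps
      by (rule run_Seq, rule run_NStore, rule run_Cond;
          rule run_NStore, rule run_state[OF _ fin[unfolded replay_def seq.simps]])
        (auto simp: Suc.prems(1)[symmetric] pv s'_def better_def mult_2)
  next
    case 2
    have v: "v = 1" using 2 Suc.prems(1,2) by simp
    show ?case
    proof (rule Q)
      fix w assume w: "1 \<le> w" "w < M"
      have "w \<noteq> v div 2 ^ j" if "1 \<le> j" for j
      proof -
        have "(1::nat) < 2 ^ j" using that by (intro one_less_power) auto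
        then show ?thesis using v w by simp
      qed
      then show "node_ok s w" using ok w by blast
    qed auto
  qed
qed

text \<open>For \<open>i = 0\<close> both alternatives of the last conjunct say 0, so slot 0 is
  never active. This is what allows 0 to encode absence.\<close>

definition pq_ok :: "nat \<Rightarrow> ram_state \<Rightarrow> bool" where
  "pq_ok M s \<longleftrightarrow> pars_ok M s \<and> (\<forall>w. 1 \<le> w \<and> w < M \<longrightarrow> node_ok s w) \<and>
     (\<forall>i<M. nats s WIN (M + i) = 0 \<or> nats s WIN (M + i) = i)"

definition active :: "nat \<Rightarrow> ram_state \<Rightarrow> nat set" where
  "active M s = {i. i < M \<and> nats s WIN (M + i) \<noteq> 0}"

lemma finite_active [simp]: "finite (active M s)"
  by (simp add: active_def)

text \<open>A nonzero winner is copied from a child, so following it downwards ends at the leaf of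
  an active slot.\<close>

lemma win_active:
  assumes "pq_ok M s" "1 \<le> w" "w < 2 * M" "nats s WIN w \<noteq> 0"
  shows "nats s WIN w \<in> active M s"
  using assms(2-)
proof (induction "2 * M - w" arbitrary: w rule: less_induct)
  case less
  show ?case
  proof (cases "w < M")
    case True
    then have "nats s WIN w = better (reals s KEY) (nats s WIN (2 * w)) (nats s WIN (2 * w + 1))"
      using assms(1) less.prems by (simp add: pq_ok_def node_ok_def)
    then have "nats s WIN w = nats s WIN (2 * w) \<or> nats s WIN w = nats s WIN (2 * w + 1)"
      by (simp add: better_def split: if_splits)
    then show ?thesis
      using less.hyps[of "2 * w"] less.hyps[of "2 * w + 1"] less.prems True by auto
  next
    case False
    then obtain i where i: "w = M + i" "i < M" using less.prems by (metis add_diff_inverse_nat add_less_cancel_left mult_2)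
    then have "nats s WIN w = i" using assms(1) less.prems by (auto simp: pq_ok_def)
    then show ?thesis using i less.prems by (simp add: active_def)
  qed
qed

text \<open>Passing from a node to its parent replaces the winner by one whose key is at least as
  large.\<close>

lemma win_root_max:
  assumes "pq_ok M s" "1 \<le> w" "w < 2 * M" "nats s WIN w \<noteq> 0"
  shows "nats s WIN 1 \<noteq> 0 \<and> reals s KEY (nats s WIN w) \<le> reals s KEY (nats s WIN 1)"
  using assms(2-)
proof (induction w rule: less_induct)
  case (less w)
  show ?case
  proof (cases "w = 1")
    case False
    define p where "p = w div 2"
    have p: "1 \<le> p" "p < M" "p < w" using less.prems False by (auto simp: p_def)
    then have "nats s WIN p = better (reals s KEY) (nats s WIN (2 * p)) (nats s WIN (2 * p + 1))"
      using assms(1) by (simp add: pq_ok_def node_ok_def)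
    moreover have "w = 2 * p \<or> w = 2 * p + 1" by (auto simp: p_def)
    ultimately have "nats s WIN p \<noteq> 0 \<and> reals s KEY (nats s WIN w) \<le> reals s KEY (nats s WIN p)"
      using less.prems by (auto simp: better_def)
    then show ?thesis using less.IH[of p] p by fastforce
  qed (use less.prems in simp)
qed

lemma root_active: "pq_ok M s \<Longrightarrow> 0 < M \<Longrightarrow> nats s WIN 1 \<noteq> 0 \<Longrightarrow> nats s WIN 1 \<in> active M s"
  by (rule win_active) auto

lemma root_max:
  assumes "pq_ok M s" "i \<in> active M s"
  shows "nats s WIN 1 \<noteq> 0" "reals s KEY i \<le> reals s KEY (nats s WIN 1)"
proof -
  have i: "i < M" "nats s WIN (M + i) \<noteq> 0" using assms(2) by (auto simp: active_def)
  moreover have "nats s WIN (M + i) = i" using assms(1) i by (auto simp: pq_ok_def)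
  ultimately show "nats s WIN 1 \<noteq> 0" "reals s KEY i \<le> reals s KEY (nats s WIN 1)"
    using win_root_max[OF assms(1), of "M + i"] by auto
qed

text \<open>Serves insertion (\<open>x = i\<close>) and removal (\<open>x = 0\<close>). The key of
  \<open>i\<close> may have been overwritten only if \<open>i\<close> was inactive: a node compares
  keys of active slots only, so no other winner is affected.\<close>

lemma run_replay_leaf:
  assumes ok: "pq_ok M s0" and L: "2 * M \<le> 2 ^ L" and i: "i < M" "0 < i" and x: "x = 0 \<or> x = i"
    and s: "nats s vV 0 = M + i" "nats s WIN = (nats s0 WIN)(M + i := x)" "nats s PAR = nats s0 PAR"
    and key: "\<And>j. j \<in> active M s0 \<Longrightarrow> j \<noteq> i \<Longrightarrow> reals s KEY j = reals s0 KEY j"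
    and new: "i \<in> active M s0 \<Longrightarrow> reals s KEY i = reals s0 KEY i"
    and Q: "\<And>t' s'. t' \<le> t + 80 * (L + 1) \<Longrightarrow> unchanged {WIN, vV} {} s s' \<Longrightarrow> pq_ok M s' \<Longrightarrow>
        active M s' = (if x = 0 then active M s0 - {i} else insert i (active M s0)) \<Longrightarrow> Q t' s'"
  shows "run replay s t Q"
proof (rule run_replay[of "M + i" _ M L])
  show "pars_ok M s" using ok s(3) by (simp add: pq_ok_def pars_ok_def)
  have lf: "(M + i) div 2 < M" using i by simp
  show "node_ok s w" if w: "1 \<le> w" "w < M" "\<And>j. 1 \<le> j \<Longrightarrow> w \<noteq> (M + i) div 2 ^ j" for w
  proof -
    have w2: "w \<noteq> (M + i) div 2" using w(3)[of 1] by simp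
    then have ne: "2 * w \<noteq> M + i" "2 * w + 1 \<noteq> M + i" by auto
    have "node_ok s0 w" using ok w by (simp add: pq_ok_def)
    moreover have k: "reals s KEY (nats s0 WIN u) = reals s0 KEY (nats s0 WIN u)"
      if "nats s0 WIN u \<noteq> 0" "1 \<le> u" "u < 2 * M" for u
    proof (cases "nats s0 WIN u = i")
      case True then show ?thesis using win_active[OF ok, of u] new that by simp
    next
      case False then show ?thesis using win_active[OF ok, of u] key that by simp
    qed
    ultimately show ?thesis
      using ne w i k[of "2 * w"] k[of "2 * w + 1"] by (auto simp: node_ok_def s(2) better_def)
  qed
  fix t' s'
  assume a: "t' \<le> t + 80 * (L + 1)" "unchanged {WIN, vV} {} s s'"
    "\<And>w. M \<le> w \<Longrightarrow> nats s' WIN w = nats s WIN w" "\<And>w. 1 \<le> w \<Longrightarrow> w < M \<Longrightarrow> node_ok s' w"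
  have "pars_ok M s'" using ok s(3) unchanged_nats[OF a(2), of PAR] by (simp add: pq_ok_def pars_ok_def)
  then have "pq_ok M s'" using a x ok i by (auto simp: pq_ok_def s(2))
  moreover have "active M s' = (if x = 0 then active M s0 - {i} else insert i (active M s0))"
    using a(3) x i by (auto simp: active_def s(2))
  ultimately show "Q t' s'" using Q a by blast
qed (use s i L in auto)

definition insert_prog :: com where
  "insert_prog = seq [RStore KEY (nvar vNX) (rvar xK), RStore AL (nvar vNX) (rvar xA),
     RStore BE (nvar vNX) (rvar xB), nassign vV (NAdd (nvar vM) (nvar vNX)),
     NStore WIN (nvar vV) (nvar vNX), nassign vNX (NAdd (nvar vNX) (NLit 1)), replay]"

text \<open>There is no constant term: constants do not influence minimisers and are not stored in
  the queue.\<close>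

definition quad :: "real \<Rightarrow> real \<Rightarrow> real \<Rightarrow> real" where
  "quad a b x = a * x\<^sup>2 + b * x"

text \<open>The function represented by the queue: every slot contributes a quadratic that is frozen to the
  right of its key.\<close>

definition pq_value :: "nat \<Rightarrow> ram_state \<Rightarrow> real \<Rightarrow> real" where
  "pq_value M s x = (\<Sum>i\<in>active M s. quad (reals s AL i) (reals s BE i) (min x (reals s KEY i)))"

text \<open>Slots are handed out in increasing order and never reused. Hence the tree has to be as
  large as the number of insertions, not just as large as the queue can get.\<close>

definition slots_free :: "nat \<Rightarrow> ram_state \<Rightarrow> bool" where
  "slots_free M s \<longleftrightarrow> 0 < nats s vNX 0 \<and> (\<forall>i\<in>active M s. i < nats s vNX 0)"

definition queue :: "nat \<Rightarrow> ram_state \<Rightarrow> bool" where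
  "queue M s \<longleftrightarrow> pq_ok M s \<and> slots_free M s \<and> nats s vM 0 = M"

text \<open>The clock together with a prepaid removal of every active slot.\<close>

definition potential :: "nat \<Rightarrow> nat \<Rightarrow> nat \<Rightarrow> ram_state \<Rightarrow> nat" where
  "potential L M t s = t + 200 * (L + 1) * card (active M s)"

text \<open>One half of the bound pays for the insertion, the other half is the credit
  \<open>200 * (L + 1)\<close> of the new slot.\<close>

lemma run_insert:
  assumes q: "queue M s" and L: "2 * M \<le> 2 ^ L" and nx: "nats s vNX 0 < M"
    and Q: "\<And>t' s'. potential L M t' s' \<le> potential L M t s + 400 * (L + 1) \<Longrightarrow>
        unchanged {WIN, vV, vNX} {KEY, AL, BE} s s' \<Longrightarrow> queue M s' \<Longrightarrow>
        nats s' vNX 0 = nats s vNX 0 + 1 \<Longrightarrow>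
        (\<And>x. pq_value M s' x = pq_value M s x +
           quad (reals s xA 0) (reals s xB 0) (min x (reals s xK 0))) \<Longrightarrow> Q t' s'"
  shows "run insert_prog s t Q"
proof -
  define i where "i = nats s vNX 0"
  have ok: "pq_ok M s" and i: "0 < i" "i < M" and ni: "\<And>j. j \<in> active M s \<Longrightarrow> j < i"
    and vM: "nats s vM 0 = M"
    using q nx by (auto simp: queue_def slots_free_def i_def)
  define s1 where "s1 = set_nat (set_nat (set_nat (set_real (set_real (set_real s KEY i (reals s xK 0))
    AL i (reals s xA 0)) BE i (reals s xB 0)) vV 0 (M + i)) WIN (M + i) i) vNX 0 (i + 1)"
  have fin: "run replay s1 t1 Q" if t1: "t1 \<le> t + 50" for t1
  proof (rule run_replay_leaf[OF ok L i(2,1), where x = i])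
    show "i = 0 \<or> i = i" by simp
    show "nats s1 vV 0 = M + i" "nats s1 WIN = (nats s WIN)(M + i := i)" "nats s1 PAR = nats s PAR"
      by (simp_all add: s1_def)
    show "reals s1 KEY j = reals s KEY j" if "j \<in> active M s" "j \<noteq> i" for j
      using that by (simp add: s1_def)
    show "reals s1 KEY i = reals s KEY i" if "i \<in> active M s" using ni[OF that] by simp
    fix t' s'
    assume a: "t' \<le> t1 + 80 * (L + 1)" "unchanged {WIN, vV} {} s1 s'" "pq_ok M s'"
      "active M s' = (if i = 0 then active M s - {i} else insert i (active M s))"
    have ac: "active M s' = insert i (active M s)" "i \<notin> active M s" using a(4) i ni by auto
    have re: "reals s' = reals s1" using a(2) by (auto simp: unchanged_def)
    have u1: "unchanged {WIN, vV, vNX} {KEY, AL, BE} s s1"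
      unfolding s1_def by (intro unchanged_set_nat unchanged_set_real) auto
    have nx': "nats s' vNX 0 = i + 1" using unchanged_nats[OF a(2), of vNX] by (simp add: s1_def)
    show "Q t' s'"
    proof (rule Q)
      show "potential L M t' s' \<le> potential L M t s + 400 * (L + 1)"
        using a(1) t1 ac by (simp add: potential_def algebra_simps)
      show "unchanged {WIN, vV, vNX} {KEY, AL, BE} s s'"
        by (rule unchanged_trans[OF u1 a(2)]) auto
      show "queue M s'"
        using a(3) nx' vM ac ni unchanged_nats[OF a(2), of vM] i
        by (fastforce simp: queue_def slots_free_def s1_def)
      show "nats s' vNX 0 = nats s vNX 0 + 1" using nx' by (simp add: i_def)
      show "pq_value M s' x = pq_value M s x +
           quad (reals s xA 0) (reals s xB 0) (min x (reals s xK 0))" for x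
      proof -
        have "(\<Sum>j\<in>active M s. quad (reals s1 AL j) (reals s1 BE j) (min x (reals s1 KEY j))) = pq_value M s x"
          unfolding pq_value_def by (rule sum.cong) (use ac in \<open>auto simp: s1_def\<close>)
        then show ?thesis unfolding pq_value_def ac(1) re using ac(2) by (simp add: s1_def)
      qed
    qed
  qed
  show ?thesis
    unfolding insert_prog_def seq.simps
    by (intro run_Seq run_RStore run_NStore, rule run_state[OF _ fin])
      (simp_all add: i_def[symmetric] vM s1_def)
qed

section \<open>Minimising a convex function on its last quadratic piece\<close>

text \<open>A smaller value at some \<open>x\<close> on the left would give the chord up to
  \<open>k\<close> a positive slope. Slopes of a convex function increase, but the quadratic piece
  leaves \<open>k\<close> with derivative at most 0.\<close>

lemma convex_tangent:
  fixes f :: "real \<Rightarrow> real"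
  assumes cv: "convex_on {l..h} f" and k: "l \<le> k" "k < c" "c \<le> h"
    and piece: "\<And>y. k \<le> y \<Longrightarrow> y \<le> c \<Longrightarrow> f y = quad a b y + d"
    and neg: "2 * a * k + b \<le> 0" and x: "l \<le> x" "x \<le> k"
  shows "f k \<le> f x"
proof (rule ccontr)
  assume "\<not> f k \<le> f x"
  then have lt: "f x < f k" by simp
  then have "x < k" using x by (cases "x = k") auto
  define \<sigma> where "\<sigma> = (f k - f x) / (k - x)"
  have \<sigma>: "0 < \<sigma>" using lt \<open>x < k\<close> by (simp add: \<sigma>_def)
  \<comment> \<open>Small enough to remain on the piece and to keep the quadratic part
    \<open>a * e\<close> of the difference quotient below the chord slope
    \<open>\<sigma>\<close>.\<close>
  define e where "e = min (c - k) (\<sigma> / (\<bar>a\<bar> + 1) / 2)"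
  have e: "0 < e" "e \<le> c - k" using k \<sigma> by (auto simp: e_def)
  have "\<bar>a\<bar> * e \<le> \<bar>a\<bar> * (\<sigma> / (\<bar>a\<bar> + 1) / 2)" by (intro mult_left_mono) (auto simp: e_def)
  also have "\<dots> < \<sigma>" using \<sigma> by (simp add: field_simps add_nonneg_pos)
  finally have ae: "a * e < \<sigma>" using e by (smt (verit) mult_right_mono)
  have "\<sigma> \<le> (f (k + e) - f k) / (k + e - k)"
    using convex_on_slope_le[OF cv, of x "k + e" k] x e k \<open>x < k\<close> unfolding \<sigma>_def
    by (smt (verit) atLeastAtMost_iff divide_minus_left minus_diff_eq minus_divide_right)
  moreover have "f (k + e) - f k = e * (a * e + (2 * a * k + b))"
    using piece[of "k + e"] piece[of k] e k by (simp add: quad_def algebra_simps power2_eq_square)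
  ultimately have "\<sigma> \<le> a * e + (2 * a * k + b)" using e by simp
  then show False using neg ae by simp
qed

text \<open>The mean of the end values exceeds the value at the midpoint by
  \<open>a * (c - k)\<^sup>2 / 4\<close>.\<close>

lemma convex_piece_coeff:
  fixes f :: "real \<Rightarrow> real"
  assumes cv: "convex_on {l..h} f" and k: "l \<le> k" "k < c" "c \<le> h"
    and piece: "\<And>y. k \<le> y \<Longrightarrow> y \<le> c \<Longrightarrow> f y = quad a b y + d"
  shows "0 \<le> a"
proof -
  have "f ((1 - 1/2) * k + 1/2 * c) \<le> (1 - 1/2) * f k + 1/2 * f c"
    using convex_onD[OF cv, of "1/2" k c] k by simp
  moreover have "(1 - 1/2) * k + 1/2 * c = (k + c) / 2" by (simp add: field_simps)
  ultimately have "f ((k + c) / 2) \<le> (f k + f c) / 2" by (simp add: field_simps)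
  then have "quad a b ((k + c) / 2) \<le> (quad a b k + quad a b c) / 2"
    using piece[of k] piece[of c] piece[of "(k + c) / 2"] k by (simp add: field_simps)
  then have "0 \<le> a * (c - k)\<^sup>2" by (simp add: quad_def field_simps power2_eq_square)
  moreover have "0 < (c - k)\<^sup>2" using k by simp
  ultimately show ?thesis by (simp add: zero_le_mult_iff)
qed

text \<open>\<open>c\<close> is the smallest key removed so far (or the right end), \<open>quad a b\<close> the sum of the removed
  terms, and \<open>k\<close> the largest remaining key.\<close>

lemma pop_step:
  fixes f :: "real \<Rightarrow> real"
  assumes cv: "convex_on {l..h} f" and k: "l \<le> k" "k < c" "c \<le> h"
    and piece: "\<And>y. k \<le> y \<Longrightarrow> y \<le> c \<Longrightarrow> f y = quad a b y + d"
    and pos: "0 < 2 * a * k + b"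
    and right: "\<And>y. c \<le> y \<Longrightarrow> y \<le> h \<Longrightarrow> f c \<le> f y"
    and y: "k \<le> y" "y \<le> h"
  shows "f k \<le> f y"
proof -
  have a: "0 \<le> a" by (rule convex_piece_coeff[OF cv k piece])
  have *: "f k \<le> f z" if "k \<le> z" "z \<le> c" for z
  proof -
    have "f z - f k = (z - k) * (a * (z - k) + (2 * a * k + b))"
      using piece[of z] piece[of k] that k by (simp add: quad_def algebra_simps power2_eq_square)
    moreover have "0 \<le> (z - k) * (a * (z - k) + (2 * a * k + b))"
      using a pos that by (intro mult_nonneg_nonneg) (auto intro: add_nonneg_nonneg)
    ultimately show ?thesis by simp
  qed
  show ?thesis
  proof (cases "y \<le> c")
    case False then show ?thesis using *[of c] right[of y] y k by simp
  qed (use * y in simp)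
qed

text \<open>For \<open>0 \<le> a\<close> and \<open>k \<le> c\<close> this is a minimiser of
  \<open>quad a b\<close> on \<open>[k, c]\<close>: \<open>2 * a * k + b\<close> is the derivative
  at \<open>k\<close> and \<open>- b / (2 * a)\<close> is the vertex.\<close>

definition piece_argmin :: "real \<Rightarrow> real \<Rightarrow> real \<Rightarrow> real \<Rightarrow> real" where
  "piece_argmin k c a b =
     (if 0 < 2 * a * k + b then k else if 0 < a \<and> - b / (2 * a) < c then - b / (2 * a) else c)"

lemma piece_argmin_bounds:
  assumes "k \<le> c"
  shows "k \<le> piece_argmin k c a b" "piece_argmin k c a b \<le> c"
proof -
  have "k \<le> - b / (2 * a)" if "\<not> 0 < 2 * a * k + b" "0 < a"
    using that by (simp add: field_simps)
  then show "k \<le> piece_argmin k c a b" "piece_argmin k c a b \<le> c"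
    using assms by (auto simp: piece_argmin_def)
qed

text \<open>Points right of \<open>c\<close> are covered by \<open>right\<close>, points of the
  piece by the shape of the parabola, and points left of \<open>k\<close> by
  \<open>convex_tangent\<close>. By \<open>stop\<close>, either nothing lies to the left of
  \<open>k\<close>, or the derivative at \<open>k\<close> has the sign that
  \<open>convex_tangent\<close> asks for.\<close>

lemma piece_argmin_optimal:
  fixes f :: "real \<Rightarrow> real"
  assumes cv: "convex_on {l..h} f" and k: "l \<le> k" "k \<le> c" "c \<le> h"
    and piece: "\<And>y. k \<le> y \<Longrightarrow> y \<le> c \<Longrightarrow> f y = quad a b y + d"
    and stop: "k = l \<or> k < c \<and> 2 * a * k + b \<le> 0"
    and right: "\<And>y. c \<le> y \<Longrightarrow> y \<le> h \<Longrightarrow> f c \<le> f y"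
  shows "argmin_on l h f (piece_argmin k c a b)"
proof -
  let ?m = "piece_argmin k c a b"
  note mb = piece_argmin_bounds[OF k(2), of a b]
  have "f ?m \<le> f y" if y: "l \<le> y" "y \<le> h" for y
  proof (cases "k = c")
    case True
    then show ?thesis using mb stop right[of y] y by auto
  next
    case False
    then have kc: "k < c" using k by simp
    have a: "0 \<le> a" by (rule convex_piece_coeff[OF cv k(1) kc k(3) piece])
    show ?thesis
    proof (cases "0 < 2 * a * k + b")
      case True
      then have "l = k" "?m = k" using stop by (auto simp: piece_argmin_def)
      then show ?thesis using pop_step[OF cv k(1) kc k(3) piece True right] y by simp
    next
      case False
      have mid: "f ?m \<le> f z" if z: "k \<le> z" "z \<le> c" for z
      proof -
        \<comment> \<open>Expansion around \<open>?m\<close>. The term \<open>2 * a * ?m + b\<close>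
          is the derivative there: it vanishes at the vertex, and it is nonpositive if the minimiser
          is the right end \<open>c\<close>.\<close>
        have fz: "f z - f ?m = (z - ?m) * (a * (z - ?m) + (2 * a * ?m + b))"
          using piece[of z] piece[of ?m] z mb by (simp add: quad_def algebra_simps power2_eq_square)
        have "0 \<le> (z - ?m) * (a * (z - ?m) + (2 * a * ?m + b))"
        proof (cases "0 < a \<and> - b / (2 * a) < c")
          case True
          then have "2 * a * ?m + b = 0" using False by (simp add: piece_argmin_def)
          then show ?thesis using a by (simp add: mult.left_commute)
        next
          case F2: False
          then have m: "?m = c" using False by (auto simp: piece_argmin_def)
          have "2 * a * c + b \<le> 0"
          proof (cases "a = 0")
            case True then show ?thesis using False by simp
          next
            case nz: False
            then have "c \<le> - b / (2 * a)" using F2 a by simp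
            then show ?thesis using nz a by (simp add: field_simps)
          qed
          moreover have "a * (z - c) \<le> 0" using a z by (simp add: mult_nonneg_nonpos)
          ultimately show ?thesis unfolding m using z by (intro mult_nonpos_nonpos) auto
        qed
        then show ?thesis using fz by simp
      qed
      have "f k \<le> f y" if "y \<le> k"
        by (rule convex_tangent[OF cv k(1) kc k(3) piece _ y(1) that]) (use False in auto)
      then show ?thesis using mid[of k] mid[of y] mid[of c] right[of y] y k by fastforce
    qed
  qed
  then show ?thesis using mb k by (simp add: argmin_on_def)
qed

section \<open>Truncating the queue at the minimiser\<close>

lemma quad_add: "quad (a + a') (b + b') x = quad a b x + quad a' b' x"
  by (simp add: quad_def algebra_simps)

lemma quad_zero [simp]: "quad 0 0 x = 0"
  by (simp add: quad_def)

lemma pq_value_remove: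
  assumes "i \<in> active M s" "active M s' = active M s - {i}"
    and "\<And>j. j \<in> active M s \<Longrightarrow> reals s' KEY j = reals s KEY j \<and> reals s' AL j = reals s AL j \<and>
      reals s' BE j = reals s BE j"
  shows "pq_value M s x = pq_value M s' x + quad (reals s AL i) (reals s BE i) (min x (reals s KEY i))"
proof -
  have "pq_value M s x = quad (reals s AL i) (reals s BE i) (min x (reals s KEY i)) +
      (\<Sum>j\<in>active M s - {i}. quad (reals s AL j) (reals s BE j) (min x (reals s KEY j)))"
    unfolding pq_value_def using assms(1) by (simp add: sum.remove)
  also have "(\<Sum>j\<in>active M s - {i}. quad (reals s AL j) (reals s BE j) (min x (reals s KEY j))) = pq_value M s' x"
    unfolding pq_value_def assms(2) by (rule sum.cong) (use assms(3) in auto)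
  finally show ?thesis by simp
qed

lemma pq_value_right_const:
  assumes "\<And>i. i \<in> active M s \<Longrightarrow> reals s KEY i \<le> k" "k \<le> x" "k \<le> y"
  shows "pq_value M s x = pq_value M s y"
  unfolding pq_value_def
proof (rule sum.cong)
  fix i assume "i \<in> active M s"
  then have "reals s KEY i \<le> k" by (rule assms(1))
  then show "quad (reals s AL i) (reals s BE i) (min x (reals s KEY i)) =
      quad (reals s AL i) (reals s BE i) (min y (reals s KEY i))"
    using assms(2,3) by (simp add: min_absorb2)
qed simp

abbreviation (input) "xLo \<equiv> 23 :: nat"
abbreviation (input) "xHi \<equiv> 24 :: nat"
abbreviation (input) "xCur \<equiv> 25 :: nat"
abbreviation (input) "xSA \<equiv> 26 :: nat"
abbreviation (input) "xSB \<equiv> 27 :: nat"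
abbreviation (input) "xM \<equiv> 28 :: nat"
abbreviation (input) "xKap \<equiv> 29 :: nat"
abbreviation (input) "top_key \<equiv> RLoad KEY (NLoad WIN (NLit 1))"
abbreviation (input) "slope \<kappa> \<equiv> RAdd (RMul (RMul (RLit 2) (rvar xSA)) \<kappa>) (rvar xSB)"

text \<open>To the right of the largest key all remaining terms are frozen, so the derivative just
  right of that key comes from the removed terms alone; \<open>slope\<close> is this derivative. A
  key that is not left of \<open>xCur\<close> is removed in any case. Keys that are not right of
  \<open>xLo\<close> stay, because the minimiser is sought within the box.\<close>

definition pop_guard :: bexp where
  "pop_guard = BAnd (NLess (NLit 0) (NLoad WIN (NLit 1))) (BAnd (RLess (rvar xLo) top_key)
     (BNot (BAnd (RLess top_key (rvar xCur)) (BNot (RLess (RLit 0) (slope top_key))))))"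

definition pop_body :: com where
  "pop_body = seq [nassign vW (NLoad WIN (NLit 1)),
     Cond (RLess (RLoad KEY (nvar vW)) (rvar xCur)) (rassign xCur (RLoad KEY (nvar vW))) Skip,
     rassign xSA (RAdd (rvar xSA) (RLoad AL (nvar vW))),
     rassign xSB (RAdd (rvar xSB) (RLoad BE (nvar vW))),
     nassign vV (NAdd (nvar vM) (nvar vW)), NStore WIN (nvar vV) (NLit 0), replay]"

lemma bval_pop_guard:
  "bval pop_guard s \<longleftrightarrow> nats s WIN 1 \<noteq> 0 \<and> reals s xLo 0 < reals s KEY (nats s WIN 1) \<and>
     (reals s KEY (nats s WIN 1) < reals s xCur 0 \<longrightarrow>
        0 < 2 * reals s xSA 0 * reals s KEY (nats s WIN 1) + reals s xSB 0)"
  by (auto simp: pop_guard_def)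

lemma run_pop_body:
  assumes q: "queue M s" and L: "2 * M \<le> 2 ^ L" "0 < M" and i: "i = nats s WIN 1" "i \<noteq> 0"
    and Q: "\<And>t' s'. t' \<le> t + 60 + 80 * (L + 1) \<Longrightarrow>
        unchanged {WIN, vV, vW} {xCur, xSA, xSB} s s' \<Longrightarrow> queue M s' \<Longrightarrow>
        active M s' = active M s - {i} \<Longrightarrow>
        reals s' xCur 0 = min (reals s KEY i) (reals s xCur 0) \<Longrightarrow>
        reals s' xSA 0 = reals s xSA 0 + reals s AL i \<Longrightarrow>
        reals s' xSB 0 = reals s xSB 0 + reals s BE i \<Longrightarrow> Q t' s'"
  shows "run pop_body s t Q"
proof -
  have ok: "pq_ok M s" and vM: "nats s vM 0 = M" using q by (auto simp: queue_def)
  have ia: "i \<in> active M s" using root_active[OF ok L(2)] i by simp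
  then have iM: "i < M" by (simp add: active_def)
  have iS: "nats s WIN (Suc 0) = i" using i by simp
  define s1 where "s1 = set_nat (set_nat (set_real (set_real (set_real (set_nat s vW 0 i)
     xCur 0 (min (reals s KEY i) (reals s xCur 0)))
     xSA 0 (reals s xSA 0 + reals s AL i)) xSB 0 (reals s xSB 0 + reals s BE i)) vV 0 (M + i)) WIN (M + i) 0"
  define s2 where "s2 = set_nat (set_nat (set_real (set_real (set_nat s vW 0 i)
     xSA 0 (reals s xSA 0 + reals s AL i)) xSB 0 (reals s xSB 0 + reals s BE i)) vV 0 (M + i)) WIN (M + i) 0"
  have s12: "s1 = s2" if "reals s xCur 0 \<le> reals s KEY i"
    using that by (auto simp: s1_def s2_def set_nat_def set_real_def min_absorb2 fun_eq_iff intro!: ram_state.equality)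
  have fin: "run replay s1 t1 Q" if t1: "t1 \<le> t + 60" for t1
  proof (rule run_replay_leaf[OF ok L(1) iM, where x = 0])
    show "nats s1 vV 0 = M + i" "nats s1 WIN = (nats s WIN)(M + i := 0)" "nats s1 PAR = nats s PAR"
      by (simp_all add: s1_def)
    fix t' s'
    assume a: "t' \<le> t1 + 80 * (L + 1)" "unchanged {WIN, vV} {} s1 s'" "pq_ok M s'"
      "active M s' = (if (0::nat) = 0 then active M s - {i} else insert i (active M s))"
    have u1: "unchanged {WIN, vV, vW} {xCur, xSA, xSB} s s1"
      unfolding s1_def by (intro unchanged_set_nat unchanged_set_real) auto
    have ac: "active M s' = active M s - {i}" using a(4) by simp
    have u: "unchanged {WIN, vV, vW} {xCur, xSA, xSB} s s'" by (rule unchanged_trans[OF u1 a(2)]) auto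
    show "Q t' s'"
    proof (rule Q[OF _ u _ ac])
      show "t' \<le> t + 60 + 80 * (L + 1)" using a(1) t1 by simp
      show "queue M s'"
        using a(3) ac q unchanged_nats[OF u, of vNX] unchanged_nats[OF u, of vM]
        by (auto simp: queue_def slots_free_def)
      show "reals s' xCur 0 = min (reals s KEY i) (reals s xCur 0)"
        "reals s' xSA 0 = reals s xSA 0 + reals s AL i" "reals s' xSB 0 = reals s xSB 0 + reals s BE i"
        using unchanged_reals[OF a(2)] by (simp_all add: s1_def)
    qed
  qed (use i in \<open>auto simp: s1_def\<close>)
  show ?thesis
    unfolding pop_body_def seq.simps
    apply (rule run_Seq, rule run_NStore, rule run_Seq, rule run_Cond)
    subgoal
      apply (intro run_Seq run_RStore run_NStore, rule run_state[OF _ fin])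
      by (auto simp: s1_def iS vM min_def)
    subgoal
      apply (intro run_Seq run_RStore run_NStore run_Skip, rule run_state[OF _ fin])
      by (auto simp: s12 s2_def iS vM)
    done
qed

text \<open>After the removals the program evaluates \<open>piece_argmin\<close> between
  \<open>xKap\<close> and \<open>xCur\<close>. The removed terms, merged into one quadratic, then
  return as a single slot with the minimiser as key.\<close>

definition trunc_prog :: com where
  "trunc_prog = seq [rassign xCur (rvar xHi), rassign xSA (RLit 0), rassign xSB (RLit 0),
     While pop_guard pop_body, rassign xKap (rvar xLo),
     Cond (BAnd (NLess (NLit 0) (NLoad WIN (NLit 1))) (RLess (rvar xLo) top_key))
       (rassign xKap top_key) Skip,
     Cond (RLess (RLit 0) (slope (rvar xKap))) (rassign xM (rvar xKap))
       (Cond (BAnd (RLess (RLit 0) (rvar xSA))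
           (RLess (RDiv (RSub (RLit 0) (rvar xSB)) (RMul (RLit 2) (rvar xSA))) (rvar xCur)))
         (rassign xM (RDiv (RSub (RLit 0) (rvar xSB)) (RMul (RLit 2) (rvar xSA))))
         (rassign xM (rvar xCur))),
     rassign xK (rvar xM), rassign xA (rvar xSA), rassign xB (rvar xSB), insert_prog]"

text \<open>The last two conjuncts carry the argument: \<open>xCur\<close> minimises the original
  function on the part of the box to its right, and to the left of \<open>xCur\<close> no removed
  term is frozen, so their sum is one quadratic.\<close>

definition pop_inv :: "nat \<Rightarrow> nat \<Rightarrow> nat \<Rightarrow> ram_state \<Rightarrow> nat \<Rightarrow> ram_state \<Rightarrow> bool" where
  "pop_inv L M t0 s0 t s \<longleftrightarrow>
     potential L M t s \<le> potential L M t0 s0 + 50 \<and>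
     unchanged {WIN, vV, vW} {xCur, xSA, xSB} s0 s \<and> queue M s \<and> active M s \<subseteq> active M s0 \<and>
     reals s0 xLo 0 \<le> reals s xCur 0 \<and> reals s xCur 0 \<le> reals s0 xHi 0 \<and>
     (\<forall>y. reals s xCur 0 \<le> y \<and> y \<le> reals s0 xHi 0 \<longrightarrow>
        pq_value M s0 (reals s xCur 0) \<le> pq_value M s0 y) \<and>
     (\<forall>y\<le>reals s xCur 0. pq_value M s0 y = pq_value M s y + quad (reals s xSA 0) (reals s xSB 0) y)"

lemma pop_inv_step:
  assumes inv: "pop_inv L M t0 s0 t s" and L: "2 * M \<le> 2 ^ L" "0 < M"
    and cv: "convex_on {reals s0 xLo 0..reals s0 xHi 0} (pq_value M s0)"
    and g: "bval pop_guard s"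
  shows "run pop_body s (t + (1 + btime pop_guard))
      (\<lambda>t' s'. pop_inv L M t0 s0 t' s' \<and> card (active M s') < card (active M s))"
proof -
  define i where "i = nats s WIN 1"
  define k where "k = reals s KEY i"
  define c where "c = reals s xCur 0"
  let ?f = "pq_value M s0" and ?lo = "reals s0 xLo 0" and ?hi = "reals s0 xHi 0"
  have pot: "potential L M t s \<le> potential L M t0 s0 + 50"
    and un: "unchanged {WIN, vV, vW} {xCur, xSA, xSB} s0 s" and q: "queue M s"
    and sub: "active M s \<subseteq> active M s0" and c: "?lo \<le> c" "c \<le> ?hi"
    and right: "\<And>y. c \<le> y \<Longrightarrow> y \<le> ?hi \<Longrightarrow> ?f c \<le> ?f y"
    and rep: "\<And>y. y \<le> c \<Longrightarrow> ?f y = pq_value M s y + quad (reals s xSA 0) (reals s xSB 0) y"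
    using inv by (auto simp: pop_inv_def c_def)
  have ok: "pq_ok M s" using q by (simp add: queue_def)
  have lo: "reals s xLo 0 = ?lo" using unchanged_reals[OF un] by simp
  have i0: "i \<noteq> 0" and lk: "?lo < k" and pos: "k < c \<Longrightarrow> 0 < 2 * reals s xSA 0 * k + reals s xSB 0"
    using g by (auto simp: bval_pop_guard lo i_def k_def c_def)
  have ia: "i \<in> active M s" using root_active[OF ok L(2)] i0 by (simp add: i_def)
  have top: "reals s KEY j \<le> k" if "j \<in> active M s" for j
    using root_max(2)[OF ok that] by (simp add: k_def i_def)
  show ?thesis
  proof (rule run_pop_body[OF q L i_def i0])
    fix t' s'
    assume a: "t' \<le> t + (1 + btime pop_guard) + 60 + 80 * (L + 1)"
      "unchanged {WIN, vV, vW} {xCur, xSA, xSB} s s'" "queue M s'" "active M s' = active M s - {i}"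
      "reals s' xCur 0 = min (reals s KEY i) (reals s xCur 0)"
      "reals s' xSA 0 = reals s xSA 0 + reals s AL i" "reals s' xSB 0 = reals s xSB 0 + reals s BE i"
    define c' where "c' = reals s' xCur 0"
    have c': "c' = min k c" using a(5) by (simp add: c'_def k_def c_def)
    have ca: "card (active M s) = Suc (card (active M s'))"
      using ia a(4) card.remove[of "active M s" i] by simp
    have bt: "1 + btime pop_guard + 60 \<le> 120" by (simp add: pop_guard_def)
    \<comment> \<open>The credit of the removed slot covers guard, body and \<open>replay\<close>,
      so the number of removals does not enter the time bound.\<close>
    have "potential L M t' s' \<le> potential L M t s"
      using a(1) ca bt by (simp add: potential_def algebra_simps)
    moreover have "unchanged {WIN, vV, vW} {xCur, xSA, xSB} s0 s'"
      by (rule unchanged_trans[OF un a(2)]) auto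
    moreover have "?f c' \<le> ?f y" if y: "c' \<le> y" "y \<le> ?hi" for y
    proof (cases "k < c")
      case True
      have piece: "?f y = quad (reals s xSA 0) (reals s xSB 0) y + pq_value M s k"
        if "k \<le> y" "y \<le> c" for y
        using rep[OF that(2)] pq_value_right_const[OF top that(1) order_refl] by simp
      show ?thesis
        using pop_step[OF cv _ True c(2) piece pos[OF True] right] lk c' y True by simp
    next
      case False then show ?thesis using right y c' by simp
    qed
    moreover have "?f y = pq_value M s' y + quad (reals s' xSA 0) (reals s' xSB 0) y" if "y \<le> c'" for y
    proof -
      have re: "reals s' KEY = reals s KEY" "reals s' AL = reals s AL" "reals s' BE = reals s BE"
        using unchanged_reals[OF a(2)] by simp_all
      have "pq_value M s y = pq_value M s' y + quad (reals s AL i) (reals s BE i) (min y (reals s KEY i))"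
        by (rule pq_value_remove[OF ia a(4)]) (simp add: re)
      then show ?thesis using that rep[of y] by (simp add: c' a(6,7) quad_add k_def min_absorb1)
    qed
    ultimately show "pop_inv L M t0 s0 t' s' \<and> card (active M s') < card (active M s)"
      using pot a(3,4) sub c' c lk ca unfolding pop_inv_def c'_def[symmetric] by auto
  qed
qed

lemma run_trunc:
  assumes q: "queue M s" and L: "2 * M \<le> 2 ^ L" and nx: "nats s vNX 0 < M"
    and lohi: "reals s xLo 0 \<le> reals s xHi 0"
    and cv: "convex_on {reals s xLo 0..reals s xHi 0} (pq_value M s)"
    and Q: "\<And>t' s'. potential L M t' s' \<le> potential L M t s + 800 * (L + 1) \<Longrightarrow>
        unchanged {WIN, vV, vNX, vW} {KEY, AL, BE, xCur, xSA, xSB, xKap, xM, xK, xA, xB} s s' \<Longrightarrow>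
        queue M s' \<Longrightarrow> nats s' vNX 0 = nats s vNX 0 + 1 \<Longrightarrow>
        argmin_on (reals s xLo 0) (reals s xHi 0) (pq_value M s) (reals s' xM 0) \<Longrightarrow>
        (\<And>x. pq_value M s' x = pq_value M s (min x (reals s' xM 0))) \<Longrightarrow> Q t' s'"
  shows "run trunc_prog s t Q"
proof -
  let ?lo = "reals s xLo 0" and ?hi = "reals s xHi 0"
  have M0: "0 < M" using nx by simp
  define s0 where "s0 = set_real (set_real (set_real s xCur 0 ?hi) xSA 0 0) xSB 0 0"
  have re0: "reals s0 KEY = reals s KEY" "reals s0 AL = reals s AL" "reals s0 BE = reals s BE"
    "nats s0 = nats s" "reals s0 xLo = reals s xLo" "reals s0 xHi = reals s xHi"
    by (simp_all add: s0_def)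
  have cur0: "reals s0 xCur 0 = ?hi" "reals s0 xSA 0 = 0" "reals s0 xSB 0 = 0" by (simp_all add: s0_def)
  have ac0: "active M s0 = active M s" by (simp add: active_def re0)
  have v0: "pq_value M s0 = pq_value M s" unfolding pq_value_def ac0 re0 ..
  have q0: "queue M s0"
    using q by (simp add: queue_def pq_ok_def slots_free_def pars_ok_def node_ok_def ac0 re0)
  have un0: "unchanged {} {xCur, xSA, xSB} s s0"
    unfolding s0_def by (intro unchanged_set_nat unchanged_set_real) auto
  define post where "post = (\<lambda>c. seq [rassign xKap (rvar xLo),
     Cond (BAnd (NLess (NLit 0) (NLoad WIN (NLit 1))) (RLess (rvar xLo) top_key))
       (rassign xKap top_key) Skip,
     Cond (RLess (RLit 0) (slope (rvar xKap))) (rassign xM (rvar xKap))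
       (Cond (BAnd (RLess (RLit 0) (rvar xSA))
           (RLess (RDiv (RSub (RLit 0) (rvar xSB)) (RMul (RLit 2) (rvar xSA))) (rvar xCur)))
         (rassign xM (RDiv (RSub (RLit 0) (rvar xSB)) (RMul (RLit 2) (rvar xSA))))
         (rassign xM (rvar xCur))),
     rassign xK (rvar xM), rassign xA (rvar xSA), rassign xB (rvar xSB), c])"
  have post: "run (post insert_prog) s1 t1 Q"
    if inv: "pop_inv L M (t + 20) s0 t2 s1" and g: "\<not> bval pop_guard s1" and t1: "t1 \<le> t2 + 60" for s1 t1 t2
  proof -
    define i where "i = nats s1 WIN 1"
    have iS: "nats s1 WIN (Suc 0) = i" by (simp add: i_def)
    define c where "c = reals s1 xCur 0"
    define a where "a = reals s1 xSA 0"
    define b where "b = reals s1 xSB 0"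
    define k where "k = (if i \<noteq> 0 \<and> ?lo < reals s1 KEY i then reals s1 KEY i else ?lo)"
    define m where "m = piece_argmin k c a b"
    have pot: "potential L M t2 s1 \<le> potential L M (t + 20) s + 50"
      and un: "unchanged {WIN, vV, vW} {xCur, xSA, xSB} s0 s1" and q1: "queue M s1"
      and c: "?lo \<le> c" "c \<le> ?hi"
      and right: "\<And>y. c \<le> y \<Longrightarrow> y \<le> ?hi \<Longrightarrow> pq_value M s c \<le> pq_value M s y"
      and rep: "\<And>y. y \<le> c \<Longrightarrow> pq_value M s y = pq_value M s1 y + quad a b y"
      using inv by (auto simp: pop_inv_def c_def v0 a_def b_def re0 potential_def ac0)
    have lo: "reals s1 xLo 0 = ?lo" using unchanged_reals[OF un] by (simp add: re0)
    have ok: "pq_ok M s1" using q1 by (simp add: queue_def)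
    have top: "reals s1 KEY j \<le> k" if "j \<in> active M s1" for j
      using root_max[OF ok that] by (auto simp: k_def i_def)
    \<comment> \<open>Failure of the guard is precisely this alternative: no key to the right of
      \<open>xLo\<close> is left, or the top key lies left of \<open>xCur\<close> and the slope
      there is nonpositive.\<close>
    have kc: "?lo \<le> k" "k \<le> c" and stop: "k = ?lo \<or> k < c \<and> 2 * a * k + b \<le> 0"
      using g c by (auto simp: k_def bval_pop_guard lo i_def c_def a_def b_def split: if_splits)
    have piece: "pq_value M s y = quad a b y + pq_value M s1 k" if "k \<le> y" "y \<le> c" for y
      using rep[OF that(2)] pq_value_right_const[OF top that(1) order_refl] by simp
    have am: "argmin_on ?lo ?hi (pq_value M s) m"
      unfolding m_def by (rule piece_argmin_optimal[OF cv kc c(2) piece stop right])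
    have mb: "k \<le> m" "m \<le> c" unfolding m_def using piece_argmin_bounds[OF kc(2)] by auto
    define s2 where "s2 = set_real (set_real (set_real (set_real (set_real s1 xKap 0 k) xM 0 m) xK 0 m) xA 0 a) xB 0 b"
    have re2: "reals s2 KEY = reals s1 KEY" "reals s2 AL = reals s1 AL" "reals s2 BE = reals s1 BE"
      "nats s2 = nats s1" by (simp_all add: s2_def)
    have ac2: "active M s2 = active M s1" by (simp add: active_def re2)
    have v2: "pq_value M s2 = pq_value M s1" unfolding pq_value_def ac2 re2 ..
    have q2: "queue M s2"
      using q1 by (simp add: queue_def pq_ok_def slots_free_def pars_ok_def node_ok_def ac2 re2)
    have un2: "unchanged {} {xKap, xM, xK, xA, xB} s1 s2"
      unfolding s2_def by (intro unchanged_set_nat unchanged_set_real) auto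
    have nx2: "nats s2 vNX 0 = nats s vNX 0"
      using unchanged_nats[OF un, of vNX] by (simp add: re2 re0)
    have fin: "run insert_prog s2 t3 Q" if t3: "t3 \<le> t1 + 90" for t3
    proof (rule run_insert[OF q2 L])
      show "nats s2 vNX 0 < M" using nx nx2 by simp
      fix t' s'
      assume h: "potential L M t' s' \<le> potential L M t3 s2 + 400 * (L + 1)"
        "unchanged {WIN, vV, vNX} {KEY, AL, BE} s2 s'" "queue M s'"
        "nats s' vNX 0 = nats s2 vNX 0 + 1"
        "\<And>x. pq_value M s' x = pq_value M s2 x + quad (reals s2 xA 0) (reals s2 xB 0) (min x (reals s2 xK 0))"
      have xm: "reals s' xM 0 = m" using unchanged_reals[OF h(2)] by (simp add: s2_def)
      show "Q t' s'"
      proof (rule Q)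
        have "potential L M t3 s2 \<le> potential L M t s + 220"
          using pot t3 t1 by (simp add: potential_def ac2)
        then show "potential L M t' s' \<le> potential L M t s + 800 * (L + 1)" using h(1) by simp
        have "unchanged {WIN, vV, vNX, vW} {KEY, AL, BE, xCur, xSA, xSB} s s1"
          by (rule unchanged_trans[OF un0 un]) auto
        from unchanged_trans[OF this un2, where C = "{WIN, vV, vNX, vW}"
            and D = "{KEY, AL, BE, xCur, xSA, xSB, xKap, xM, xK, xA, xB}"]
        have "unchanged {WIN, vV, vNX, vW} {KEY, AL, BE, xCur, xSA, xSB, xKap, xM, xK, xA, xB} s s2"
          by blast
        then show "unchanged {WIN, vV, vNX, vW} {KEY, AL, BE, xCur, xSA, xSB, xKap, xM, xK, xA, xB} s s'"
          by (rule unchanged_trans[OF _ h(2)]) auto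
        show "argmin_on ?lo ?hi (pq_value M s) (reals s' xM 0)" using am by (simp add: xm)
        show "nats s' vNX 0 = nats s vNX 0 + 1" using h(4) nx2 by simp
        show "pq_value M s' x = pq_value M s (min x (reals s' xM 0))" for x
        proof -
          \<comment> \<open>All remaining keys are at most \<open>k \<le> m\<close>, so the
            remaining terms are constant beyond \<open>m\<close>; the reinserted term is frozen
            there by its own key.\<close>
          have "pq_value M s1 x = pq_value M s1 (min x m)"
            using pq_value_right_const[OF top, where x = x and y = m] mb by (auto simp: min_def)
          then show ?thesis using h(5)[of x] rep[of "min x m"] mb by (simp add: xm v2) (simp add: s2_def)
        qed
      qed (rule h(3))
    qed
    have fin': "run insert_prog s2' t3 Q" if "s2' = s2" "t3 \<le> t1 + 90" for s2' t3
      using fin that by simp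
    show ?thesis
      unfolding post_def seq.simps
      apply (rule run_Seq, rule run_RStore, rule run_Seq, rule run_Cond)
      subgoal
        apply (rule run_RStore, rule run_Seq, rule run_Cond)
        subgoal
          apply (rule run_RStore, intro run_Seq run_RStore, rule fin')
          by (auto simp: s2_def m_def piece_argmin_def k_def lo iS a_def[symmetric] b_def[symmetric] set_real_def set_nat_def)
        subgoal
          apply (rule run_Cond; intro run_Seq run_RStore, rule fin')
          by (auto simp: s2_def m_def piece_argmin_def k_def lo iS a_def[symmetric] b_def[symmetric] c_def[symmetric] set_real_def set_nat_def)
        done
      subgoal
        apply (rule run_Skip, rule run_Seq, rule run_Cond)
        subgoal
          apply (rule run_RStore, intro run_Seq run_RStore, rule fin')
          by (auto simp: s2_def m_def piece_argmin_def k_def lo iS a_def[symmetric] b_def[symmetric] set_real_def set_nat_def)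
        subgoal
          apply (rule run_Cond; intro run_Seq run_RStore, rule fin')
          by (auto simp: s2_def m_def piece_argmin_def k_def lo iS a_def[symmetric] b_def[symmetric] c_def[symmetric] set_real_def set_nat_def)
        done
      done
  qed
  have loop: "run (While pop_guard pop_body) s0 t0 (\<lambda>t' s'. run (post insert_prog) s' t' Q)"
    if t0: "t0 \<le> t + 20" for t0
  proof (rule run_While[where I = "pop_inv L M (t + 20) s0" and \<mu> = "\<lambda>s. card (active M s)"])
    show "pop_inv L M (t + 20) s0 t0 s0"
      using t0 q0 lohi
      by (simp add: pop_inv_def potential_def re0 cur0 flip: order_eq_iff)
    show "run pop_body s' (t' + (1 + btime pop_guard))
        (\<lambda>t'' s''. pop_inv L M (t + 20) s0 t'' s'' \<and> card (active M s'') < card (active M s'))"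
      if "pop_inv L M (t + 20) s0 t' s'" "bval pop_guard s'" for t' s'
      by (rule pop_inv_step[OF that(1) L M0 _ that(2)]) (use cv in \<open>simp add: v0 re0\<close>)
    show "run (post insert_prog) s' (t' + (1 + btime pop_guard)) Q"
      if "pop_inv L M (t + 20) s0 t' s'" "\<not> bval pop_guard s'" for t' s'
      by (rule post[OF that]) (simp add: pop_guard_def)
  qed
  show ?thesis
    unfolding trunc_prog_def seq.simps
    apply (intro run_Seq run_RStore)
    apply (rule run_state[OF _ loop[unfolded post_def seq.simps]])
    by (simp_all add: s0_def)
qed

section \<open>Inserting a cost function into the queue\<close>

text \<open>In the array \<open>R\<close> the \<open>k\<close> kinks start at \<open>p\<close> and are followed by the coefficient triples.\<close>

definition stored_cost :: "(nat \<Rightarrow> real) \<Rightarrow> nat \<Rightarrow> nat \<Rightarrow> (real \<Rightarrow> real) \<Rightarrow> bool" where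
  "stored_cost R p k f \<longleftrightarrow>
     (\<forall>j. Suc j < k \<longrightarrow> R (p + j) \<le> R (p + Suc j)) \<and>
     (\<forall>j\<le>k. \<forall>u. (0 < j \<longrightarrow> R (p + (j - 1)) \<le> u) \<and> (j < k \<longrightarrow> u \<le> R (p + j)) \<longrightarrow>
        f u = quad (R (p + k + 3 * j)) (R (p + k + 3 * j + 1)) u + R (p + k + 3 * j + 2))"

text \<open>The boundaries of the pieces of \<open>x \<mapsto> f (clip a b x + o')\<close>: the
  kinks moved by \<open>o'\<close> and confined to \<open>[a, b]\<close>. Index 0 is the left end
  and index \<open>k + 1\<close> the right end. Pieces outside \<open>[a, b]\<close> become empty,
  and for \<open>b < a\<close> all boundaries coincide with \<open>a\<close>.\<close>

definition shifted_kink :: "(nat \<Rightarrow> real) \<Rightarrow> nat \<Rightarrow> nat \<Rightarrow> real \<Rightarrow> real \<Rightarrow> real \<Rightarrow> nat \<Rightarrow> real" where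
  "shifted_kink R p k o' a b j =
     (case j of 0 \<Rightarrow> a | Suc i \<Rightarrow> max a (if i < k \<and> R (p + i) - o' < b then R (p + i) - o' else b))"

lemma quad_shift: "quad a b (x + c) = quad a (2 * a * c + b) x + quad a b c"
  by (simp add: quad_def algebra_simps power2_eq_square)

text \<open>A term with negated coefficients and key \<open>\<kappa>\<close> together with the
  original term and key \<open>\<kappa>'\<close> contributes 0 up to \<open>\<kappa>\<close>,
  follows the piece between the keys and is constant afterwards. It is thus the increment of the
  cost over this piece, and the increments of successive pieces telescope.\<close>

lemma insert_piece_value:
  fixes R :: "nat \<Rightarrow> real" and o' a b :: real
  assumes st: "stored_cost R p k f" and j: "j \<le> k"
  defines "al \<equiv> R (p + k + 3 * j)" and "be \<equiv> 2 * R (p + k + 3 * j) * o' + R (p + k + 3 * j + 1)"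
    and "\<kappa> \<equiv> shifted_kink R p k o' a b j" and "\<kappa>' \<equiv> shifted_kink R p k o' a b (Suc j)"
  shows "quad (- al) (- be) (min x \<kappa>) + quad al be (min x \<kappa>') =
    f (clip a b (min x \<kappa>') + o') - f (clip a b (min x \<kappa>) + o')"
proof -
  have ge: "a \<le> \<kappa>" "a \<le> \<kappa>'" and le: "\<kappa> \<le> max a b" "\<kappa>' \<le> max a b"
    by (auto simp: \<kappa>_def \<kappa>'_def shifted_kink_def split: nat.split)
  have mono: "\<kappa> \<le> \<kappa>'"
  proof (cases j)
    case 0 then show ?thesis using ge by (simp add: \<kappa>_def shifted_kink_def)
  next
    case (Suc i)
    have "R (p + i) \<le> R (p + Suc i)" if "Suc i < k" using st that by (simp add: stored_cost_def)
    then show ?thesis using j Suc by (auto simp: \<kappa>_def \<kappa>'_def shifted_kink_def)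
  qed
  have neg: "quad (- al) (- be) y = - quad al be y" for y by (simp add: quad_def)
  show ?thesis
  proof (cases "\<kappa> < x \<and> \<kappa> < \<kappa>'")
    \<comment> \<open>Either \<open>x\<close> has not passed the left boundary or the piece is
      empty: both terms are evaluated at the same point and cancel.\<close>
    case False
    then have "min x \<kappa> = min x \<kappa>'" using mono by auto
    then show ?thesis by (simp add: neg)
  next
    case True
    then have ab: "a < b" using ge le by auto
    have on: "f (clip a b y + o') = quad al be y + (quad al (R (p + k + 3 * j + 1)) o' + R (p + k + 3 * j + 2))"
      if y: "\<kappa> \<le> y" "y \<le> \<kappa>'" for y
    proof -
      have c: "clip a b y = y" using y ge le ab by (auto simp: clip_def)
      have l: "R (p + (j - 1)) \<le> y + o'" if "0 < j"
        using that y True le ab j by (cases j) (auto simp: \<kappa>_def shifted_kink_def split: if_splits)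
      have r: "y + o' \<le> R (p + j)" if "j < k"
        using that y True ge ab by (auto simp: \<kappa>'_def shifted_kink_def max_def split: if_splits)
      have "f (y + o') = quad (R (p + k + 3 * j)) (R (p + k + 3 * j + 1)) (y + o') + R (p + k + 3 * j + 2)"
        using st j l r unfolding stored_cost_def by blast
      then show ?thesis unfolding c quad_shift al_def be_def by simp
    qed
    have "min x \<kappa> = \<kappa>" "\<kappa> \<le> min x \<kappa>'" "min x \<kappa>' \<le> \<kappa>'" using True by auto
    then show ?thesis using on[of \<kappa>] on[of "min x \<kappa>'"] mono by (simp add: neg)
  qed
qed

text \<open>The last boundary is \<open>max a b\<close>, beyond which clipping is constant.\<close>

lemma clip_last_kink: "clip a b (min x (shifted_kink R p k o' a b (Suc k))) = clip a b x"
  by (auto simp: clip_def shifted_kink_def)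

abbreviation (input) "vP \<equiv> 24 :: nat"
abbreviation (input) "vE \<equiv> 25 :: nat"
abbreviation (input) "vD \<equiv> 26 :: nat"
abbreviation (input) "xO \<equiv> 30 :: nat"
abbreviation (input) "xJA \<equiv> 31 :: nat"
abbreviation (input) "xJB \<equiv> 32 :: nat"
abbreviation (input) "xK1 \<equiv> 33 :: nat"
abbreviation (input) "xK2 \<equiv> 34 :: nat"
abbreviation (input) "xCA \<equiv> 35 :: nat"
abbreviation (input) "xCB \<equiv> 36 :: nat"

text \<open>\<open>xK1\<close> holds the left boundary of the current piece and \<open>xK2\<close>
  its right boundary, which becomes the left one of the next piece.\<close>

definition piece_prog :: com where
  "piece_prog = seq [
     Cond (BAnd (NLess (nvar vP) (nvar vE)) (RLess (RSub (RLoad 0 (nvar vP)) (rvar xO)) (rvar xJB)))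
       (rassign xK2 (RSub (RLoad 0 (nvar vP)) (rvar xO))) (rassign xK2 (rvar xJB)),
     Cond (RLess (rvar xK2) (rvar xJA)) (rassign xK2 (rvar xJA)) Skip,
     rassign xCA (RLoad 0 (nvar vD)),
     rassign xCB (RAdd (RMul (RMul (RLit 2) (rvar xCA)) (rvar xO)) (RLoad 0 (NAdd (nvar vD) (NLit 1)))),
     rassign xK (rvar xK1), rassign xA (RSub (RLit 0) (rvar xCA)), rassign xB (RSub (RLit 0) (rvar xCB)),
     insert_prog,
     rassign xK (rvar xK2), rassign xA (rvar xCA), rassign xB (rvar xCB), insert_prog,
     rassign xK1 (rvar xK2), nassign vP (NAdd (nvar vP) (NLit 1)), nassign vD (NAdd (nvar vD) (NLit 3))]"

text \<open>\<open>k\<close> kinks bound \<open>k + 1\<close> pieces, hence the test against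
  \<open>vE + 1\<close>. The coefficients follow the kinks, so \<open>vD\<close> starts at
  \<open>vE\<close>. In the last round \<open>vP = vE\<close> no longer addresses a kink, which
  explains the comparison of \<open>vP\<close> with \<open>vE\<close> in
  \<open>piece_prog\<close>.\<close>

definition insert_cost_prog :: com where
  "insert_cost_prog = seq [rassign xK1 (rvar xJA), nassign vD (nvar vE),
     While (NLess (nvar vP) (NAdd (nvar vE) (NLit 1))) piece_prog]"

lemma queue_set_scalars:
  assumes "queue M s" "nats s' WIN = nats s WIN" "nats s' PAR = nats s PAR" "nats s' vNX = nats s vNX"
    "nats s' vM = nats s vM" "reals s' KEY = reals s KEY"
  shows "queue M s'" "active M s' = active M s"
  using assms by (simp_all add: queue_def pq_ok_def slots_free_def pars_ok_def node_ok_def active_def)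

lemma pq_value_unchanged:
  assumes "unchanged A B s s'" "WIN \<notin> A" "KEY \<notin> B" "AL \<notin> B" "BE \<notin> B"
  shows "pq_value M s' = pq_value M s" "active M s' = active M s"
  using assms by (simp_all add: fun_eq_iff pq_value_def active_def unchanged_def)

lemma queue_unchanged:
  assumes "unchanged A B s s'" "queue M s" "WIN \<notin> A" "PAR \<notin> A" "vNX \<notin> A" "vM \<notin> A" "KEY \<notin> B"
  shows "queue M s'"
  by (rule queue_set_scalars(1)[OF assms(2)]) (use assms in \<open>simp_all add: unchanged_def\<close>)

lemma run_piece:
  assumes q: "queue M s" and L: "2 * M \<le> 2 ^ L" and nx: "nats s vNX 0 + 1 < M"
    and Q: "\<And>t' s'. potential L M t' s' \<le> potential L M t s + 900 * (L + 1) + 100 \<Longrightarrow>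
        unchanged {WIN, vV, vNX, vP, vD} {KEY, AL, BE, xK, xA, xB, xK1, xK2, xCA, xCB} s s' \<Longrightarrow>
        queue M s' \<Longrightarrow> nats s' vNX 0 = nats s vNX 0 + 2 \<Longrightarrow>
        nats s' vP 0 = nats s vP 0 + 1 \<Longrightarrow> nats s' vD 0 = nats s vD 0 + 3 \<Longrightarrow>
        reals s' xK1 0 = max (reals s xJA 0) (if nats s vP 0 < nats s vE 0 \<and>
          reals s 0 (nats s vP 0) - reals s xO 0 < reals s xJB 0
          then reals s 0 (nats s vP 0) - reals s xO 0 else reals s xJB 0) \<Longrightarrow>
        (\<And>x. pq_value M s' x = pq_value M s x +
          (quad (- reals s 0 (nats s vD 0))
             (- (2 * reals s 0 (nats s vD 0) * reals s xO 0 + reals s 0 (nats s vD 0 + 1))) (min x (reals s xK1 0)) +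
           quad (reals s 0 (nats s vD 0))
             (2 * reals s 0 (nats s vD 0) * reals s xO 0 + reals s 0 (nats s vD 0 + 1)) (min x (reals s' xK1 0)))) \<Longrightarrow>
        Q t' s'"
  shows "run piece_prog s t Q"
proof -
  define \<kappa> where "\<kappa> = max (reals s xJA 0) (if nats s vP 0 < nats s vE 0 \<and>
          reals s 0 (nats s vP 0) - reals s xO 0 < reals s xJB 0
          then reals s 0 (nats s vP 0) - reals s xO 0 else reals s xJB 0)"
  define a where "a = reals s 0 (nats s vD 0)"
  define b where "b = 2 * a * reals s xO 0 + reals s 0 (nats s vD 0 + 1)"
  define s1 where "s1 = set_real (set_real (set_real (set_real (set_real (set_real s xK2 0 \<kappa>)
      xCA 0 a) xCB 0 b) xK 0 (reals s xK1 0)) xA 0 (- a)) xB 0 (- b)"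
  have un1: "unchanged {} {xK2, xCA, xCB, xK, xA, xB} s s1"
    unfolding s1_def by (intro unchanged_set_real) auto
  have q1: "queue M s1" by (rule queue_unchanged[OF un1 q]) auto
  have v1: "pq_value M s1 = pq_value M s" "active M s1 = active M s"
    by (rule pq_value_unchanged[OF un1]; simp)+
  have fin: "run insert_prog s1 t1 (\<lambda>t' s'. run (seq [rassign xK (rvar xK2), rassign xA (rvar xCA),
      rassign xB (rvar xCB), insert_prog, rassign xK1 (rvar xK2),
      nassign vP (NAdd (nvar vP) (NLit 1)), nassign vD (NAdd (nvar vD) (NLit 3))]) s' t' Q)"
    if t1: "t1 \<le> t + 70" for t1
  proof (rule run_insert[OF q1 L])
    show "nats s1 vNX 0 < M" using nx by (simp add: s1_def)
    fix t2 s2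
    assume p2: "potential L M t2 s2 \<le> potential L M t1 s1 + 400 * (L + 1)"
      and un2: "unchanged {WIN, vV, vNX} {KEY, AL, BE} s1 s2" and q2: "queue M s2"
      and nx2: "nats s2 vNX 0 = nats s1 vNX 0 + 1"
      and v2: "\<And>x. pq_value M s2 x = pq_value M s1 x +
           quad (reals s1 xA 0) (reals s1 xB 0) (min x (reals s1 xK 0))"
    define s3 where "s3 = set_real (set_real (set_real s2 xK 0 \<kappa>) xA 0 a) xB 0 b"
    have un3: "unchanged {} {xK, xA, xB} s2 s3"
      unfolding s3_def by (intro unchanged_set_real) auto
    have q3: "queue M s3" by (rule queue_unchanged[OF un3 q2]) auto
    have v3: "pq_value M s3 = pq_value M s2" "active M s3 = active M s2"
      by (rule pq_value_unchanged[OF un3]; simp)+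
    have re2: "reals s2 xK2 0 = \<kappa>" "reals s2 xCA 0 = a" "reals s2 xCB 0 = b"
      using unchanged_reals[OF un2] by (simp_all add: s1_def)
    have re3: "reals s3 xK 0 = \<kappa>" "reals s3 xA 0 = a" "reals s3 xB 0 = b" by (simp_all add: s3_def)
    have re1: "reals s1 xK 0 = reals s xK1 0" "reals s1 xA 0 = - a" "reals s1 xB 0 = - b"
      by (simp_all add: s1_def)
    have fin3: "run insert_prog s3 t3 (\<lambda>t' s'. run (seq [rassign xK1 (rvar xK2),
        nassign vP (NAdd (nvar vP) (NLit 1)), nassign vD (NAdd (nvar vD) (NLit 3))]) s' t' Q)"
      if t3: "t3 \<le> t2 + 12" for t3
    proof (rule run_insert[OF q3 L])
      show "nats s3 vNX 0 < M" using nx nx2 by (simp add: s3_def s1_def)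
      fix t4 s4
      assume p4: "potential L M t4 s4 \<le> potential L M t3 s3 + 400 * (L + 1)"
        and un4: "unchanged {WIN, vV, vNX} {KEY, AL, BE} s3 s4" and q4: "queue M s4"
        and nx4: "nats s4 vNX 0 = nats s3 vNX 0 + 1"
        and v4: "\<And>x. pq_value M s4 x = pq_value M s3 x +
             quad (reals s3 xA 0) (reals s3 xB 0) (min x (reals s3 xK 0))"
      have n4: "nats s4 vP 0 = nats s vP 0" "nats s4 vD 0 = nats s vD 0"
        using unchanged_nats[OF un4] unchanged_nats[OF un3] unchanged_nats[OF un2] unchanged_nats[OF un1]
        by simp_all
      have k4: "reals s4 xK2 0 = \<kappa>"
        using unchanged_reals[OF un4] unchanged_reals[OF un3] re2 by simp
      define s5 where "s5 = set_nat (set_nat (set_real s4 xK1 0 \<kappa>) vP 0 (nats s vP 0 + 1)) vD 0 (nats s vD 0 + 3)"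
      have un5: "unchanged {vP, vD} {xK1} s4 s5"
        unfolding s5_def by (intro unchanged_set_real unchanged_set_nat) auto
      have "unchanged {WIN, vV, vNX} {KEY, AL, BE, xK, xA, xB, xK2, xCA, xCB} s s2"
        by (rule unchanged_trans[OF un1 un2]) auto
      from unchanged_trans[OF this un3, where C = "{WIN, vV, vNX}" and D = "{KEY, AL, BE, xK, xA, xB, xK2, xCA, xCB}"]
      have "unchanged {WIN, vV, vNX} {KEY, AL, BE, xK, xA, xB, xK2, xCA, xCB} s s3" by blast
      from unchanged_trans[OF this un4, where C = "{WIN, vV, vNX}" and D = "{KEY, AL, BE, xK, xA, xB, xK2, xCA, xCB}"]
      have u4: "unchanged {WIN, vV, vNX} {KEY, AL, BE, xK, xA, xB, xK2, xCA, xCB} s s4" by blast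
      have fin5: "Q t5 s5" if t5: "t5 \<le> t4 + 20" for t5
      proof (rule Q)
        show "potential L M t5 s5 \<le> potential L M t s + 900 * (L + 1) + 100"
          using t5 t3 t1 p2 p4 pq_value_unchanged(2)[OF un5]
          by (simp add: potential_def v3 v1 algebra_simps)
        show "unchanged {WIN, vV, vNX, vP, vD} {KEY, AL, BE, xK, xA, xB, xK1, xK2, xCA, xCB} s s5"
          by (rule unchanged_trans[OF u4 un5]) auto
        show "queue M s5" by (rule queue_unchanged[OF un5 q4]) auto
        show "nats s5 vNX 0 = nats s vNX 0 + 2" using nx4 nx2 by (simp add: s5_def s3_def s1_def)
        show "nats s5 vP 0 = nats s vP 0 + 1" "nats s5 vD 0 = nats s vD 0 + 3" by (simp_all add: s5_def)
        show "reals s5 xK1 0 = max (reals s xJA 0) (if nats s vP 0 < nats s vE 0 \<and>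
          reals s 0 (nats s vP 0) - reals s xO 0 < reals s xJB 0
          then reals s 0 (nats s vP 0) - reals s xO 0 else reals s xJB 0)"
          by (simp add: s5_def \<kappa>_def)
        have k5: "reals s5 xK1 0 = \<kappa>" by (simp add: s5_def)
        show "pq_value M s5 x = pq_value M s x +
          (quad (- reals s 0 (nats s vD 0))
             (- (2 * reals s 0 (nats s vD 0) * reals s xO 0 + reals s 0 (nats s vD 0 + 1))) (min x (reals s xK1 0)) +
           quad (reals s 0 (nats s vD 0))
             (2 * reals s 0 (nats s vD 0) * reals s xO 0 + reals s 0 (nats s vD 0 + 1)) (min x (reals s5 xK1 0)))" for x
          unfolding k5 a_def[symmetric] b_def[symmetric]
          using v4[of x] v2[of x] pq_value_unchanged(1)[OF un5] by (simp add: v3 v1 re1 re3)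
      qed
      show "run (seq [rassign xK1 (rvar xK2), nassign vP (NAdd (nvar vP) (NLit 1)),
          nassign vD (NAdd (nvar vD) (NLit 3))]) s4 t4 Q"
        unfolding seq.simps
        by (intro run_Seq run_RStore run_NStore) (rule fin5[unfolded s5_def, THEN back_subst[of "Q _"]], simp_all add: k4 n4)
    qed
    show "run (seq [rassign xK (rvar xK2), rassign xA (rvar xCA),
      rassign xB (rvar xCB), insert_prog, rassign xK1 (rvar xK2),
      nassign vP (NAdd (nvar vP) (NLit 1)), nassign vD (NAdd (nvar vD) (NLit 3))]) s2 t2 Q"
      unfolding seq.simps
      by (intro run_Seq run_RStore, rule run_state[OF _ fin3[unfolded seq.simps]]) (simp_all add: s3_def re2)
  qed
  have fin': "s' = s1 \<Longrightarrow> t1 \<le> t + 70 \<Longrightarrow> run insert_prog s' t1 (\<lambda>t' s'. run (seq [rassign xK (rvar xK2), rassign xA (rvar xCA),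
      rassign xB (rvar xCB), insert_prog, rassign xK1 (rvar xK2),
      nassign vP (NAdd (nvar vP) (NLit 1)), nassign vD (NAdd (nvar vD) (NLit 3))]) s' t' Q)" for s' t1
    using fin by simp
  show ?thesis
    unfolding piece_prog_def seq.simps
    apply (rule run_Seq, rule run_Cond; rule run_RStore, rule run_Seq, rule run_Cond)
       apply ((rule run_RStore | rule run_Skip), intro run_Seq run_RStore, rule fin'[unfolded seq.simps],
         force simp: s1_def set_real_def \<kappa>_def a_def b_def, simp)+
    done
qed

text \<open>By \<open>insert_piece_value\<close> the contributions telescope: after \<open>j\<close>
  pieces the queue has gained the cost with its argument cut off at boundary \<open>j\<close>, minus
  its value at the left end. That value, negated, is the constant \<open>C\<close>.\<close>

lemma run_insert_cost:
  assumes q: "queue M s" and L: "2 * M \<le> 2 ^ L"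
    and st: "stored_cost (reals s 0) (nats s vP 0) k f" and e: "nats s vE 0 = nats s vP 0 + k"
    and nx: "nats s vNX 0 + 2 * (k + 1) \<le> M"
    and Q: "\<And>t' s' C. potential L M t' s' \<le> potential L M t s + 1200 * (L + 1) * (k + 1) \<Longrightarrow>
        unchanged {WIN, vV, vNX, vP, vD} {KEY, AL, BE, xK, xA, xB, xK1, xK2, xCA, xCB} s s' \<Longrightarrow>
        queue M s' \<Longrightarrow> nats s' vNX 0 = nats s vNX 0 + 2 * (k + 1) \<Longrightarrow>
        (\<And>x. pq_value M s' x = pq_value M s x +
           f (clip (reals s xJA 0) (reals s xJB 0) x + reals s xO 0) + C) \<Longrightarrow> Q t' s'"
  shows "run insert_cost_prog s t Q"
proof -
  let ?p = "nats s vP 0" and ?R = "reals s 0" and ?o = "reals s xO 0" and ?a = "reals s xJA 0" and ?b = "reals s xJB 0"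
  let ?N = "{WIN, vV, vNX, vP, vD}" and ?B = "{KEY, AL, BE, xK, xA, xB, xK1, xK2, xCA, xCB}"
  let ?\<kappa> = "shifted_kink ?R ?p k ?o ?a ?b"
  define I where "I t' s' \<longleftrightarrow> (\<exists>j\<le>k + 1. nats s' vP 0 = ?p + j \<and> nats s' vD 0 = ?p + k + 3 * j \<and>
      reals s' xK1 0 = ?\<kappa> j \<and> nats s' vNX 0 = nats s vNX 0 + 2 * j \<and>
      potential L M t' s' \<le> potential L M t s + 20 + 1100 * (L + 1) * j \<and>
      unchanged ?N ?B s s' \<and> queue M s' \<and>
      (\<forall>x. pq_value M s' x = pq_value M s x + (f (clip ?a ?b (min x (?\<kappa> j)) + ?o) - f (?a + ?o))))"
    for t' s'
  let ?g = "NLess (nvar vP) (NAdd (nvar vE) (NLit 1))"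
  define s0 where "s0 = set_nat (set_real s xK1 0 ?a) vD 0 (?p + k)"
  have un0: "unchanged {vD} {xK1} s s0"
    unfolding s0_def by (intro unchanged_set_nat unchanged_set_real) auto
  have loop: "run (While ?g piece_prog) s0 t0 Q" if t0: "t0 \<le> t + 20" for t0
  proof (rule run_While[where I = I and \<mu> = "\<lambda>s'. ?p + k + 1 - nats s' vP 0"])
    have "unchanged ?N ?B s s0" by (rule unchanged_trans[OF un0 unchanged_refl]) auto
    moreover have "queue M s0" by (rule queue_unchanged[OF un0 q]) auto
    moreover have "pq_value M s0 = pq_value M s" "active M s0 = active M s"
      by (rule pq_value_unchanged[OF un0]; simp)+
    ultimately show "I t0 s0"
      unfolding I_def using t0
      by (intro exI[of _ 0]) (simp add: potential_def s0_def shifted_kink_def, simp add: clip_def)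
  next
    fix t1 s1 assume I1: "I t1 s1" and g: "bval ?g s1"
    from I1 obtain j where vP: "nats s1 vP 0 = ?p + j" and vD: "nats s1 vD 0 = ?p + k + 3 * j"
      and k1: "reals s1 xK1 0 = ?\<kappa> j" and nx1: "nats s1 vNX 0 = nats s vNX 0 + 2 * j"
      and pot1: "potential L M t1 s1 \<le> potential L M t s + 20 + 1100 * (L + 1) * j"
      and un1: "unchanged ?N ?B s s1" and q1: "queue M s1"
      and v1: "\<And>x. pq_value M s1 x = pq_value M s x + (f (clip ?a ?b (min x (?\<kappa> j)) + ?o) - f (?a + ?o))"
      unfolding I_def by auto
    have e1: "nats s1 vE 0 = ?p + k" using unchanged_nats[OF un1] e by simp
    have j: "j \<le> k" using g vP e1 by simp
    have re: "reals s1 0 = ?R" "reals s1 xO = reals s xO" "reals s1 xJA = reals s xJA" "reals s1 xJB = reals s xJB"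
      using unchanged_reals[OF un1] by simp_all
    show "run piece_prog s1 (t1 + (1 + btime ?g))
        (\<lambda>t' s'. I t' s' \<and> ?p + k + 1 - nats s' vP 0 < ?p + k + 1 - nats s1 vP 0)"
    proof (rule run_piece[OF q1 L])
      show "nats s1 vNX 0 + 1 < M" using nx nx1 j by simp
      fix t2 s2
      assume pot2: "potential L M t2 s2 \<le> potential L M (t1 + (1 + btime ?g)) s1 + 900 * (L + 1) + 100"
        and un2: "unchanged ?N ?B s1 s2" and q2: "queue M s2" and nx2: "nats s2 vNX 0 = nats s1 vNX 0 + 2"
        and vP2: "nats s2 vP 0 = nats s1 vP 0 + 1" and vD2: "nats s2 vD 0 = nats s1 vD 0 + 3"
        and k2: "reals s2 xK1 0 = max (reals s1 xJA 0) (if nats s1 vP 0 < nats s1 vE 0 \<and>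
          reals s1 0 (nats s1 vP 0) - reals s1 xO 0 < reals s1 xJB 0
          then reals s1 0 (nats s1 vP 0) - reals s1 xO 0 else reals s1 xJB 0)"
        and v2: "\<And>x. pq_value M s2 x = pq_value M s1 x +
          (quad (- reals s1 0 (nats s1 vD 0))
             (- (2 * reals s1 0 (nats s1 vD 0) * reals s1 xO 0 + reals s1 0 (nats s1 vD 0 + 1))) (min x (reals s1 xK1 0)) +
           quad (reals s1 0 (nats s1 vD 0))
             (2 * reals s1 0 (nats s1 vD 0) * reals s1 xO 0 + reals s1 0 (nats s1 vD 0 + 1)) (min x (reals s2 xK1 0)))"
      have k2': "reals s2 xK1 0 = ?\<kappa> (Suc j)"
        unfolding k2 re vP e1 by (simp add: shifted_kink_def)
      have "unchanged ?N ?B s s2" by (rule unchanged_trans[OF un1 un2]) auto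
      moreover have "pq_value M s2 x = pq_value M s x + (f (clip ?a ?b (min x (?\<kappa> (Suc j))) + ?o) - f (?a + ?o))" for x
        using v2[of x] v1[of x] insert_piece_value[OF st j, of ?o x ?a ?b] by (simp add: k2' k1 re vD)
      moreover have "potential L M t2 s2 \<le> potential L M t s + 20 + 1100 * (L + 1) * Suc j"
        using pot2 pot1 by (simp add: potential_def)
      ultimately have "I t2 s2"
        unfolding I_def using j k2' q2 nx2 nx1 vP2 vP vD2 vD by (intro exI[of _ "Suc j"]) simp
      then show "I t2 s2 \<and> ?p + k + 1 - nats s2 vP 0 < ?p + k + 1 - nats s1 vP 0"
        using vP vP2 j by simp
    qed
  next
    fix t1 s1 assume I1: "I t1 s1" and g: "\<not> bval ?g s1"
    from I1 obtain j where j: "j \<le> k + 1" and vP: "nats s1 vP 0 = ?p + j"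
      and nx1: "nats s1 vNX 0 = nats s vNX 0 + 2 * j"
      and pot1: "potential L M t1 s1 \<le> potential L M t s + 20 + 1100 * (L + 1) * j"
      and un1: "unchanged ?N ?B s s1" and q1: "queue M s1"
      and v1: "\<And>x. pq_value M s1 x = pq_value M s x + (f (clip ?a ?b (min x (?\<kappa> j)) + ?o) - f (?a + ?o))"
      unfolding I_def by auto
    have jk: "j = Suc k" using g j vP unchanged_nats[OF un1] e by simp
    show "Q (t1 + (1 + btime ?g)) s1"
    proof (rule Q[OF _ un1 q1])
      show "potential L M (t1 + (1 + btime ?g)) s1 \<le> potential L M t s + 1200 * (L + 1) * (k + 1)"
        using pot1 by (simp add: potential_def jk algebra_simps)
      show "nats s1 vNX 0 = nats s vNX 0 + 2 * (k + 1)" using nx1 jk by simp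
      show "pq_value M s1 x = pq_value M s x + f (clip ?a ?b x + ?o) + - f (?a + ?o)" for x
        using v1[of x] by (simp add: jk clip_last_kink)
    qed
  qed
  show ?thesis
    unfolding insert_cost_prog_def seq.simps
    by (intro run_Seq run_RStore run_NStore, rule run_state[OF _ loop]) (simp_all add: s0_def e)
qed

section \<open>Solving a chain\<close>

abbreviation (input) "PS \<equiv> 12 :: nat"
abbreviation (input) "JC \<equiv> 13 :: nat"
abbreviation (input) "JE \<equiv> 14 :: nat"
abbreviation (input) "vJ \<equiv> 27 :: nat"
abbreviation (input) "vS \<equiv> 28 :: nat"
abbreviation (input) "vNS \<equiv> 29 :: nat"
abbreviation (input) "vKB \<equiv> 30 :: nat"
abbreviation (input) "JO \<equiv> 15 :: nat"
abbreviation (input) "JA \<equiv> 16 :: nat"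
abbreviation (input) "JB \<equiv> 17 :: nat"
abbreviation (input) "LO \<equiv> 18 :: nat"
abbreviation (input) "HI \<equiv> 19 :: nat"
abbreviation (input) "xU \<equiv> 37 :: nat"
abbreviation (input) "MM \<equiv> 40 :: nat"
abbreviation (input) "UU \<equiv> 41 :: nat"

text \<open>Stage \<open>\<sigma>\<close> of the chain has the box \<open>[LO \<sigma>, HI \<sigma>]\<close> and the jobs from \<open>JE (\<sigma> - 1)\<close> up to \<open>JE \<sigma>\<close>, exclusively;
  a job contributes \<open>x \<mapsto> f (clip JA JB x + JO)\<close>, where \<open>f\<close> is the cost function of the cell \<open>JC\<close>.\<close>

definition reset_prog :: com where
  "reset_prog = seq [nassign vV (NLit 0),
     While (NLess (nvar vV) (NAdd (nvar vM) (nvar vM)))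
       (seq [NStore WIN (nvar vV) (NLit 0), nassign vV (NAdd (nvar vV) (NLit 1))]),
     nassign vNX (NLit 1)]"

definition job_prog :: com where
  "job_prog = seq [nassign vP (NLoad PS (NLoad JC (nvar vJ))),
     nassign vE (NAdd (nvar vP) (NLoad 0 (NAdd (nvar vKB) (NLoad JC (nvar vJ))))),
     rassign xO (RLoad JO (nvar vJ)), rassign xJA (RLoad JA (nvar vJ)), rassign xJB (RLoad JB (nvar vJ)),
     insert_cost_prog, nassign vJ (NAdd (nvar vJ) (NLit 1))]"

definition stage_prog :: com where
  "stage_prog = seq [While (NLess (nvar vJ) (NLoad JE (nvar vS))) job_prog,
     rassign xLo (RLoad LO (nvar vS)), rassign xHi (RLoad HI (nvar vS)), trunc_prog,
     RStore MM (nvar vS) (rvar xM), nassign vS (NAdd (nvar vS) (NLit 1))]"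

definition backtrack_prog :: com where
  "backtrack_prog = While (NLess (NLit 0) (nvar vS)) (seq [nassign vS (NSub (nvar vS) (NLit 1)),
       Cond (RLess (RLoad MM (nvar vS)) (rvar xU)) (rassign xU (RLoad MM (nvar vS))) Skip,
       RStore UU (nvar vS) (rvar xU)])"

text \<open>\<open>xU\<close> starts at the right end of the last box, which is an upper bound of
  the last minimiser; the first backtracking step therefore yields this minimiser itself.\<close>

definition solve_prog :: com where
  "solve_prog = seq [reset_prog, nassign vS (NLit 0), nassign vJ (NLit 0),
     While (NLess (nvar vS) (nvar vNS)) stage_prog,
     rassign xU (RLoad HI (NSub (nvar vNS) (NLit 1))), backtrack_prog]"

text \<open>The tree is cleared explicitly because the solver runs twice, and the second run must
  not see slots left by the first.\<close>

lemma run_reset: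
  assumes pars: "pars_ok M s" and vM: "nats s vM 0 = M"
    and Q: "\<And>t' s'. t' \<le> t + 40 * M + 40 \<Longrightarrow> unchanged {WIN, vV, vNX} {} s s' \<Longrightarrow> queue M s' \<Longrightarrow>
        nats s' vNX 0 = 1 \<Longrightarrow> active M s' = {} \<Longrightarrow> Q t' s'"
  shows "run reset_prog s t Q"
proof -
  define I where "I t' s' \<longleftrightarrow> unchanged {WIN, vV} {} s s' \<and> nats s' vV 0 \<le> 2 * M \<and>
      t' \<le> t + 3 + 20 * nats s' vV 0 \<and> (\<forall>i<nats s' vV 0. nats s' WIN i = 0)" for t' s'
  let ?g = "NLess (nvar vV) (NAdd (nvar vM) (nvar vM))"
  show ?thesis
    unfolding reset_prog_def seq.simps
  proof (intro run_Seq run_NStore, rule run_While[where I = I and \<mu> = "\<lambda>s. 2 * M - nats s vV 0"], goal_cases)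
    case 1
    show ?case by (simp add: I_def) (simp add: unchanged_def)
  next
    case (2 t1 s1)
    have u: "unchanged {WIN, vV} {} s s1" and i: "nats s1 vV 0 < 2 * M" and t1: "t1 \<le> t + 3 + 20 * nats s1 vV 0"
      and z: "\<forall>i<nats s1 vV 0. nats s1 WIN i = 0"
      using 2 unchanged_nats[of "{WIN, vV}" "{}" s s1 vM] vM by (auto simp: I_def)
    have "unchanged {WIN, vV} {} s (set_nat (set_nat s1 WIN (nats s1 vV 0) 0) vV 0 (Suc (nats s1 vV 0)))"
      by (intro unchanged_set_nat u) auto
    then show ?case
      by (intro run_Seq run_NStore) (use i t1 z in \<open>simp add: I_def less_Suc_eq\<close>)
  next
    case (3 t1 s1)
    have u: "unchanged {WIN, vV} {} s s1" and i: "nats s1 vV 0 = 2 * M" and t1: "t1 \<le> t + 3 + 20 * nats s1 vV 0"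
      and z: "\<And>i. i < 2 * M \<Longrightarrow> nats s1 WIN i = 0"
      using 3 unchanged_nats[of "{WIN, vV}" "{}" s s1 vM] vM by (auto simp: I_def)
    define s2 where "s2 = set_nat s1 vNX 0 1"
    have n2: "nats s2 PAR = nats s PAR" "nats s2 vM 0 = M" "reals s2 = reals s"
      using unchanged_nats[OF u] vM u by (auto simp: s2_def unchanged_def fun_eq_iff)
    have ac: "active M s2 = {}" using z by (auto simp: active_def s2_def)
    have "Q (t1 + (1 + btime ?g) + (1 + ntime (NLit 0) + ntime (NLit 1))) s2"
    proof (rule Q[OF _ _ _ _ ac])
      show "t1 + (1 + btime ?g) + (1 + ntime (NLit 0) + ntime (NLit 1)) \<le> t + 40 * M + 40" using t1 i by simp
      have "unchanged {WIN, vV, vNX} {} s s1" by (rule unchanged_trans[OF u unchanged_refl]) auto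
      then show "unchanged {WIN, vV, vNX} {} s s2" unfolding s2_def by (rule unchanged_set_nat) simp
      show "queue M s2"
        using pars z by (simp add: queue_def pq_ok_def pars_ok_def node_ok_def slots_free_def ac n2 better_def)
          (simp add: s2_def)
      show "nats s2 vNX 0 = 1" by (simp add: s2_def)
    qed
    then show ?case by (intro run_NStore) (simp add: s2_def)
  qed
qed

text \<open>The locale is separated from \<open>chain_solver_ok\<close> because the assumptions of
  the latter are stated with the quantities defined here.\<close>

locale chain_solver =
  fixes s0 :: ram_state and M L S :: nat and f :: "nat \<Rightarrow> real \<Rightarrow> real"
  assumes stages: "nats s0 vNS 0 = S"
    and tree: "2 * M \<le> 2 ^ L" "nats s0 vM 0 = M" "pars_ok M s0"
begin

definition job_cell :: "nat \<Rightarrow> nat" where "job_cell j = nats s0 JC j"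
definition job_kinks :: "nat \<Rightarrow> nat" where "job_kinks j = nats s0 0 (nats s0 vKB 0 + job_cell j)"
definition first_job :: "nat \<Rightarrow> nat" where
  "first_job \<sigma> = (case \<sigma> of 0 \<Rightarrow> 0 | Suc \<tau> \<Rightarrow> nats s0 JE \<tau>)"
definition job_cost :: "nat \<Rightarrow> real \<Rightarrow> real" where
  "job_cost j x = f (job_cell j) (clip (reals s0 JA j) (reals s0 JB j) x + reals s0 JO j)"
definition stage_cost :: "nat \<Rightarrow> real \<Rightarrow> real" where
  "stage_cost \<sigma> x = (\<Sum>j\<in>{first_job \<sigma>..<first_job (Suc \<sigma>)}. job_cost j x)"
text \<open>The slots taken by the first \<open>n\<close> jobs: two for each of the
  \<open>k + 1\<close> pieces of a cost with \<open>k\<close> kinks.\<close>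

definition weight :: "nat \<Rightarrow> nat" where "weight n = (\<Sum>j<n. 2 * (job_kinks j + 1))"

end

locale chain_solver_ok = chain_solver +
  assumes first_job_mono: "\<And>\<sigma>. \<sigma> < S \<Longrightarrow> first_job \<sigma> \<le> first_job (Suc \<sigma>)"
    and stored: "\<And>j. j < first_job S \<Longrightarrow>
        stored_cost (reals s0 0) (nats s0 PS (job_cell j)) (job_kinks j) (f (job_cell j))"
    and capacity: "1 + weight (first_job S) + S \<le> M"
    and boxes: "chain_boxes S (reals s0 LO) (reals s0 HI) stage_cost"
begin

abbreviation (input) "NS \<equiv> {WIN, vV, vNX, vW, vP, vE, vD, vJ, vS} :: nat set"
abbreviation (input) "RS \<equiv> {KEY, AL, BE, xK, xA, xB, xK1, xK2, xCA, xCB, xO, xJA, xJB, xLo, xHi, xCur, xSA, xSB,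
  xKap, xM, xU, MM, UU} :: nat set"

lemma first_job_le: "\<tau> \<le> \<sigma> \<Longrightarrow> \<sigma> \<le> S \<Longrightarrow> first_job \<tau> \<le> first_job \<sigma>"
  by (induction \<sigma> rule: dec_induct) (use first_job_mono in \<open>auto intro: order_trans\<close>)

lemma weight_mono: "m \<le> n \<Longrightarrow> weight m \<le> weight n"
  unfolding weight_def by (rule sum_mono2) auto

text \<open>Describes the state after \<open>\<sigma>\<close> complete stages and \<open>j\<close>
  jobs. Elapsed time plus credit is charged to the consumed slots, \<open>1000 * (L + 1)\<close> for
  each. The last conjunct says that the queue holds the stage function under construction, up to a
  constant.\<close>

definition solver_inv :: "nat \<Rightarrow> nat \<Rightarrow> nat \<Rightarrow> nat \<Rightarrow> ram_state \<Rightarrow> bool" where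
  "solver_inv t0 \<sigma> j t s \<longleftrightarrow>
     nats s vS 0 = \<sigma> \<and> nats s vJ 0 = j \<and> queue M s \<and> nats s vNX 0 = 1 + weight j + \<sigma> \<and>
     unchanged NS RS s0 s \<and> reals s UU = reals s0 UU \<and>
     potential L M t s \<le> t0 + 1000 * (L + 1) * (weight j + \<sigma>) \<and>
     (\<forall>\<tau><\<sigma>. argmin_on (reals s0 LO \<tau>) (reals s0 HI \<tau>) (stage_fun stage_cost (reals s MM) \<tau>) (reals s MM \<tau>)) \<and>
     (\<exists>C. \<forall>x. pq_value M s x =
        value_fun stage_cost (reals s MM) \<sigma> x + (\<Sum>i\<in>{first_job \<sigma>..<j}. job_cost i x) + C)"

text \<open>\<open>t1\<close> may exceed the time \<open>t\<close> of the invariant by the loop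
  tests in between. A job is budgeted with \<open>2000 * (L + 1) * (k + 1)\<close>, and inserting
  its cost takes at most \<open>1200 * (L + 1) * (k + 1)\<close>, so this overhead fits in.\<close>

lemma run_job:
  assumes inv: "solver_inv t0 \<sigma> j t s" and \<sigma>: "\<sigma> < S" and j: "first_job \<sigma> \<le> j" "j < first_job (Suc \<sigma>)"
    and t1: "t1 \<le> t + 40"
  shows "run job_prog s t1 (solver_inv t0 \<sigma> (Suc j))"
proof -
  obtain C where vS: "nats s vS 0 = \<sigma>" and vJ: "nats s vJ 0 = j" and q: "queue M s"
    and nx: "nats s vNX 0 = 1 + weight j + \<sigma>" and un: "unchanged NS RS s0 s" and uu: "reals s UU = reals s0 UU"
    and pot: "potential L M t s \<le> t0 + 1000 * (L + 1) * (weight j + \<sigma>)"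
    and am: "\<forall>\<tau><\<sigma>. argmin_on (reals s0 LO \<tau>) (reals s0 HI \<tau>) (stage_fun stage_cost (reals s MM) \<tau>) (reals s MM \<tau>)"
    and val: "\<And>x. pq_value M s x =
        value_fun stage_cost (reals s MM) \<sigma> x + (\<Sum>i\<in>{first_job \<sigma>..<j}. job_cost i x) + C"
    using inv unfolding solver_inv_def by auto
  note un_n = unchanged_nats[OF un] and un_r = unchanged_reals[OF un]
  have jS: "j < first_job S" using j(2) first_job_le[of "Suc \<sigma>" S] \<sigma> by simp
  define k where "k = job_kinks j"
  define p where "p = nats s0 PS (job_cell j)"
  define s1 where "s1 = set_real (set_real (set_real (set_nat (set_nat s vP 0 p) vE 0 (p + k))
     xO 0 (reals s0 JO j)) xJA 0 (reals s0 JA j)) xJB 0 (reals s0 JB j)"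
  have un1: "unchanged {vP, vE} {xO, xJA, xJB} s s1"
    unfolding s1_def by (intro unchanged_set_nat unchanged_set_real) auto
  have q1: "queue M s1" by (rule queue_unchanged[OF un1 q]) auto
  have v1: "pq_value M s1 = pq_value M s" "active M s1 = active M s"
    by (rule pq_value_unchanged[OF un1]; simp)+
  have w: "weight (Suc j) = weight j + 2 * (k + 1)" by (simp add: weight_def k_def)
  have fin: "run insert_cost_prog s1 t2 (\<lambda>t' s'. run (nassign vJ (NAdd (nvar vJ) (NLit 1))) s' t' (solver_inv t0 \<sigma> (Suc j)))"
    if t2: "t2 \<le> t1 + 40" for t2
  proof (rule run_insert_cost[OF q1 tree(1), where k = k and f = "f (job_cell j)"])
    show "stored_cost (reals s1 0) (nats s1 vP 0) k (f (job_cell j))"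
      using stored[OF jS] un_r by (simp add: s1_def p_def k_def)
    show "nats s1 vE 0 = nats s1 vP 0 + k" by (simp add: s1_def)
    show "nats s1 vNX 0 + 2 * (k + 1) \<le> M"
      using capacity weight_mono[of "Suc j" "first_job S"] jS \<sigma> nx w by (simp add: s1_def)
    fix t3 s3 C'
    assume pot3: "potential L M t3 s3 \<le> potential L M t2 s1 + 1200 * (L + 1) * (k + 1)"
      and un3: "unchanged {WIN, vV, vNX, vP, vD} {KEY, AL, BE, xK, xA, xB, xK1, xK2, xCA, xCB} s1 s3"
      and q3: "queue M s3" and nx3: "nats s3 vNX 0 = nats s1 vNX 0 + 2 * (k + 1)"
      and v3: "\<And>x. pq_value M s3 x = pq_value M s1 x +
           f (job_cell j) (clip (reals s1 xJA 0) (reals s1 xJB 0) x + reals s1 xO 0) + C'"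
    define s4 where "s4 = set_nat s3 vJ 0 (Suc j)"
    have un4: "unchanged {vJ} {} s3 s4" unfolding s4_def by (intro unchanged_set_nat) auto
    have "unchanged NS RS s0 s1" by (rule unchanged_trans[OF un un1]) auto
    from unchanged_trans[OF this un3, where C = NS and D = RS]
    have "unchanged NS RS s0 s3" by blast
    then have un04: "unchanged NS RS s0 s4" by (rule unchanged_trans[OF _ un4]) auto
    have v4: "pq_value M s4 = pq_value M s3" "active M s4 = active M s3"
      by (rule pq_value_unchanged[OF un4]; simp)+
    have q4: "queue M s4" by (rule queue_unchanged[OF un4 q3]) auto
    have n4: "nats s4 vS 0 = \<sigma>" "nats s4 vJ 0 = Suc j" "nats s4 vNX 0 = 1 + weight (Suc j) + \<sigma>"
      using unchanged_nats[OF un3] nx3 nx vS by (simp_all add: s4_def s1_def w)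
    have r4: "reals s4 MM = reals s MM" "reals s4 UU = reals s UU"
      using unchanged_reals[OF un3] by (simp_all add: s4_def s1_def)
    have re1: "reals s1 xJA 0 = reals s0 JA j" "reals s1 xJB 0 = reals s0 JB j" "reals s1 xO 0 = reals s0 JO j"
      by (simp_all add: s1_def)
    have val4: "pq_value M s4 x = value_fun stage_cost (reals s4 MM) \<sigma> x +
        (\<Sum>i\<in>{first_job \<sigma>..<Suc j}. job_cost i x) + (C + C')" for x
      using v3[of x] val[of x] j(1) by (simp add: v4 v1 r4 re1 job_cost_def)
    have pot4: "potential L M t4 s4 \<le> t0 + 1000 * (L + 1) * (weight (Suc j) + \<sigma>)" if "t4 \<le> t3 + 10" for t4
      using pot3 pot that t2 t1 unfolding w by (simp add: potential_def v4 v1 algebra_simps)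
    have "solver_inv t0 \<sigma> (Suc j) t4 s4" if "t4 \<le> t3 + 10" for t4
      unfolding solver_inv_def using n4 q4 un04 r4 uu pot4[OF that] am val4 by auto
    moreover have "nats s3 vJ 0 = j" using unchanged_nats[OF un3] vJ by (simp add: s1_def)
    ultimately show "run (nassign vJ (NAdd (nvar vJ) (NLit 1))) s3 t3 (solver_inv t0 \<sigma> (Suc j))"
      by (intro run_NStore) (simp add: s4_def)
  qed
  show ?thesis
    unfolding job_prog_def seq.simps
    by (intro run_Seq run_RStore run_NStore, rule run_state[OF _ fin])
      (simp_all add: s1_def vJ un_n un_r p_def k_def job_cell_def[symmetric] job_kinks_def)
qed

lemma run_jobs:
  assumes inv: "solver_inv t0 \<sigma> (first_job \<sigma>) t s" and \<sigma>: "\<sigma> < S" and t1: "t1 \<le> t + 20"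
    and Q: "\<And>t' t'' s'. solver_inv t0 \<sigma> (first_job (Suc \<sigma>)) t' s' \<Longrightarrow> t'' \<le> t' + 40 \<Longrightarrow> Q t'' s'"
  shows "run (While (NLess (nvar vJ) (NLoad JE (nvar vS))) job_prog) s t1 Q"
proof (rule run_While[where \<mu> = "\<lambda>s'. first_job (Suc \<sigma>) - nats s' vJ 0" and
      I = "\<lambda>t' s'. \<exists>j t''. first_job \<sigma> \<le> j \<and> j \<le> first_job (Suc \<sigma>) \<and> solver_inv t0 \<sigma> j t'' s' \<and> t' \<le> t'' + 20"],
    goal_cases)
  case 1
  show ?case using inv first_job_mono[OF \<sigma>] t1 by blast
next
  case (2 t2 s2)
  then obtain j t3 where j: "first_job \<sigma> \<le> j" "j \<le> first_job (Suc \<sigma>)" and i: "solver_inv t0 \<sigma> j t3 s2"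
    and t: "t2 \<le> t3 + 20" by auto
  have vJ: "nats s2 vJ 0 = j" using i by (simp add: solver_inv_def)
  have "nats s2 JE \<sigma> = first_job (Suc \<sigma>)"
    using i unchanged_nats[of NS RS s0 s2 JE] by (simp add: solver_inv_def first_job_def)
  then have "j < first_job (Suc \<sigma>)" using 2(2) i by (simp add: solver_inv_def)
  show ?case
    by (rule run_mono[OF run_job[OF i \<sigma> j(1) \<open>j < first_job (Suc \<sigma>)\<close>]])
      (use t \<open>j < first_job (Suc \<sigma>)\<close> j(1) vJ in \<open>auto simp: solver_inv_def intro: exI[of _ "Suc j"]\<close>)
next
  case (3 t2 s2)
  then obtain j t3 where j: "first_job \<sigma> \<le> j" "j \<le> first_job (Suc \<sigma>)" and i: "solver_inv t0 \<sigma> j t3 s2"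
    and t: "t2 \<le> t3 + 20" by auto
  have "nats s2 JE \<sigma> = first_job (Suc \<sigma>)"
    using i unchanged_nats[of NS RS s0 s2 JE] by (simp add: solver_inv_def first_job_def)
  then have "j = first_job (Suc \<sigma>)" using 3(2) i j by (simp add: solver_inv_def)
  then show ?case using Q[of t3 s2] i t by simp
qed

text \<open>Once its jobs are inserted, the queue represents the stage function. This is convex on
  the box of the stage by \<open>stage_fun_convex\<close>, so it can be truncated at its
  minimiser.\<close>

lemma run_stage:
  assumes inv: "solver_inv t0 \<sigma> (first_job \<sigma>) t s" and \<sigma>: "\<sigma> < S" and t1: "t1 \<le> t + 20"
  shows "run stage_prog s t1 (solver_inv t0 (Suc \<sigma>) (first_job (Suc \<sigma>)))"
proof -
  let ?lo = "reals s0 LO \<sigma>" and ?hi = "reals s0 HI \<sigma>" and ?j = "first_job (Suc \<sigma>)"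
  let ?rest = "seq [RStore MM (nvar vS) (rvar xM), nassign vS (NAdd (nvar vS) (NLit 1))]"
  have main: "run trunc_prog (set_real (set_real s1 xLo 0 ?lo) xHi 0 ?hi) t3
      (\<lambda>t' s'. run ?rest s' t' (solver_inv t0 (Suc \<sigma>) ?j))"
    if inv1: "solver_inv t0 \<sigma> ?j t2 s1" and t3: "t3 \<le> t2 + 60" for s1 t2 t3
  proof -
    obtain C where vS: "nats s1 vS 0 = \<sigma>" and vJ: "nats s1 vJ 0 = ?j" and q: "queue M s1"
      and nx: "nats s1 vNX 0 = 1 + weight ?j + \<sigma>" and un: "unchanged NS RS s0 s1"
      and uu: "reals s1 UU = reals s0 UU"
      and pot: "potential L M t2 s1 \<le> t0 + 1000 * (L + 1) * (weight ?j + \<sigma>)"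
      and am: "\<And>\<tau>. \<tau> < \<sigma> \<Longrightarrow> argmin_on (reals s0 LO \<tau>) (reals s0 HI \<tau>)
        (stage_fun stage_cost (reals s1 MM) \<tau>) (reals s1 MM \<tau>)"
      and val0: "\<And>x. pq_value M s1 x =
        value_fun stage_cost (reals s1 MM) \<sigma> x + (\<Sum>i\<in>{first_job \<sigma>..<?j}. job_cost i x) + C"
      using inv1 unfolding solver_inv_def by auto
    have val: "pq_value M s1 x = stage_fun stage_cost (reals s1 MM) \<sigma> x + C" for x
      using val0[of x] by (simp add: stage_fun_def stage_cost_def)
    define s2 where "s2 = set_real (set_real s1 xLo 0 ?lo) xHi 0 ?hi"
    have un2: "unchanged {} {xLo, xHi} s1 s2"
      unfolding s2_def by (intro unchanged_set_nat unchanged_set_real) auto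
    have q2: "queue M s2" by (rule queue_unchanged[OF un2 q]) auto
    have v2: "pq_value M s2 = pq_value M s1" "active M s2 = active M s1"
      by (rule pq_value_unchanged[OF un2]; simp)+
    have lh: "reals s2 xLo 0 = ?lo" "reals s2 xHi 0 = ?hi" by (simp_all add: s2_def)
    have cv: "convex_on {?lo..?hi} (stage_fun stage_cost (reals s1 MM) \<sigma>)"
      by (rule stage_fun_convex[OF boxes \<sigma> am])
    have "run trunc_prog s2 t3 (\<lambda>t' s'. run ?rest s' t' (solver_inv t0 (Suc \<sigma>) ?j))"
    proof (rule run_trunc[OF q2 tree(1)], unfold lh)
      show "nats s2 vNX 0 < M"
        using nx capacity weight_mono[of ?j "first_job S"] first_job_le[of "Suc \<sigma>" S] \<sigma> by (simp add: s2_def)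
      show "?lo \<le> ?hi" using boxes \<sigma> by (simp add: chain_boxes_def)
      show "convex_on {?lo..?hi} (pq_value M s2)"
      proof -
        have "pq_value M s2 = (\<lambda>x. stage_fun stage_cost (reals s1 MM) \<sigma> x + C)"
          by (rule ext) (simp add: v2 val)
        then show ?thesis using convex_on_add[OF cv convex_on_const[THEN iffD2, of "{?lo..?hi}" C]] by simp
      qed
      fix t4 s4
      assume pot4: "potential L M t4 s4 \<le> potential L M t3 s2 + 800 * (L + 1)"
        and un4: "unchanged {WIN, vV, vNX, vW} {KEY, AL, BE, xCur, xSA, xSB, xKap, xM, xK, xA, xB} s2 s4"
        and q4: "queue M s4" and nx4: "nats s4 vNX 0 = nats s2 vNX 0 + 1"
        and am4: "argmin_on ?lo ?hi (pq_value M s2) (reals s4 xM 0)"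
        and v4: "\<And>x. pq_value M s4 x = pq_value M s2 (min x (reals s4 xM 0))"
      define m where "m = reals s4 xM 0"
      define s5 where "s5 = set_nat (set_real s4 MM \<sigma> m) vS 0 (Suc \<sigma>)"
      have un5: "unchanged {vS} {MM} s4 s5"
        unfolding s5_def by (intro unchanged_set_nat unchanged_set_real) auto
      have "unchanged NS RS s0 s2" by (rule unchanged_trans[OF un un2]) auto
      from unchanged_trans[OF this un4, where C = NS and D = RS]
      have "unchanged NS RS s0 s4" by blast
      then have un05: "unchanged NS RS s0 s5" by (rule unchanged_trans[OF _ un5]) auto
      have v5: "pq_value M s5 = pq_value M s4" "active M s5 = active M s4"
        by (rule pq_value_unchanged[OF un5]; simp)+
      have q5: "queue M s5" by (rule queue_unchanged[OF un5 q4]) auto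
      have n5: "nats s5 vS 0 = Suc \<sigma>" "nats s5 vJ 0 = ?j" "nats s5 vNX 0 = 1 + weight ?j + Suc \<sigma>"
        using unchanged_nats[OF un4] nx4 nx vJ by (simp_all add: s5_def s2_def)
      have r5: "reals s5 MM = (reals s1 MM)(\<sigma> := m)" "reals s5 UU = reals s0 UU"
        using unchanged_reals[OF un4] uu by (simp_all add: s5_def s2_def)
      \<comment> \<open>A stage function depends on the minimisers of earlier stages only, so
        storing \<open>m\<close> at index \<open>\<sigma>\<close> leaves those up to
        \<open>\<sigma>\<close> as they were.\<close>
      have sf: "stage_fun stage_cost (reals s5 MM) \<tau> = stage_fun stage_cost (reals s1 MM) \<tau>" if "\<tau> \<le> \<sigma>" for \<tau>
        by (rule ext, rule stage_fun_cong) (use that in \<open>simp add: r5\<close>)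
      have am5: "argmin_on (reals s0 LO \<tau>) (reals s0 HI \<tau>) (stage_fun stage_cost (reals s5 MM) \<tau>) (reals s5 MM \<tau>)"
        if "\<tau> < Suc \<sigma>" for \<tau>
      proof (cases "\<tau> = \<sigma>")
        case True
        then show ?thesis using am4 sf[of \<sigma>] by (simp add: r5 argmin_on_def v2 val m_def)
      next
        case False
        then show ?thesis using am[of \<tau>] sf[of \<tau>] that by (simp add: r5)
      qed
      have val5: "pq_value M s5 x = value_fun stage_cost (reals s5 MM) (Suc \<sigma>) x +
          (\<Sum>i\<in>{first_job (Suc \<sigma>)..<?j}. job_cost i x) + C" for x
        unfolding value_fun_Suc_stage using sf[of \<sigma>] v4[of x] by (simp add: v5 v2 val r5 m_def)
      have pot5: "potential L M t5 s5 \<le> t0 + 1000 * (L + 1) * (weight ?j + Suc \<sigma>)" if "t5 \<le> t4 + 20" for t5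
        using pot4 pot that t3 by (simp add: potential_def v5 v2 algebra_simps)
      have fin: "solver_inv t0 (Suc \<sigma>) ?j t5 s5" if "t5 \<le> t4 + 20" for t5
        unfolding solver_inv_def using n5 q5 un05 r5 pot5[OF that] am5 val5 by auto
      have "nats s4 vS 0 = \<sigma>" using unchanged_nats[OF un4] vS by (simp add: s2_def)
      then show "run ?rest s4 t4 (solver_inv t0 (Suc \<sigma>) ?j)"
        unfolding seq.simps using fin
        by (intro run_Seq run_NStore run_RStore) (simp add: s5_def m_def)
    qed
    then show ?thesis by (simp add: s2_def)
  qed
  show ?thesis
    unfolding stage_prog_def seq.simps
  proof (rule run_Seq, rule run_jobs[OF inv \<sigma> t1], intro run_Seq run_RStore)
    fix t2 t3 s1 assume i: "solver_inv t0 \<sigma> ?j t2 s1" and t: "t3 \<le> t2 + 40"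
    have e: "nats s1 vS 0 = \<sigma>" "reals s1 LO = reals s0 LO" "reals s1 HI = reals s0 HI"
      using i unchanged_reals[of NS RS s0 s1] by (simp_all add: solver_inv_def)
    show "run trunc_prog (set_real (set_real s1 xLo (nval (NLit 0) s1) (rval (RLoad LO (nvar vS)) s1)) xHi
         (nval (NLit 0) (set_real s1 xLo (nval (NLit 0) s1) (rval (RLoad LO (nvar vS)) s1)))
         (rval (RLoad HI (nvar vS)) (set_real s1 xLo (nval (NLit 0) s1) (rval (RLoad LO (nvar vS)) s1))))
       (t3 + (1 + ntime (NLit 0) + rtime (RLoad LO (nvar vS))) + (1 + ntime (NLit 0) + rtime (RLoad HI (nvar vS))))
       (\<lambda>t' s'. run (Seq (RStore MM (nvar vS) (rvar xM)) (nassign vS (NAdd (nvar vS) (NLit 1)))) s' t'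
          (solver_inv t0 (Suc \<sigma>) ?j))"
      by (rule run_state[OF _ main[OF i, unfolded seq.simps]]) (use t in \<open>simp_all add: e\<close>)
  qed
qed

lemma run_backtrack:
  assumes vS: "nats s vS 0 = S" and u: "S = 0 \<or> reals s MM (S - 1) \<le> reals s xU 0"
    and Q: "\<And>t' s'. t' \<le> t + 50 * S + 50 \<Longrightarrow> unchanged {vS} {xU, UU} s s' \<Longrightarrow>
       (\<And>\<sigma>. Suc \<sigma> = S \<Longrightarrow> reals s' UU \<sigma> = reals s MM \<sigma>) \<Longrightarrow>
       (\<And>\<sigma>. Suc \<sigma> < S \<Longrightarrow> reals s' UU \<sigma> = min (reals s MM \<sigma>) (reals s' UU (Suc \<sigma>))) \<Longrightarrow>
       (\<And>\<sigma>. S \<le> \<sigma> \<Longrightarrow> reals s' UU \<sigma> = reals s UU \<sigma>) \<Longrightarrow> Q t' s'"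
  shows "run backtrack_prog s t Q"
proof -
  define I where "I t' s' \<longleftrightarrow> (\<exists>\<sigma>\<le>S. nats s' vS 0 = \<sigma> \<and> unchanged {vS} {xU, UU} s s' \<and>
      t' + 50 * \<sigma> \<le> t + 50 * S \<and>
      (if \<sigma> = S then reals s' xU 0 = reals s xU 0 else reals s' xU 0 = reals s' UU \<sigma>) \<and>
      (\<forall>\<tau>\<ge>\<sigma>. Suc \<tau> = S \<longrightarrow> reals s' UU \<tau> = reals s MM \<tau>) \<and>
      (\<forall>\<tau>\<ge>\<sigma>. Suc \<tau> < S \<longrightarrow> reals s' UU \<tau> = min (reals s MM \<tau>) (reals s' UU (Suc \<tau>))) \<and>
      (\<forall>\<tau>\<ge>S. reals s' UU \<tau> = reals s UU \<tau>))" for t' s'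
  show ?thesis
    unfolding backtrack_prog_def
  proof (rule run_While[where I = I and \<mu> = "\<lambda>s. nats s vS 0"], goal_cases)
    case 1
    show ?case using vS by (simp add: I_def)
  next
    case (2 t1 s1)
    obtain \<sigma> where n: "nats s1 vS 0 = Suc \<sigma>" and un: "unchanged {vS} {xU, UU} s s1" and sS: "\<sigma> < S"
      and t1: "t1 + 50 * Suc \<sigma> \<le> t + 50 * S"
      and xu: "if Suc \<sigma> = S then reals s1 xU 0 = reals s xU 0 else reals s1 xU 0 = reals s1 UU (Suc \<sigma>)"
      and a1: "\<And>\<tau>. \<tau> \<ge> Suc \<sigma> \<Longrightarrow> Suc \<tau> = S \<Longrightarrow> reals s1 UU \<tau> = reals s MM \<tau>"
      and a2: "\<And>\<tau>. \<tau> \<ge> Suc \<sigma> \<Longrightarrow> Suc \<tau> < S \<Longrightarrow> reals s1 UU \<tau> = min (reals s MM \<tau>) (reals s1 UU (Suc \<tau>))"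
      and a3: "\<And>\<tau>. \<tau> \<ge> S \<Longrightarrow> reals s1 UU \<tau> = reals s UU \<tau>"
    proof -
      obtain \<sigma>' where "\<sigma>' \<le> S" "nats s1 vS 0 = \<sigma>'" "0 < \<sigma>'" using 2 by (auto simp: I_def)
      then obtain \<sigma> where "\<sigma>' = Suc \<sigma>" by (cases \<sigma>') auto
      with 2(1) \<open>nats s1 vS 0 = \<sigma>'\<close> that[of \<sigma>] show ?thesis by (auto simp: I_def)
    qed
    have mm: "reals s1 MM = reals s MM" using unchanged_reals[OF un] by simp
    define x where "x = min (reals s MM \<sigma>) (reals s1 xU 0)"
    define s2 where "s2 = set_real (set_real (set_nat s1 vS 0 \<sigma>) xU 0 x) UU \<sigma> x"
    have un2: "unchanged {vS} {xU, UU} s s2"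
      unfolding s2_def by (intro unchanged_set_nat unchanged_set_real un) auto
    have fin: "I t2 s2 \<and> nats s2 vS 0 < nats s1 vS 0" if "t2 \<le> t1 + 50" for t2
    proof -
      have "reals s2 UU \<tau> = reals s MM \<tau>" if "\<sigma> \<le> \<tau>" "Suc \<tau> = S" for \<tau>
      proof (cases "\<tau> = \<sigma>")
        case True then show ?thesis using that xu u by (auto simp: s2_def x_def)
      next
        case False then show ?thesis using that a1[of \<tau>] by (simp add: s2_def)
      qed
      moreover have "reals s2 UU \<tau> = min (reals s MM \<tau>) (reals s2 UU (Suc \<tau>))" if "\<sigma> \<le> \<tau>" "Suc \<tau> < S" for \<tau>
      proof (cases "\<tau> = \<sigma>")
        case True then show ?thesis using that xu by (auto simp: s2_def x_def)
      next
        case False then show ?thesis using that a2[of \<tau>] by (simp add: s2_def)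
      qed
      moreover have "reals s2 UU \<tau> = reals s UU \<tau>" if "\<tau> \<ge> S" for \<tau>
        using that a3[of \<tau>] sS by (simp add: s2_def)
      ultimately show ?thesis
        unfolding I_def using sS un2 t1 that n
        by (intro conjI exI[of _ \<sigma>]) (auto simp: s2_def)
    qed
    have fin': "I t2 s2' \<and> nats s2' vS 0 < nats s1 vS 0" if "s2' = s2" "t2 \<le> t1 + 50" for t2 s2'
      using fin that by simp
    show ?case
      unfolding seq.simps
      apply (rule run_Seq, rule run_NStore, rule run_Seq, rule run_Cond)
       apply (rule run_RStore, rule run_RStore, rule fin')
        apply (simp add: s2_def n mm x_def min_def set_real_def set_nat_def)
       apply simp
      apply (rule run_Skip, rule run_RStore, rule fin')
       apply (use unchanged_reals[OF un] in \<open>auto simp: s2_def n mm x_def min_def set_real_def set_nat_def fun_eq_iff intro!: ram_state.equality\<close>)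
      done
  next
    case (3 t1 s1)
    then show ?case by (intro Q) (auto simp: I_def)
  qed
qed

text \<open>By \<open>capacity\<close> at most \<open>M\<close> slots are charged with
  \<open>1000 * (L + 1)\<close> each. Reset, backtracking and overhead are linear in
  \<open>M\<close> and fit into the other half of the bound.\<close>

lemma run_solve:
  assumes Q: "\<And>t' s'. t' \<le> t + 2000 * (L + 1) * M \<Longrightarrow> unchanged NS RS s0 s' \<Longrightarrow>
      chain_optimal S (reals s0 LO) (reals s0 HI) stage_cost (reals s' UU) \<Longrightarrow>
      (\<And>\<sigma>. S \<le> \<sigma> \<Longrightarrow> reals s' UU \<sigma> = reals s0 UU \<sigma>) \<Longrightarrow> Q t' s'"
  shows "run solve_prog s0 t Q"
  unfolding solve_prog_def seq.simps
proof (rule run_Seq, rule run_reset[OF tree(3,2)], intro run_Seq run_NStore)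
  fix t1 s1
  assume t1: "t1 \<le> t + 40 * M + 40" and un1: "unchanged {WIN, vV, vNX} {} s0 s1" and q1: "queue M s1"
    and nx1: "nats s1 vNX 0 = 1" and ac1: "active M s1 = {}"
  define s2 where "s2 = set_nat (set_nat s1 vS 0 0) vJ 0 0"
  define T where "T = t + 40 * M + 60"
  have un2: "unchanged {vS, vJ} {} s1 s2"
    unfolding s2_def by (intro unchanged_set_nat unchanged_set_real) auto
  have v2: "active M s2 = {}" using pq_value_unchanged(2)[OF un2] ac1 by simp
  have un02: "unchanged NS RS s0 s2" by (rule unchanged_trans[OF un1 un2]) auto
  have q2: "queue M s2" by (rule queue_unchanged[OF un2 q1]) auto
  have init: "solver_inv T 0 (first_job 0) t2 s2" if "t2 \<le> T" for t2
    unfolding solver_inv_def using q2 un02 nx1 that unchanged_reals[OF un1, of UU]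
    by (auto simp: s2_def potential_def v2[unfolded s2_def] first_job_def weight_def pq_value_def)
  have loop: "run (While (NLess (nvar vS) (nvar vNS)) stage_prog) s2 t2
      (\<lambda>t' s'. run (Seq (rassign xU (RLoad HI (NSub (nvar vNS) (NLit 1)))) backtrack_prog) s' t' Q)"
    if t2: "t2 \<le> T" for t2
  proof (rule run_While[where \<mu> = "\<lambda>s'. S - nats s' vS 0" and
        I = "\<lambda>t' s'. \<exists>\<sigma>\<le>S. solver_inv T \<sigma> (first_job \<sigma>) t' s'"], goal_cases)
    case 1
    show ?case using init[OF t2] by blast
  next
    case (2 t3 s3)
    then obtain \<sigma> where i: "\<sigma> \<le> S" "solver_inv T \<sigma> (first_job \<sigma>) t3 s3" by auto
    have "nats s3 vNS 0 = S" using i unchanged_nats[of NS RS s0 s3 vNS] stages by (simp add: solver_inv_def)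
    then have \<sigma>: "\<sigma> < S" "nats s3 vS 0 = \<sigma>" using 2(2) i by (simp_all add: solver_inv_def)
    show ?case
    proof (rule run_mono[OF run_stage[OF i(2) \<sigma>(1)]])
      fix t4 s4 assume j: "solver_inv T (Suc \<sigma>) (first_job (Suc \<sigma>)) t4 s4"
      then have "nats s4 vS 0 = Suc \<sigma>" by (simp add: solver_inv_def)
      then show "(\<exists>\<sigma>\<le>S. solver_inv T \<sigma> (first_job \<sigma>) t4 s4) \<and> S - nats s4 vS 0 < S - nats s3 vS 0"
        using j \<sigma> by (auto intro!: exI[of _ "Suc \<sigma>"])
    qed simp
  next
    case (3 t3 s3)
    then obtain \<sigma> where i: "\<sigma> \<le> S" "solver_inv T \<sigma> (first_job \<sigma>) t3 s3" by auto
    have vNS: "nats s3 vNS 0 = S" using i unchanged_nats[of NS RS s0 s3 vNS] stages by (simp add: solver_inv_def)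
    then have \<sigma>: "\<sigma> = S" using 3(2) i by (simp add: solver_inv_def)
    have un3: "unchanged NS RS s0 s3" and uu: "reals s3 UU = reals s0 UU" and vS: "nats s3 vS 0 = S"
      and pot: "potential L M t3 s3 \<le> T + 1000 * (L + 1) * (weight (first_job S) + S)"
      and am: "\<And>\<tau>. \<tau> < S \<Longrightarrow> argmin_on (reals s0 LO \<tau>) (reals s0 HI \<tau>)
         (stage_fun stage_cost (reals s3 MM) \<tau>) (reals s3 MM \<tau>)"
      using i(2) \<sigma> by (auto simp: solver_inv_def)
    have t3: "t3 + 1000 * (L + 1) \<le> T + 1000 * (L + 1) * M"
    proof -
      have "1000 * (L + 1) * (weight (first_job S) + S + 1) \<le> 1000 * (L + 1) * M"
        using capacity by (intro mult_left_mono) auto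
      then show ?thesis using pot by (simp add: potential_def)
    qed
    define s4 where "s4 = set_real s3 xU 0 (reals s0 HI (S - 1))"
    have un4: "unchanged {} {xU} s3 s4"
      unfolding s4_def by (intro unchanged_set_nat unchanged_set_real) auto
    have hi3: "reals s3 HI = reals s0 HI" using unchanged_reals[OF un3] by simp
    have "run backtrack_prog s4 t4 Q" if t4: "t4 \<le> t3 + 30" for t4
    proof (rule run_backtrack)
      show "nats s4 vS 0 = S" using vS by (simp add: s4_def)
      show "S = 0 \<or> reals s4 MM (S - 1) \<le> reals s4 xU 0"
        using am[of "S - 1"] by (cases "S = 0") (auto simp: s4_def argmin_on_def)
      fix t5 s5
      assume t5: "t5 \<le> t4 + 50 * S + 50" and un5: "unchanged {vS} {xU, UU} s4 s5"
        and u1: "\<And>\<sigma>. Suc \<sigma> = S \<Longrightarrow> reals s5 UU \<sigma> = reals s4 MM \<sigma>"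
        and u2: "\<And>\<sigma>. Suc \<sigma> < S \<Longrightarrow> reals s5 UU \<sigma> = min (reals s4 MM \<sigma>) (reals s5 UU (Suc \<sigma>))"
        and u3: "\<And>\<sigma>. S \<le> \<sigma> \<Longrightarrow> reals s5 UU \<sigma> = reals s4 UU \<sigma>"
      have un04: "unchanged NS RS s0 s4" by (rule unchanged_trans[OF un3 un4]) auto
      show "Q t5 s5"
      proof (rule Q)
        have "S \<le> M" "1 \<le> M" using capacity by auto
        then show "t5 \<le> t + 2000 * (L + 1) * M"
          using t5 t4 t3 by (simp add: T_def algebra_simps)
        show "unchanged NS RS s0 s5" by (rule unchanged_trans[OF un04 un5]) auto
        show "chain_optimal S (reals s0 LO) (reals s0 HI) stage_cost (reals s5 UU)"
          by (rule backtrack_optimal[OF boxes am]) (use u1 u2 in \<open>auto simp: s4_def\<close>)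
        show "reals s5 UU \<sigma> = reals s0 UU \<sigma>" if "S \<le> \<sigma>" for \<sigma>
          using u3[OF that] uu by (simp add: s4_def)
      qed
    qed
    then show ?case
      by (intro run_Seq run_RStore) (simp add: s4_def vNS hi3)
  qed
  show "run (While (NLess (nvar vS) (nvar vNS)) stage_prog)
     (set_nat (set_nat s1 vS (nval (NLit 0) s1) (nval (NLit 0) s1)) vJ
        (nval (NLit 0) (set_nat s1 vS (nval (NLit 0) s1) (nval (NLit 0) s1)))
        (nval (NLit 0) (set_nat s1 vS (nval (NLit 0) s1) (nval (NLit 0) s1))))
     (t1 + (1 + ntime (NLit 0) + ntime (NLit 0)) + (1 + ntime (NLit 0) + ntime (NLit 0)))
      (\<lambda>t' s'. run (Seq (rassign xU (RLoad HI (NSub (nvar vNS) (NLit 1)))) backtrack_prog) s' t' Q)"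
    by (rule run_state[OF _ loop]) (use t1 in \<open>simp_all add: s2_def T_def\<close>)
qed

end

section \<open>The reduction to two chains\<close>

text \<open>A constant per element changes all feasible costs by the same amount. This justifies
  that the queue forgets constants.\<close>

lemma chain_optimal_cong:
  assumes "\<And>s x. s < S \<Longrightarrow> lo s \<le> x \<Longrightarrow> x \<le> hi s \<Longrightarrow> F s x = G s x + C s"
    and "chain_optimal S lo hi F u"
  shows "chain_optimal S lo hi G u"
proof -
  have "(\<Sum>s<S. F s (w s)) = (\<Sum>s<S. G s (w s)) + (\<Sum>s<S. C s)" if "chain_feasible S lo hi w" for w
    unfolding sum.distrib[symmetric]
    by (rule sum.cong) (use assms(1) that in \<open>auto simp: chain_feasible_def\<close>)
  then show ?thesis using assms(2) by (auto simp: chain_optimal_def)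
qed

lemma convex_on_eq:
  fixes g h :: "real \<Rightarrow> real"
  assumes "convex_on {a..b} g" "\<And>x. x \<in> {a..b} \<Longrightarrow> g x = h x"
  shows "convex_on {a..b} h"
proof (rule convex_onI)
  fix t x y :: real assume a: "0 < t" "t < 1" "x \<in> {a..b}" "y \<in> {a..b}"
  then have "(1 - t) * x + t * y \<in> {a..b}" using convexD_alt[of "{a..b}" x y t] by simp
  then show "h ((1 - t) *\<^sub>R x + t *\<^sub>R y) \<le> (1 - t) * h x + t * h y"
    using convex_onD[OF assms(1), of t x y] a assms(2) by simp
qed simp

text \<open>Without the widths of the predecessors, the distance constraints become monotonicity,
  which spreads the bounds of the first and the last cell over the whole row.\<close>

lemma row_feasible_iff_shifted:
  fixes w p :: "nat \<Rightarrow> real"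
  defines "q \<equiv> \<lambda>j. p j - (\<Sum>t\<in>{1..<j}. w t)"
  assumes "1 \<le> n"
  shows "row_feasible l r n w p \<longleftrightarrow>
    (\<forall>j\<in>{1..n}. l \<le> q j \<and> q j \<le> r - (\<Sum>t\<in>{1..n}. w t)) \<and> (\<forall>j. 1 \<le> j \<and> j < n \<longrightarrow> q j \<le> q (Suc j))"
proof -
  have S: "(\<Sum>t\<in>{1..<Suc j}. w t) = (\<Sum>t\<in>{1..<j}. w t) + w j" if "1 \<le> j" for j
    using that by (simp add: sum.atLeastLessThan_Suc)
  have step: "p j + w j \<le> p (j + 1) \<longleftrightarrow> q j \<le> q (Suc j)" if "1 \<le> j" for j
    using S[OF that] by (auto simp: q_def)
  have one: "p 1 = q 1" by (simp add: q_def)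
  have tot: "(\<Sum>t\<in>{1..n}. w t) = (\<Sum>t\<in>{1..<n}. w t) + w n"
    using S[OF assms(2)] by (simp add: atLeastLessThanSuc_atLeastAtMost)
  have last: "p n + w n \<le> r \<longleftrightarrow> q n \<le> r - (\<Sum>t\<in>{1..n}. w t)"
    unfolding tot by (auto simp: q_def)
  have mono: "q i \<le> q j" if "\<forall>j. 1 \<le> j \<and> j < n \<longrightarrow> q j \<le> q (Suc j)" "1 \<le> i" "i \<le> j" "j \<le> n" for i j
    using that(3,4)
  proof (induction j rule: dec_induct)
    case (step m)
    then have "q i \<le> q m" "q m \<le> q (Suc m)" using that(1,2) by simp_all
    then show ?case by simp
  qed simp
  show ?thesis
  proof
    assume "row_feasible l r n w p"
    then have a: "l \<le> q 1" "\<forall>j. 1 \<le> j \<and> j < n \<longrightarrow> q j \<le> q (Suc j)" "q n \<le> r - (\<Sum>t\<in>{1..n}. w t)"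
      using assms(2) last one step by (auto simp: row_feasible_def)
    then show "(\<forall>j\<in>{1..n}. l \<le> q j \<and> q j \<le> r - (\<Sum>t\<in>{1..n}. w t)) \<and> (\<forall>j. 1 \<le> j \<and> j < n \<longrightarrow> q j \<le> q (Suc j))"
      using mono[OF a(2), of 1] mono[OF a(2), of _ n] by fastforce
  next
    assume "(\<forall>j\<in>{1..n}. l \<le> q j \<and> q j \<le> r - (\<Sum>t\<in>{1..n}. w t)) \<and> (\<forall>j. 1 \<le> j \<and> j < n \<longrightarrow> q j \<le> q (Suc j))"
    then show "row_feasible l r n w p"
      using assms(2) last one step by (auto simp: row_feasible_def)
  qed
qed

lemma sum_grouped:
  fixes g :: "nat \<Rightarrow> real"
  assumes "\<And>i. b i \<le> b (Suc i)"
  shows "(\<Sum>c\<in>{b 0..<b m}. g c) = (\<Sum>i<m. \<Sum>c\<in>{b i..<b (Suc i)}. g c)"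
proof (induction m)
  case (Suc m)
  have "b 0 \<le> b m" using assms by (rule lift_Suc_mono_le) simp
  then show ?case using Suc assms[of m] sum.atLeastLessThan_concat[of "b 0" "b m" "b (Suc m)" g] by simp
qed simp

text \<open>All cells are numbered consecutively: first the \<open>k\<close> double-row cells, then the \<open>2 * k + 2\<close> single
  rows one after the other. Row \<open>\<rho>\<close> lies between the double-row cells \<open>col \<rho>\<close> and \<open>col \<rho> + 1\<close>.\<close>

locale flat_instance =
  fixes k :: nat and num :: "nat \<Rightarrow> nat" and W :: "nat \<Rightarrow> real" and L R :: real
    and f :: "nat \<Rightarrow> real \<Rightarrow> real"
begin

definition row_start :: "nat \<Rightarrow> nat" where "row_start \<rho> = k + (\<Sum>\<tau><\<rho>. num \<tau>)"
definition cells :: nat where "cells = row_start (2 * k + 2)"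
text \<open>Rows \<open>0\<close> to \<open>k\<close> are bottom rows, rows \<open>k + 1\<close> to
  \<open>2 * k + 1\<close> are top rows.\<close>

definition col :: "nat \<Rightarrow> nat" where "col \<rho> = (if \<rho> \<le> k then \<rho> else \<rho> - (k + 1))"
definition row :: "nat \<Rightarrow> nat" where "row c = (LEAST \<rho>. c < row_start (Suc \<rho>))"
definition row_width :: "nat \<Rightarrow> real" where
  "row_width \<rho> = (\<Sum>d\<in>{row_start \<rho>..<row_start (Suc \<rho>)}. W d)"
definition shift :: "nat \<Rightarrow> real" where "shift \<rho> = real \<rho> * (R - L)"

text \<open>A single-row cell is described by its position minus the widths of its predecessors in the row;
  \<open>shift\<close> moves the rows to disjoint intervals, so that they form a single chain.\<close>

definition offset :: "nat \<Rightarrow> real" where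
  "offset c = (\<Sum>d\<in>{row_start (row c)..<c}. W d) - shift (row c)"
definition double_width :: "nat \<Rightarrow> real" where "double_width i = (if i = 0 then 0 else W (i - 1))"

text \<open>The least distance of a double-row cell from the left wall, where of the two rows in a
  column the longer one counts. After its subtraction the double-row cells only have to be in order,
  between \<open>L\<close> and \<open>max_shifted\<close>.\<close>

primrec double_offset :: "nat \<Rightarrow> real" where
  "double_offset 0 = 0"
| "double_offset (Suc i) = double_offset i + double_width i + max (row_width i) (row_width (k + 1 + i))"

definition max_shifted :: real where "max_shifted = R - double_offset (Suc k)"
text \<open>If the neighbours of row \<open>\<rho>\<close> have the reduced positions
  \<open>x\<close> and \<open>y\<close>, the reduced positions in the row range from
  \<open>x + left_bound \<rho>\<close> to \<open>y + right_bound \<rho>\<close>.\<close>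

definition left_bound :: "nat \<Rightarrow> real" where
  "left_bound \<rho> = double_offset (col \<rho>) + double_width (col \<rho>) + shift \<rho>"
definition right_bound :: "nat \<Rightarrow> real" where
  "right_bound \<rho> = double_offset (Suc (col \<rho>)) - row_width \<rho> + shift \<rho>"

text \<open>The first \<open>k\<close> elements of the chain are dummies with a one-point box and
  zero cost; they make chain indices and cell numbers coincide.\<close>

definition row_lo :: "nat \<Rightarrow> real" where "row_lo c = (if c < k then L else L + shift (row c))"
definition row_hi :: "nat \<Rightarrow> real" where "row_hi c = (if c < k then L else R + shift (row c))"
definition row_cost :: "nat \<Rightarrow> real \<Rightarrow> real" where
  "row_cost c u = (if c < k then 0 else f c (u + offset c))"

text \<open>The parts of the row cost that depend on the left and on the right neighbour. The third
  term of the clipping identity depends on neither and goes into \<open>fixed_cost\<close>.\<close>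

definition left_cost :: "(nat \<Rightarrow> real) \<Rightarrow> nat \<Rightarrow> real \<Rightarrow> real" where
  "left_cost U \<rho> x = (\<Sum>c\<in>{row_start \<rho>..<row_start (Suc \<rho>)}. f c (max (x + left_bound \<rho>) (U c) + offset c))"
definition right_cost :: "(nat \<Rightarrow> real) \<Rightarrow> nat \<Rightarrow> real \<Rightarrow> real" where
  "right_cost U \<rho> x = (\<Sum>c\<in>{row_start \<rho>..<row_start (Suc \<rho>)}. f c (min (x + right_bound \<rho>) (U c) + offset c))"

text \<open>Stage \<open>s\<close> is the double-row cell with index \<open>s + 1\<close> in the
  instance: it bounds the rows of column \<open>s + 1\<close> from the left and those of column
  \<open>s\<close> from the right.\<close>

definition double_cost :: "(nat \<Rightarrow> real) \<Rightarrow> nat \<Rightarrow> real \<Rightarrow> real" where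
  "double_cost U s x = f s (x + double_offset (Suc s)) +
     left_cost U (Suc s) x + left_cost U (k + 1 + Suc s) x + right_cost U s x + right_cost U (k + 1 + s) x"

text \<open>Reduced positions with both walls included; adding \<open>double_offset\<close> gives
  \<open>double_pos\<close>.\<close>

definition ext :: "(nat \<Rightarrow> real) \<Rightarrow> nat \<Rightarrow> real" where
  "ext v i = (if i = 0 then L else if i = Suc k then max_shifted else v (i - 1))"

definition double_pos :: "(nat \<Rightarrow> real) \<Rightarrow> nat \<Rightarrow> real" where
  "double_pos X i = (if i = 0 then L else if i = Suc k then R else X (i - 1))"

definition flat_feasible :: "(nat \<Rightarrow> real) \<Rightarrow> bool" where
  "flat_feasible X \<longleftrightarrow>
     (\<forall>i\<le>k. double_pos X i + double_width i \<le> double_pos X (i + 1)) \<and>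
     (\<forall>\<rho><2 * k + 2. row_feasible (double_pos X (col \<rho>) + double_width (col \<rho>)) (double_pos X (col \<rho> + 1))
        (num \<rho>) (\<lambda>j. W (row_start \<rho> + j - 1)) (\<lambda>j. X (row_start \<rho> + j - 1)))"

definition assemble :: "(nat \<Rightarrow> real) \<Rightarrow> (nat \<Rightarrow> real) \<Rightarrow> nat \<Rightarrow> real" where
  "assemble v U c = (if c < k then v c + double_offset (Suc c)
     else clip (ext v (col (row c)) + left_bound (row c)) (ext v (Suc (col (row c))) + right_bound (row c)) (U c)
       + offset c)"

lemma row_start_Suc: "row_start (Suc \<rho>) = row_start \<rho> + num \<rho>"
  by (simp add: row_start_def)

lemma row_start_mono: "\<rho> \<le> \<tau> \<Longrightarrow> row_start \<rho> \<le> row_start \<tau>"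
  by (rule lift_Suc_mono_le[of row_start]) (simp_all add: row_start_Suc)

lemma row_start_0 [simp]: "row_start 0 = k"
  by (simp add: row_start_def)

lemma row_eqI:
  assumes "row_start \<rho> \<le> c" "c < row_start (Suc \<rho>)" shows "row c = \<rho>"
  unfolding row_def
proof (rule Least_equality)
  fix \<tau> assume "c < row_start (Suc \<tau>)"
  then show "\<rho> \<le> \<tau>" using row_start_mono[of "Suc \<tau>" \<rho>] assms(1) by (meson leD le_trans not_less_eq_eq)
qed (rule assms(2))

lemma row_bounds:
  assumes "k \<le> c" "c < cells"
  shows "row c < 2 * k + 2" "row_start (row c) \<le> c" "c < row_start (Suc (row c))"
proof -
  have "\<exists>\<rho><2 * k + 2. row_start \<rho> \<le> c \<and> c < row_start (Suc \<rho>)"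
  proof -
    have "c < row_start m \<Longrightarrow> \<exists>\<rho><m. row_start \<rho> \<le> c \<and> c < row_start (Suc \<rho>)" for m
    proof (induction m)
      case (Suc m)
      then show ?case by (cases "c < row_start m") (auto intro: less_SucI)
    qed (use assms(1) in simp)
    then show ?thesis using assms(2) by (simp add: cells_def)
  qed
  then obtain \<rho> where "\<rho> < 2 * k + 2" "row_start \<rho> \<le> c" "c < row_start (Suc \<rho>)" by auto
  then show "row c < 2 * k + 2" "row_start (row c) \<le> c" "c < row_start (Suc (row c))"
    using row_eqI[of \<rho> c] by simp_all
qed

lemma row_start_le_cells: "\<rho> < 2 * k + 2 \<Longrightarrow> row_start (Suc \<rho>) \<le> cells"
  unfolding cells_def by (rule row_start_mono) simp

lemma k_le_row_start: "k \<le> row_start \<rho>"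
  by (simp add: row_start_def)

lemma k_le_cells: "k \<le> cells"
  by (simp add: cells_def k_le_row_start)

lemma row_mono: assumes "k \<le> c" "c \<le> d" "d < cells" shows "row c \<le> row d"
proof (rule ccontr)
  assume "\<not> row c \<le> row d"
  then have "row_start (Suc (row d)) \<le> row_start (row c)" by (intro row_start_mono) simp
  then show False using row_bounds[of c] row_bounds[of d] assms by simp
qed

lemma col_le: "\<rho> < 2 * k + 2 \<Longrightarrow> col \<rho> \<le> k"
  by (auto simp: col_def)

lemma sum_rows: "(\<Sum>c\<in>{k..<cells}. g c) = (\<Sum>\<rho><2 * k + 2. \<Sum>c\<in>{row_start \<rho>..<row_start (Suc \<rho>)}. (g c :: real))"
  using sum_grouped[of row_start g "2 * k + 2"] by (simp add: row_start_Suc cells_def)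

lemma sum_lessThan_split: "k \<le> m \<Longrightarrow> (\<Sum>c<m. g c) = (\<Sum>c<k. g c) + (\<Sum>c\<in>{k..<m}. (g c :: real))"
  using sum.atLeastLessThan_concat[of 0 k m g] by (simp add: atLeast0LessThan)

lemma sum_rows_all:
  "(\<Sum>c<cells. if c < k then 0 else g (row c) c) =
     (\<Sum>\<rho><2 * k + 2. \<Sum>c\<in>{row_start \<rho>..<row_start (Suc \<rho>)}. (g \<rho> c :: real))"
proof -
  have "(\<Sum>c<cells. if c < k then 0 else g (row c) c) = (\<Sum>c\<in>{k..<cells}. g (row c) c)"
    by (subst sum_lessThan_split[OF k_le_cells]) simp
  also have "\<dots> = (\<Sum>\<rho><2 * k + 2. \<Sum>c\<in>{row_start \<rho>..<row_start (Suc \<rho>)}. g \<rho> c)"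
    unfolding sum_rows by (intro sum.cong) (auto simp: row_eqI)
  finally show ?thesis .
qed

lemma sum_two_rows: "(\<Sum>\<rho><2 * k + 2. g \<rho>) = (\<Sum>i<Suc k. (g i :: real) + g (k + 1 + i))"
proof -
  have "(\<Sum>\<rho><2 * k + 2. g \<rho>) = (\<Sum>\<rho><Suc k + Suc k. g \<rho>)" by (rule arg_cong[where f = "\<lambda>m. sum g {..<m}"]) simp
  also have "\<dots> = (\<Sum>\<rho><Suc k. g \<rho>) + (\<Sum>i<Suc k. g (Suc k + i))"
    using sum.nat_group[of g "Suc k" 2] sum.atLeastLessThan_concat[of 0 "Suc k" "Suc k + Suc k" g]
      sum.shift_bounds_nat_ivl[of g 0 "Suc k" "Suc k"]
    by (simp add: atLeast0LessThan add.commute)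
  finally show ?thesis by (simp add: sum.distrib)
qed

end

section \<open>Geometry of the reduced problem\<close>

locale flat_instance_ok = flat_instance +
  assumes k: "1 \<le> k"
    and W_pos: "\<And>c. c < cells \<Longrightarrow> 0 < W c"
    and f_convex: "\<And>c. c < cells \<Longrightarrow> convex_on UNIV (f c)"
    and fits: "L + double_offset (Suc k) \<le> R"
begin

lemma row_width_nonneg: "\<rho> < 2 * k + 2 \<Longrightarrow> 0 \<le> row_width \<rho>"
  unfolding row_width_def using row_start_le_cells[of \<rho>] W_pos by (intro sum_nonneg) (simp add: less_imp_le)

lemma double_width_nonneg: "i \<le> k \<Longrightarrow> 0 \<le> double_width i"
  using W_pos[of "i - 1"] k_le_cells by (simp add: double_width_def less_imp_le)

lemma double_offset_step:
  "i \<le> k \<Longrightarrow> double_offset i + double_width i + row_width i \<le> double_offset (Suc i)"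
  "i \<le> k \<Longrightarrow> double_offset i + double_width i + row_width (k + 1 + i) \<le> double_offset (Suc i)"
  by simp_all

lemma double_offset_mono: "i \<le> j \<Longrightarrow> j \<le> Suc k \<Longrightarrow> double_offset i \<le> double_offset j"
proof (induction j rule: dec_induct)
  case (step j)
  then show ?case using double_width_nonneg[of j] row_width_nonneg[of j] double_offset_step(1)[of j] by simp
qed simp

lemma double_offset_nonneg: "i \<le> Suc k \<Longrightarrow> 0 \<le> double_offset i"
  using double_offset_mono[of 0 i] by simp

lemma L_le_R: "L \<le> max_shifted" "L \<le> R"
  using fits double_offset_nonneg[of "Suc k"] by (auto simp: max_shifted_def)

lemma shift_mono: "\<rho> \<le> \<tau> \<Longrightarrow> shift \<rho> \<le> shift \<tau>"
  and shift_nonneg: "0 \<le> shift \<rho>"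
  using L_le_R by (auto simp: shift_def intro: mult_right_mono)

lemma shift_Suc: "shift (Suc \<rho>) = shift \<rho> + (R - L)"
  by (simp add: shift_def algebra_simps)

text \<open>The middle inequality is where the maximum in \<open>double_offset\<close> matters: even
  if both neighbours have the same reduced position, either row of the column fits between
  them.\<close>

lemma bounds_in_box:
  assumes "\<rho> < 2 * k + 2" "L \<le> x" "x \<le> y" "y \<le> max_shifted"
  shows "L + shift \<rho> \<le> x + left_bound \<rho>" "x + left_bound \<rho> \<le> y + right_bound \<rho>"
    "y + right_bound \<rho> \<le> R + shift \<rho>"
proof -
  have c: "col \<rho> \<le> k" using assms(1) by (rule col_le)
  show "L + shift \<rho> \<le> x + left_bound \<rho>"
    using assms double_offset_nonneg[of "col \<rho>"] double_width_nonneg[of "col \<rho>"] c by (simp add: left_bound_def)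
  have "\<rho> = col \<rho> \<or> \<rho> = k + 1 + col \<rho>" by (auto simp: col_def)
  then have "double_offset (col \<rho>) + double_width (col \<rho>) + row_width \<rho> \<le> double_offset (Suc (col \<rho>))"
    using double_offset_step[OF c] by metis
  then show "x + left_bound \<rho> \<le> y + right_bound \<rho>"
    using assms by (simp add: left_bound_def right_bound_def)
  show "y + right_bound \<rho> \<le> R + shift \<rho>"
    using assms double_offset_mono[of "Suc (col \<rho>)" "Suc k"] c row_width_nonneg[of \<rho>]
    by (simp add: right_bound_def max_shifted_def)
qed

text \<open>\<open>shift\<close> puts the boxes of successive rows end to end, which separates
  adjacent elements of different rows; elements of the same row share their bounds.\<close>

lemma block_bounds_rows:
  assumes "\<And>\<rho>. \<rho> < 2 * k + 2 \<Longrightarrow> L + shift \<rho> \<le> A \<rho> \<and> A \<rho> \<le> B \<rho> \<and> B \<rho> \<le> R + shift \<rho>"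
  shows "block_bounds cells row_lo row_hi (\<lambda>c. if c < k then L else A (row c)) (\<lambda>c. if c < k then L else B (row c))"
  unfolding block_bounds_def
proof (intro conjI allI impI)
  fix c assume "c < cells"
  then show "row_lo c \<le> (if c < k then L else A (row c))"
    "(if c < k then L else A (row c)) \<le> (if c < k then L else B (row c))"
    "(if c < k then L else B (row c)) \<le> row_hi c"
    using assms[of "row c"] row_bounds(1)[of c] by (auto simp: row_lo_def row_hi_def not_less)
next
  fix c assume c: "Suc c < cells"
  show "row_hi c \<le> row_lo (Suc c) \<or>
    (if c < k then L else A (row c)) = (if Suc c < k then L else A (row (Suc c))) \<and>
    (if c < k then L else B (row c)) = (if Suc c < k then L else B (row (Suc c)))"
  proof (cases "c < k \<or> row c = row (Suc c)")
    case True
    then show ?thesis using shift_nonneg[of "row (Suc c)"] by (auto simp: row_lo_def row_hi_def)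
  next
    case False
    then have "row c < row (Suc c)" using row_mono[of c "Suc c"] c by simp
    then have "shift (Suc (row c)) \<le> shift (row (Suc c))" by (intro shift_mono) simp
    then show ?thesis using False by (auto simp: row_lo_def row_hi_def shift_Suc)
  qed
qed

lemma rows_chain_boxes: "chain_boxes cells row_lo row_hi row_cost"
  unfolding chain_boxes_def
proof (intro conjI allI impI)
  fix c assume c: "c < cells"
  show "row_lo c \<le> row_hi c" using L_le_R by (simp add: row_lo_def row_hi_def)
  show "convex_on {row_lo c..row_hi c} (row_cost c)"
  proof (cases "c < k")
    case True
    then have "row_cost c = (\<lambda>_. 0)" by (auto simp: row_cost_def)
    then show ?thesis by (simp add: convex_on_const)
  next
    case False
    have "f c ((1 - t) * x + t * y + offset c) \<le> (1 - t) * f c (x + offset c) + t * f c (y + offset c)"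
      if "0 < t" "t < 1" for t x y
      using convex_onD[OF f_convex[OF c], of t "x + offset c" "y + offset c"] that by (simp add: algebra_simps)
    then show ?thesis using False by (intro convex_onI) (simp_all add: row_cost_def)
  qed
next
  fix c assume c: "Suc c < cells"
  have "row c \<le> row (Suc c)" if "k \<le> c" using that c by (intro row_mono) auto
  then have "shift (row c) \<le> shift (row (Suc c))" if "k \<le> c" using that shift_mono by simp
  then show "row_lo c \<le> row_lo (Suc c)" "row_hi c \<le> row_hi (Suc c)"
    using shift_nonneg[of "row (Suc c)"] L_le_R by (auto simp: row_lo_def row_hi_def not_less)
qed

end

section \<open>Replacing the single rows by convex costs of the double-row cells\<close>

locale solved_rows = flat_instance_ok +
  fixes U :: "nat \<Rightarrow> real"
  assumes U: "chain_optimal cells row_lo row_hi row_cost U"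
begin

lemma U_box: "k \<le> c \<Longrightarrow> c < cells \<Longrightarrow> L + shift (row c) \<le> U c \<and> U c \<le> R + shift (row c)"
  using U by (auto simp: chain_optimal_def chain_feasible_def row_lo_def row_hi_def)

definition clipped_row :: "real \<Rightarrow> real \<Rightarrow> nat \<Rightarrow> real" where
  "clipped_row l r \<rho> = (\<Sum>c\<in>{row_start \<rho>..<row_start (Suc \<rho>)}. f c (clip l r (U c) + offset c))"

lemma sum_clipped_rows:
  "(\<Sum>c<cells. row_cost c (clip (if c < k then L else A (row c)) (if c < k then L else B (row c)) (U c))) =
     (\<Sum>\<rho><2 * k + 2. clipped_row (A \<rho>) (B \<rho>) \<rho>)"
  using sum_rows_all[of "\<lambda>\<rho> c. f c (clip (A \<rho>) (B \<rho>) (U c) + offset c)"]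
  by (simp add: clipped_row_def row_cost_def if_distrib cong: if_cong)

text \<open>\<open>clipped_cost_convex\<close> speaks of the whole chain. If all other rows keep
  their full boxes, their contribution is a constant, and what remains is the convexity of one
  row.\<close>

lemma clipped_row_convex:
  assumes \<rho>: "\<rho> < 2 * k + 2"
    and A: "\<And>t x y. A ((1 - t) * x + t * y) = (1 - t) * A x + t * A y"
    and B: "\<And>t x y. B ((1 - t) * x + t * y) = (1 - t) * B x + t * B y"
    and box: "\<And>x. x \<in> {a..b} \<Longrightarrow> L + shift \<rho> \<le> A x \<and> A x \<le> B x \<and> B x \<le> R + shift \<rho>"
  shows "convex_on {a..b} (\<lambda>x. clipped_row (A x) (B x) \<rho>)"
proof -
  define A' where "A' x \<tau> = (if \<tau> = \<rho> then A x else L + shift \<tau>)" for x \<tau>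
  define B' where "B' x \<tau> = (if \<tau> = \<rho> then B x else R + shift \<tau>)" for x \<tau>
  define C where "C = (\<Sum>\<tau>\<in>{..<2 * k + 2} - {\<rho>}. clipped_row (L + shift \<tau>) (R + shift \<tau>) \<tau>)"
  have "convex_on {a..b} (\<lambda>x. \<Sum>c<cells. row_cost c (clip (if c < k then L else A' x (row c))
      (if c < k then L else B' x (row c)) (U c)))"
  proof (rule clipped_cost_convex[OF rows_chain_boxes U])
    show "block_bounds cells row_lo row_hi (\<lambda>c. if c < k then L else A' x (row c))
        (\<lambda>c. if c < k then L else B' x (row c))" if "x \<in> {a..b}" for x
      by (rule block_bounds_rows) (use box[OF that] L_le_R in \<open>auto simp: A'_def B'_def\<close>)
  qed (auto simp: A'_def B'_def A B; simp add: algebra_simps)+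
  moreover have "(\<Sum>c<cells. row_cost c (clip (if c < k then L else A' x (row c))
      (if c < k then L else B' x (row c)) (U c))) = clipped_row (A x) (B x) \<rho> + C" for x
    unfolding sum_clipped_rows C_def
    using \<rho> by (subst sum.remove[of _ \<rho>]) (auto simp: A'_def B'_def intro!: sum.cong)
  ultimately have "convex_on {a..b} (\<lambda>x. clipped_row (A x) (B x) \<rho> + C)" by simp
  from convex_on_add[OF this convex_on_const[THEN iffD2, of "{a..b}" "- C"]] show ?thesis by simp
qed

text \<open>\<open>U\<close> never exceeds the right end of its box, so the one-sided expression is
  a clipping with constant right bound. Each half is thereby an optimal row cost in its own right,
  which is the source of its convexity.\<close>

lemma left_cost_clipped:
  assumes "\<rho> < 2 * k + 2"
  shows "left_cost U \<rho> x = clipped_row (x + left_bound \<rho>) (R + shift \<rho>) \<rho>"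
  unfolding left_cost_def clipped_row_def
proof (rule sum.cong)
  fix c assume c: "c \<in> {row_start \<rho>..<row_start (Suc \<rho>)}"
  then have "U c \<le> R + shift \<rho>"
    using U_box[of c] row_eqI[of \<rho> c] row_start_le_cells[OF assms] k_le_row_start[of \<rho>] by simp
  then show "f c (max (x + left_bound \<rho>) (U c) + offset c) = f c (clip (x + left_bound \<rho>) (R + shift \<rho>) (U c) + offset c)"
    by (simp add: clip_def)
qed simp

lemma right_cost_clipped:
  assumes "\<rho> < 2 * k + 2" "L \<le> x"
  shows "right_cost U \<rho> x = clipped_row (L + shift \<rho>) (x + right_bound \<rho>) \<rho>"
  unfolding right_cost_def clipped_row_def
proof (rule sum.cong)
  fix c assume c: "c \<in> {row_start \<rho>..<row_start (Suc \<rho>)}"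
  then have "L + shift \<rho> \<le> U c"
    using U_box[of c] row_eqI[of \<rho> c] row_start_le_cells[OF assms(1)] k_le_row_start[of \<rho>] by simp
  moreover have "L + shift \<rho> \<le> x + right_bound \<rho>"
    using bounds_in_box[OF assms(1) order_refl order_refl L_le_R(1)] assms(2) by simp
  ultimately show "f c (min (x + right_bound \<rho>) (U c) + offset c) = f c (clip (L + shift \<rho>) (x + right_bound \<rho>) (U c) + offset c)"
    by (simp add: clip_def)
qed simp

lemma left_cost_convex: assumes "\<rho> < 2 * k + 2" shows "convex_on {L..max_shifted} (left_cost U \<rho>)"
proof -
  have "convex_on {L..max_shifted} (\<lambda>x. clipped_row (x + left_bound \<rho>) (R + shift \<rho>) \<rho>)"
    by (rule clipped_row_convex[OF assms])
      (use bounds_in_box[OF assms _ order_refl] in \<open>force simp: algebra_simps\<close>)+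
  then show ?thesis by (rule convex_on_eq) (use left_cost_clipped[OF assms] in auto)
qed

lemma right_cost_convex: assumes "\<rho> < 2 * k + 2" shows "convex_on {L..max_shifted} (right_cost U \<rho>)"
proof -
  have "convex_on {L..max_shifted} (\<lambda>x. clipped_row (L + shift \<rho>) (x + right_bound \<rho>) \<rho>)"
    by (rule clipped_row_convex[OF assms])
      (use bounds_in_box[OF assms _ order_refl] in \<open>force simp: algebra_simps\<close>)+
  then show ?thesis
    by (rule convex_on_eq) (use right_cost_clipped[OF assms] in auto)
qed

lemma double_chain_boxes: "chain_boxes k (\<lambda>_. L) (\<lambda>_. max_shifted) (double_cost U)"
proof -
  have "convex_on {L..max_shifted} (double_cost U s)" if s: "s < k" for s
  proof -
    have "convex_on {L..max_shifted} (\<lambda>x. f s (x + double_offset (Suc s)))"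
    proof (rule convex_onI)
      fix t x y :: real assume "0 < t" "t < 1"
      then show "f s ((1 - t) *\<^sub>R x + t *\<^sub>R y + double_offset (Suc s)) \<le>
          (1 - t) * f s (x + double_offset (Suc s)) + t * f s (y + double_offset (Suc s))"
        using convex_onD[OF f_convex[of s], of t "x + double_offset (Suc s)" "y + double_offset (Suc s)"] s k_le_cells
        by (simp add: algebra_simps del: double_offset.simps)
    qed simp
    then show ?thesis
      unfolding double_cost_def using s
      by (intro convex_on_add left_cost_convex right_cost_convex) simp_all
  qed
  then show ?thesis using L_le_R by (simp add: chain_boxes_def)
qed

lemma clipped_row_split:
  assumes "l \<le> r"
  shows "clipped_row l r \<rho> =
    (\<Sum>c\<in>{row_start \<rho>..<row_start (Suc \<rho>)}. f c (max l (U c) + offset c)) +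
    (\<Sum>c\<in>{row_start \<rho>..<row_start (Suc \<rho>)}. f c (min r (U c) + offset c)) -
    (\<Sum>c\<in>{row_start \<rho>..<row_start (Suc \<rho>)}. f c (U c + offset c))"
  unfolding clipped_row_def sum.distrib[symmetric] sum_subtractf[symmetric]
  by (rule sum.cong) (use assms in \<open>auto simp: clip_def max_def min_def\<close>)

text \<open>What the sum over the double-row cells leaves out: the halves that belong to the two
  walls, and the subtracted third terms of the clipping identity.\<close>

definition fixed_cost :: real where
  "fixed_cost = left_cost U 0 L + left_cost U (k + 1) L + right_cost U k max_shifted +
     right_cost U (k + 1 + k) max_shifted -
     (\<Sum>\<rho><2 * k + 2. \<Sum>c\<in>{row_start \<rho>..<row_start (Suc \<rho>)}. f c (U c + offset c))"

lemma ext_bounds: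
  assumes "chain_feasible k (\<lambda>_. L) (\<lambda>_. max_shifted) v" "i \<le> k"
  shows "L \<le> ext v i" "ext v i \<le> ext v (Suc i)" "ext v (Suc i) \<le> max_shifted"
  using assms L_le_R by (cases i; force simp: ext_def chain_feasible_def)+

text \<open>A regrouping: on the left the halves are summed by row, on the right by the double-row
  cell on which they depend.\<close>

lemma double_cost_total:
  assumes v: "chain_feasible k (\<lambda>_. L) (\<lambda>_. max_shifted) v"
  shows "(\<Sum>s<k. f s (v s + double_offset (Suc s))) +
      (\<Sum>\<rho><2 * k + 2. clipped_row (ext v (col \<rho>) + left_bound \<rho>) (ext v (Suc (col \<rho>)) + right_bound \<rho>) \<rho>) =
    (\<Sum>s<k. double_cost U s (v s)) + fixed_cost"
proof -
  define G where "G = (\<Sum>\<rho><2 * k + 2. \<Sum>c\<in>{row_start \<rho>..<row_start (Suc \<rho>)}. f c (U c + offset c))"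
  define A where "A i x = left_cost U i x + left_cost U (k + 1 + i) x" for i x
  define B where "B i x = right_cost U i x + right_cost U (k + 1 + i) x" for i x
  have "clipped_row (ext v (col \<rho>) + left_bound \<rho>) (ext v (Suc (col \<rho>)) + right_bound \<rho>) \<rho> =
      left_cost U \<rho> (ext v (col \<rho>)) + right_cost U \<rho> (ext v (Suc (col \<rho>))) -
      (\<Sum>c\<in>{row_start \<rho>..<row_start (Suc \<rho>)}. f c (U c + offset c))" if "\<rho> < 2 * k + 2" for \<rho>
    unfolding left_cost_def right_cost_def
    by (rule clipped_row_split) (use bounds_in_box(2)[OF that] ext_bounds[OF v col_le[OF that]] in auto)
  then have "(\<Sum>\<rho><2 * k + 2. clipped_row (ext v (col \<rho>) + left_bound \<rho>) (ext v (Suc (col \<rho>)) + right_bound \<rho>) \<rho>) =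
      (\<Sum>\<rho><2 * k + 2. left_cost U \<rho> (ext v (col \<rho>)) + right_cost U \<rho> (ext v (Suc (col \<rho>)))) - G"
    by (simp add: G_def sum_subtractf)
  also have "(\<Sum>\<rho><2 * k + 2. left_cost U \<rho> (ext v (col \<rho>)) + right_cost U \<rho> (ext v (Suc (col \<rho>)))) =
      (\<Sum>i<Suc k. A i (ext v i)) + (\<Sum>i<Suc k. B i (ext v (Suc i)))"
    unfolding sum_two_rows sum.distrib[symmetric]
    by (rule sum.cong) (auto simp: A_def B_def col_def)
  also have "(\<Sum>i<Suc k. A i (ext v i)) = A 0 L + (\<Sum>s<k. A (Suc s) (v s))"
    by (subst sum.lessThan_Suc_shift) (simp add: ext_def)
  also have "(\<Sum>i<Suc k. B i (ext v (Suc i))) = (\<Sum>s<k. B s (v s)) + B k max_shifted"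
    by (simp add: ext_def)
  finally show ?thesis
    by (simp add: double_cost_def fixed_cost_def A_def B_def G_def sum.distrib del: double_offset.simps)
qed

definition flat_cost :: "(nat \<Rightarrow> real) \<Rightarrow> real" where
  "flat_cost X = (\<Sum>c<cells. f c (X c))"

text \<open>This is \<open>row_feasible_iff_shifted\<close> with cell numbers instead of indices
  within the row. \<open>shift \<rho>\<close> is contained in \<open>X c - offset c\<close> as well
  as in both bounds and cancels.\<close>

lemma row_feasible_flat:
  assumes \<rho>: "\<rho> < 2 * k + 2"
  shows "row_feasible (x + double_offset (col \<rho>) + double_width (col \<rho>)) (y + double_offset (Suc (col \<rho>)))
      (num \<rho>) (\<lambda>j. W (row_start \<rho> + j - 1)) (\<lambda>j. X (row_start \<rho> + j - 1)) \<longleftrightarrow>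
    (\<forall>c\<in>{row_start \<rho>..<row_start (Suc \<rho>)}. x + left_bound \<rho> \<le> X c - offset c \<and> X c - offset c \<le> y + right_bound \<rho>) \<and>
    (\<forall>c. row_start \<rho> \<le> c \<and> Suc c < row_start (Suc \<rho>) \<longrightarrow> X c - offset c \<le> X (Suc c) - offset (Suc c))"
    (is "?row \<longleftrightarrow> (\<forall>c\<in>?C. ?P c) \<and> (\<forall>c. ?A c \<longrightarrow> ?M c)")
proof (cases "num \<rho> = 0")
  case True
  then show ?thesis by (simp add: row_feasible_def row_start_Suc)
next
  case False
  define a where "a = row_start \<rho>"
  have pre: "(\<Sum>t\<in>{1..<j}. W (a + t - 1)) = (\<Sum>d\<in>{a..<a + j - 1}. W d)" if "1 \<le> j" for j
    by (rule sum.reindex_bij_witness[of _ "\<lambda>d. d + 1 - a" "\<lambda>t. a + t - 1"]) (use that in auto)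
  have tot: "(\<Sum>t\<in>{1..num \<rho>}. W (a + t - 1)) = row_width \<rho>"
    using pre[of "Suc (num \<rho>)"] by (simp add: row_width_def row_start_Suc a_def atLeastLessThanSuc_atLeastAtMost)
  have q: "X (a + j - 1) - (\<Sum>t\<in>{1..<j}. W (a + t - 1)) = X (a + j - 1) - offset (a + j - 1) - shift \<rho>"
    if "1 \<le> j" "j \<le> num \<rho>" for j
    using pre[OF that(1)] row_eqI[of \<rho> "a + j - 1"] that by (simp add: offset_def row_start_Suc a_def)
  have "?row \<longleftrightarrow> (\<forall>j\<in>{1..num \<rho>}. ?P (a + j - 1)) \<and> (\<forall>j. 1 \<le> j \<and> j < num \<rho> \<longrightarrow> ?M (a + j - 1))"
    unfolding a_def[symmetric]
  proof (subst row_feasible_iff_shifted, goal_cases)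
    case 1 then show ?case using False by simp
  next
    case 2
    have "X (a + j - 1) - (\<Sum>t\<in>{1..<j}. W (a + t - 1)) \<le> X (a + Suc j - 1) - (\<Sum>t\<in>{1..<Suc j}. W (a + t - 1)) \<longleftrightarrow>
        ?M (a + j - 1)" if "1 \<le> j \<and> j < num \<rho>" for j
      unfolding q[of j, OF conjunct1[OF that] less_imp_le[OF conjunct2[OF that]]]
      using q[of "Suc j"] that by (auto simp: Suc_diff_le)
    moreover have "x + double_offset (col \<rho>) + double_width (col \<rho>) \<le> X (a + j - 1) - (\<Sum>t\<in>{1..<j}. W (a + t - 1)) \<and>
        X (a + j - 1) - (\<Sum>t\<in>{1..<j}. W (a + t - 1)) \<le> y + double_offset (Suc (col \<rho>)) - (\<Sum>t\<in>{1..num \<rho>}. W (a + t - 1)) \<longleftrightarrow>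
        ?P (a + j - 1)" if "j \<in> {1..num \<rho>}" for j
      unfolding tot using q[of j] that by (auto simp: left_bound_def right_bound_def simp del: double_offset.simps)
    ultimately show ?case by (metis (no_types, lifting))
  qed
  also have "\<dots> \<longleftrightarrow> (\<forall>c\<in>?C. ?P c) \<and> (\<forall>c. ?A c \<longrightarrow> ?M c)"
  proof (intro arg_cong2[where f = "(\<and>)"])
    have "?C = (\<lambda>j. a + j - 1) ` {1..num \<rho>}"
    proof (intro equalityI subsetI)
      fix c assume "c \<in> ?C"
      then show "c \<in> (\<lambda>j. a + j - 1) ` {1..num \<rho>}"
        by (intro image_eqI[of _ _ "c + 1 - a"]) (auto simp: row_start_Suc a_def)
    qed (auto simp: row_start_Suc a_def)
    then show "(\<forall>j\<in>{1..num \<rho>}. ?P (a + j - 1)) = (\<forall>c\<in>?C. ?P c)" by simp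
    show "(\<forall>j. 1 \<le> j \<and> j < num \<rho> \<longrightarrow> ?M (a + j - 1)) = (\<forall>c. ?A c \<longrightarrow> ?M c)"
    proof (intro iffI allI impI)
      fix c assume h: "\<forall>j. 1 \<le> j \<and> j < num \<rho> \<longrightarrow> ?M (a + j - 1)" and c: "?A c"
      have "1 \<le> c + 1 - a \<and> c + 1 - a < num \<rho>" "a + (c + 1 - a) - 1 = c"
        using c unfolding row_start_Suc a_def by linarith+
      then show "?M c" using h by metis
    next
      fix j assume h: "\<forall>c. ?A c \<longrightarrow> ?M c" and j: "1 \<le> j \<and> j < num \<rho>"
      have "?A (a + j - 1)" using j unfolding row_start_Suc a_def by linarith
      then show "?M (a + j - 1)" using h by blast
    qed
  qed
  finally show ?thesis .
qed

abbreviation (input) "cell_lo v c \<equiv> (if c < k then L else ext v (col (row c)) + left_bound (row c))"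
abbreviation (input) "cell_hi v c \<equiv> (if c < k then L else ext v (Suc (col (row c))) + right_bound (row c))"

lemma cell_bounds:
  assumes "chain_feasible k (\<lambda>_. L) (\<lambda>_. max_shifted) v"
  shows "block_bounds cells row_lo row_hi (\<lambda>c. cell_lo v c) (\<lambda>c. cell_hi v c)"
proof (rule block_bounds_rows[of "\<lambda>\<rho>. ext v (col \<rho>) + left_bound \<rho>" "\<lambda>\<rho>. ext v (Suc (col \<rho>)) + right_bound \<rho>"])
  fix \<rho> assume \<rho>: "\<rho> < 2 * k + 2"
  note e = ext_bounds[OF assms col_le[OF \<rho>]]
  show "L + shift \<rho> \<le> ext v (col \<rho>) + left_bound \<rho> \<and>
      ext v (col \<rho>) + left_bound \<rho> \<le> ext v (Suc (col \<rho>)) + right_bound \<rho> \<and>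
      ext v (Suc (col \<rho>)) + right_bound \<rho> \<le> R + shift \<rho>"
    using bounds_in_box[OF \<rho> e] by simp
qed

lemma double_pos_ext:
  assumes "\<And>s. s < k \<Longrightarrow> X s = v s + double_offset (Suc s)" "i \<le> Suc k"
  shows "double_pos X i = ext v i + double_offset i"
  using assms(1)[of "i - 1"] assms(2) by (cases i) (auto simp: double_pos_def ext_def max_shifted_def)

lemma flat_cost_split:
  assumes "\<And>s. s < k \<Longrightarrow> X s = v s + double_offset (Suc s)"
    and "\<And>c. k \<le> c \<Longrightarrow> c < cells \<Longrightarrow> X c = w c + offset c"
  shows "flat_cost X = (\<Sum>s<k. f s (v s + double_offset (Suc s))) + (\<Sum>c<cells. row_cost c (w c))"
  unfolding flat_cost_def sum_lessThan_split[OF k_le_cells] using assms by (simp add: row_cost_def)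

text \<open>With the double-row cells held fixed, the clipped \<open>U\<close> is an optimal filling
  of the rows, and \<open>double_cost_total\<close> turns its cost into the cost of the double-row
  chain.\<close>

lemma feasible_lower_bound:
  assumes X: "flat_feasible X"
  defines "v \<equiv> \<lambda>s. X s - double_offset (Suc s)"
  shows "chain_feasible k (\<lambda>_. L) (\<lambda>_. max_shifted) v"
    and "(\<Sum>s<k. double_cost U s (v s)) + fixed_cost \<le> flat_cost X"
proof -
  have dp: "double_pos X i = ext v i + double_offset i" if "i \<le> Suc k" for i
    using that by (intro double_pos_ext) (simp_all add: v_def)
  define u where "u c = X c - offset c" for c
  have row: "(\<forall>c\<in>{row_start \<rho>..<row_start (Suc \<rho>)}. ext v (col \<rho>) + left_bound \<rho> \<le> u c \<and>
        u c \<le> ext v (Suc (col \<rho>)) + right_bound \<rho>) \<and>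
      (\<forall>c. row_start \<rho> \<le> c \<and> Suc c < row_start (Suc \<rho>) \<longrightarrow> u c \<le> u (Suc c))" if "\<rho> < 2 * k + 2" for \<rho>
  proof -
    have "row_feasible (ext v (col \<rho>) + double_offset (col \<rho>) + double_width (col \<rho>))
        (ext v (Suc (col \<rho>)) + double_offset (Suc (col \<rho>))) (num \<rho>)
        (\<lambda>j. W (row_start \<rho> + j - 1)) (\<lambda>j. X (row_start \<rho> + j - 1))"
    proof -
      have "row_feasible (double_pos X (col \<rho>) + double_width (col \<rho>)) (double_pos X (col \<rho> + 1)) (num \<rho>)
          (\<lambda>j. W (row_start \<rho> + j - 1)) (\<lambda>j. X (row_start \<rho> + j - 1))"
        using X that unfolding flat_feasible_def by blast
      moreover have "double_pos X (col \<rho>) = ext v (col \<rho>) + double_offset (col \<rho>)"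
        "double_pos X (col \<rho> + 1) = ext v (Suc (col \<rho>)) + double_offset (Suc (col \<rho>))"
        using dp[of "col \<rho>"] dp[of "Suc (col \<rho>)"] col_le[OF that] by simp_all
      ultimately show ?thesis by (simp only:)
    qed
    then show ?thesis unfolding row_feasible_flat[OF that] u_def .
  qed
  \<comment> \<open>A nonempty row claims its width between its neighbours, as seen from the bounds
    of its first cell. For an empty row the constraint between the neighbours themselves is used.
    Both rows of a column together give \<open>mono\<close>.\<close>
  have fit: "ext v i + double_offset i + double_width i + row_width \<rho> \<le> ext v (Suc i) + double_offset (Suc i)"
    if "i \<le> k" and \<rho>: "\<rho> = i \<or> \<rho> = k + 1 + i" for i \<rho>
  proof (cases "num \<rho> = 0")
    case True
    then have "row_width \<rho> = 0" by (simp add: row_width_def row_start_Suc)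
    then show ?thesis
      using X dp[of i] dp[of "Suc i"] that(1) by (auto simp: flat_feasible_def simp del: double_offset.simps)
  next
    case False
    have c: "col \<rho> = i" "\<rho> < 2 * k + 2" using that by (auto simp: col_def)
    show ?thesis
      using row[OF c(2)] False by (auto simp: row_start_Suc left_bound_def right_bound_def c(1)
          simp del: double_offset.simps dest!: bspec[of _ _ "row_start \<rho>"])
  qed
  have mono: "ext v i \<le> ext v (Suc i)" if "i \<le> k" for i
    using fit[OF that, of i] fit[OF that, of "k + 1 + i"] by (auto simp: max_def split: if_splits)
  have ext_mono: "ext v i \<le> ext v j" if "i \<le> j" "j \<le> Suc k" for i j
    using that
  proof (induction j rule: dec_induct)
    case (step m) then show ?case using mono[of m] by simp
  qed simp
  show v: "chain_feasible k (\<lambda>_. L) (\<lambda>_. max_shifted) v"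
    unfolding chain_feasible_def
  proof (intro conjI allI impI)
    fix s assume "s < k"
    then show "L \<le> v s" "v s \<le> max_shifted"
      using ext_mono[of 0 "Suc s"] ext_mono[of "Suc s" "Suc k"] by (simp_all add: ext_def)
  next
    fix s assume "Suc s < k"
    then show "v s \<le> v (Suc s)" using mono[of "Suc s"] by (simp add: ext_def)
  qed
  define w where "w c = (if c < k then L else u c)" for c
  note bb = cell_bounds[OF v]
  have box: "cell_lo v c \<le> w c \<and> w c \<le> cell_hi v c" if "c < cells" for c
    using row[of "row c"] row_bounds[of c] that by (auto simp: w_def not_less)
  have "chain_feasible cells (\<lambda>c. cell_lo v c) (\<lambda>c. cell_hi v c) w"
    unfolding chain_feasible_def
  proof (intro conjI allI impI)
    fix c assume "c < cells" then show "cell_lo v c \<le> w c" "w c \<le> cell_hi v c" using box by auto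
  next
    fix c assume c: "Suc c < cells"
    have "cell_hi v c \<le> row_hi c" "row_lo (Suc c) \<le> cell_lo v (Suc c)"
      using bb c by (simp_all add: block_bounds_def)
    moreover have "row_hi c \<le> row_lo (Suc c) \<or> k \<le> c \<and> row c = row (Suc c)"
    proof (cases "c < k")
      case True then show ?thesis using shift_nonneg[of "row (Suc c)"] by (auto simp: row_lo_def row_hi_def)
    next
      case False
      then have "row c \<le> row (Suc c)" using c by (intro row_mono) auto
      moreover have "shift (Suc (row c)) \<le> shift (row (Suc c))" if "row c < row (Suc c)"
        using that by (intro shift_mono) simp
      ultimately show ?thesis using False by (auto simp: row_lo_def row_hi_def shift_Suc le_less)
    qed
    moreover have "w c \<le> w (Suc c)" if "k \<le> c" "row c = row (Suc c)"
      using row[of "row c"] row_bounds[of c] row_bounds[of "Suc c"] that c by (auto simp: w_def)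
    ultimately show "w c \<le> w (Suc c)" using box[of c] box[of "Suc c"] c by auto
  qed
  then have "(\<Sum>c<cells. row_cost c (clip (cell_lo v c) (cell_hi v c) (U c))) \<le> (\<Sum>c<cells. row_cost c (w c))"
    using clip_optimal[OF rows_chain_boxes U bb] by (simp add: chain_optimal_def)
  moreover have "flat_cost X = (\<Sum>s<k. f s (v s + double_offset (Suc s))) + (\<Sum>c<cells. row_cost c (w c))"
    by (rule flat_cost_split) (simp_all add: v_def w_def u_def)
  ultimately show "(\<Sum>s<k. double_cost U s (v s)) + fixed_cost \<le> flat_cost X"
    using double_cost_total[OF v] sum_clipped_rows[of "\<lambda>\<rho>. ext v (col \<rho>) + left_bound \<rho>"
      "\<lambda>\<rho>. ext v (Suc (col \<rho>)) + right_bound \<rho>"] by linarith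
qed

text \<open>The assembled solution attains the bound of \<open>feasible_lower_bound\<close> for its
  own \<open>v\<close>, and \<open>v\<close> minimises that bound over all chains.\<close>

theorem assemble_optimal:
  assumes v: "chain_optimal k (\<lambda>_. L) (\<lambda>_. max_shifted) (double_cost U) v"
  shows "flat_feasible (assemble v U)"
    and "flat_feasible Y \<Longrightarrow> flat_cost (assemble v U) \<le> flat_cost Y"
proof -
  let ?X = "assemble v U"
  have vf: "chain_feasible k (\<lambda>_. L) (\<lambda>_. max_shifted) v" using v by (simp add: chain_optimal_def)
  note bb = cell_bounds[OF vf]
  define w where "w c = clip (cell_lo v c) (cell_hi v c) (U c)" for c
  have wf: "chain_feasible cells (\<lambda>c. cell_lo v c) (\<lambda>c. cell_hi v c) w"
    using clip_optimal[OF rows_chain_boxes U bb] unfolding chain_optimal_def w_def[abs_def] by blast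
  have Xd: "?X s = v s + double_offset (Suc s)" if "s < k" for s using that by (simp add: assemble_def)
  have Xr: "?X c = w c + offset c" if "k \<le> c" for c using that by (simp add: assemble_def w_def)
  have dp: "double_pos ?X i = ext v i + double_offset i" if "i \<le> Suc k" for i
    using that by (intro double_pos_ext) (simp_all add: Xd)
  show "flat_feasible ?X"
    unfolding flat_feasible_def
  proof (intro conjI allI impI)
    fix i assume i: "i \<le> k"
    have "0 \<le> row_width i" using row_width_nonneg[of i] i by simp
    then show "double_pos ?X i + double_width i \<le> double_pos ?X (i + 1)"
      using dp[of i] dp[of "Suc i"] i ext_bounds(2)[OF vf i] double_offset_step(1)[OF i]
      by (simp del: double_offset.simps)
  next
    fix \<rho> assume \<rho>: "\<rho> < 2 * k + 2"
    have c: "col \<rho> \<le> k" by (rule col_le[OF \<rho>])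
    have in_row: "k \<le> c \<and> c < cells \<and> row c = \<rho>" if "row_start \<rho> \<le> c" "c < row_start (Suc \<rho>)" for c
      using that row_eqI[of \<rho> c] row_start_le_cells[OF \<rho>] k_le_row_start[of \<rho>] by simp
    have "row_feasible (ext v (col \<rho>) + double_offset (col \<rho>) + double_width (col \<rho>))
        (ext v (Suc (col \<rho>)) + double_offset (Suc (col \<rho>))) (num \<rho>)
        (\<lambda>j. W (row_start \<rho> + j - 1)) (\<lambda>j. ?X (row_start \<rho> + j - 1))"
      unfolding row_feasible_flat[OF \<rho>]
    proof (intro conjI ballI allI impI)
      fix c assume "c \<in> {row_start \<rho>..<row_start (Suc \<rho>)}"
      then have "k \<le> c" "c < cells" "row c = \<rho>" using in_row by auto
      then show "ext v (col \<rho>) + left_bound \<rho> \<le> ?X c - offset c" "?X c - offset c \<le> ext v (Suc (col \<rho>)) + right_bound \<rho>"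
        using wf Xr[of c] by (auto simp: chain_feasible_def)
    next
      fix c assume "row_start \<rho> \<le> c \<and> Suc c < row_start (Suc \<rho>)"
      then have "k \<le> c" "Suc c < cells" using in_row[of c] in_row[of "Suc c"] by auto
      then show "?X c - offset c \<le> ?X (Suc c) - offset (Suc c)"
        using wf Xr[of c] Xr[of "Suc c"] by (simp add: chain_feasible_def)
    qed
    then show "row_feasible (double_pos ?X (col \<rho>) + double_width (col \<rho>)) (double_pos ?X (col \<rho> + 1))
        (num \<rho>) (\<lambda>j. W (row_start \<rho> + j - 1)) (\<lambda>j. ?X (row_start \<rho> + j - 1))"
      using dp[of "col \<rho>"] dp[of "Suc (col \<rho>)"] c by (simp del: double_offset.simps)
  qed
  have "flat_cost ?X = (\<Sum>s<k. f s (v s + double_offset (Suc s))) + (\<Sum>c<cells. row_cost c (w c))"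
    by (rule flat_cost_split) (simp_all add: Xd Xr)
  then have "flat_cost ?X = (\<Sum>s<k. double_cost U s (v s)) + fixed_cost"
    using double_cost_total[OF vf] sum_clipped_rows[of "\<lambda>\<rho>. ext v (col \<rho>) + left_bound \<rho>"
      "\<lambda>\<rho>. ext v (Suc (col \<rho>)) + right_bound \<rho>"] unfolding w_def by linarith
  moreover assume Y: "flat_feasible Y"
  ultimately show "flat_cost ?X \<le> flat_cost Y"
    using feasible_lower_bound[OF Y] v by (fastforce simp: chain_optimal_def)
qed

end

section \<open>The input of the program\<close>

lemma nth_concat:
  assumes "c < length xss" "j < length (xss ! c)"
  shows "(\<Sum>d<c. length (xss ! d)) + j < length (concat xss)"
    and "concat xss ! ((\<Sum>d<c. length (xss ! d)) + j) = xss ! c ! j"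
  using assms
proof (induction xss arbitrary: c)
  case (Cons xs xss)
  { case 1 then show ?case
      using Cons.IH(1)[of "c - 1"] by (cases c) (auto simp: sum.lessThan_Suc_shift simp del: sum.lessThan_Suc) }
  { case 2 then show ?case
      using Cons.IH(2)[of "c - 1"]
      by (cases c) (auto simp: sum.lessThan_Suc_shift nth_append simp del: sum.lessThan_Suc) }
qed simp_all

lemma concat_rows:
  assumes "i < K" "j < m i"
  shows "(\<Sum>t<i. m t) + j < (\<Sum>t<K. m t)"
    and "concat (map (\<lambda>i. map (q i) [1..<m i + 1]) [0..<K]) ! ((\<Sum>t<i. m t) + j) = q i (j + 1)"
proof -
  let ?xss = "map (\<lambda>i. map (q i) [1..<m i + 1]) [0..<K]"
  have n: "?xss ! t = map (q t) [1..<m t + 1]" if "t < K" for t using that by simp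
  have s: "(\<Sum>t<i. length (?xss ! t)) = (\<Sum>t<i. m t)"
    using assms(1) by (intro sum.cong) (auto simp: n simp del: upt_Suc)
  have len: "length (concat ?xss) = (\<Sum>t<K. m t)"
    by (simp add: length_concat comp_def interv_sum_list_conv_sum_set_nat atLeast0LessThan del: upt_Suc)
  have j: "j < length (?xss ! i)" using assms by simp
  show "(\<Sum>t<i. m t) + j < (\<Sum>t<K. m t)"
    using nth_concat(1)[of i ?xss j] assms(1) j unfolding s len by simp
  have "concat ?xss ! ((\<Sum>t<i. m t) + j) = ?xss ! i ! j"
    using nth_concat(2)[of i ?xss j] assms(1) j unfolding s by simp
  also have "\<dots> = q i (j + 1)" using assms by (simp add: n nth_upt del: upt_Suc)
  finally show "concat ?xss ! ((\<Sum>t<i. m t) + j) = q i (j + 1)" .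
qed

lemma length_concat_rows: "length (concat (map (\<lambda>i. map (q i) [1..<m i + 1]) [0..<K])) = (\<Sum>t<K. m t)"
  by (simp add: length_concat comp_def interv_sum_list_conv_sum_set_nat atLeast0LessThan del: upt_Suc)

locale program_input =
  fixes I :: instance_drp and D :: costs_pq
  assumes instance_ok: "double_row_instance I" and data_ok: "costs_represented D I"
begin

abbreviation "start \<equiv> initial_state I D"
abbreviation "kC \<equiv> num_C I"

definition cell_data :: "nat \<Rightarrow> pq_data" where
  "cell_data c = cell_list I (data_C D) (data_b D) (data_t D) ! c"
definition cell_fun :: "nat \<Rightarrow> real \<Rightarrow> real" where
  "cell_fun c = cell_list I (cost_C I) (cost_b I) (cost_t I) ! c"

text \<open>The input lists the bottom counts directly before the top counts, and the widths in the
  order of the cells. The flat numbering is thus that of the memory, and both functions are plain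
  reads at a fixed distance.\<close>

definition row_size :: "nat \<Rightarrow> nat" where "row_size \<rho> = nats start 0 (1 + \<rho>)"
definition cell_width :: "nat \<Rightarrow> real" where "cell_width c = reals start 0 (2 + c)"

text \<open>Only the definitions become available here. The conditions of
  \<open>flat_instance_ok\<close> concern the values in memory and follow after the memory has been
  decoded.\<close>

sublocale flat_instance kC row_size cell_width "x_min I" "x_max I" cell_fun .

lemma start_nats: "nats start 0 = array_of (input_nats I D)"
  and start_reals: "reals start 0 = array_of (input_reals I D)"
  by (simp_all add: initial_state_def)

lemma num_rows:
  assumes "i \<le> kC"
  shows "row_size i = num_b I i" "row_size (kC + 1 + i) = num_t I i"
  using assms by (simp_all add: row_size_def start_nats array_of_def input_nats_def nth_append nth_Cons' del: upt_Suc)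

lemma start_0 [simp]: "nats start 0 0 = kC" "reals start 0 0 = x_min I" "reals start 0 (Suc 0) = x_max I"
  by (simp_all add: start_nats start_reals array_of_def input_nats_def input_reals_def)

lemma row_start_bottom: "i \<le> Suc kC \<Longrightarrow> row_start i = kC + (\<Sum>t<i. num_b I t)"
  unfolding row_start_def by (intro arg_cong2[where f = "(+)"] sum.cong) (auto simp: num_rows(1))

lemma row_start_top:
  "i \<le> Suc kC \<Longrightarrow> row_start (kC + 1 + i) = kC + (\<Sum>t<Suc kC. num_b I t) + (\<Sum>t<i. num_t I t)"
proof (induction i)
  case 0 then show ?case using row_start_bottom[of "Suc kC"] by simp
next
  case (Suc i)
  then show ?case using row_start_Suc[of "kC + 1 + i"] num_rows(2)[of i] by simp
qed

lemma cells_eq: "cells = num_cells I"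
  using row_start_top[of "Suc kC"]
  by (simp add: cells_def num_cells_def atLeast0AtMost lessThan_Suc_atMost mult_2 add.assoc del: sum.lessThan_Suc)

lemma length_cell_list: "length (cell_list I p q r) = cells"
proof -
  have "length (cell_list I p q r) = kC + (\<Sum>t<Suc kC. num_b I t) + (\<Sum>t<Suc kC. num_t I t)"
    unfolding cell_list_def length_append length_concat_rows by (simp del: upt_Suc)
  then show ?thesis using row_start_top[of "Suc kC"] by (simp add: cells_def mult_2)
qed

lemma nth_cell_list:
  "c < kC \<Longrightarrow> cell_list I p q r ! c = p (c + 1)"
  "i \<le> kC \<Longrightarrow> j < num_b I i \<Longrightarrow> cell_list I p q r ! (row_start i + j) = q i (j + 1)"
  "i \<le> kC \<Longrightarrow> j < num_t I i \<Longrightarrow> cell_list I p q r ! (row_start (kC + 1 + i) + j) = r i (j + 1)"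
proof -
  let ?b = "concat (map (\<lambda>i. map (q i) [1..<num_b I i + 1]) [0..<kC + 1])"
  let ?t = "concat (map (\<lambda>i. map (r i) [1..<num_t I i + 1]) [0..<kC + 1])"
  have lb: "length ?b = (\<Sum>t<Suc kC. num_b I t)" unfolding length_concat_rows by simp
  show "cell_list I p q r ! c = p (c + 1)" if "c < kC"
    using that by (simp add: cell_list_def nth_append del: upt_Suc)
  show "cell_list I p q r ! (row_start i + j) = q i (j + 1)" if "i \<le> kC" "j < num_b I i"
    using concat_rows[where i = i and K = "kC + 1" and j = j and m = "num_b I"] that lb
    by (simp add: cell_list_def nth_append row_start_bottom del: upt_Suc sum.lessThan_Suc)
  show "cell_list I p q r ! (row_start (kC + 1 + i) + j) = r i (j + 1)" if "i \<le> kC" "j < num_t I i"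
    using concat_rows[where i = i and K = "kC + 1" and j = j and m = "num_t I"] that lb row_start_top[of i]
    by (simp add: cell_list_def nth_append del: upt_Suc sum.lessThan_Suc)
qed

lemma cell_cases:
  assumes "c < cells"
  obtains (double) "c < kC"
    | (bottom) i j where "i \<le> kC" "j < num_b I i" "c = row_start i + j"
    | (top) i j where "i \<le> kC" "j < num_t I i" "c = row_start (kC + 1 + i) + j"
proof (cases "c < kC")
  case False
  define \<rho> where "\<rho> = row c"
  have \<rho>: "\<rho> < 2 * kC + 2" "row_start \<rho> \<le> c" "c < row_start (Suc \<rho>)"
    using row_bounds[of c] False assms by (auto simp: \<rho>_def)
  define j where "j = c - row_start \<rho>"
  have j: "c = row_start \<rho> + j" "j < row_size \<rho>"
    using \<rho> by (auto simp: j_def row_start_Suc)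
  show ?thesis
  proof (cases "\<rho> \<le> kC")
    case True then show ?thesis using bottom[of \<rho> j] j num_rows(1)[of \<rho>] by simp
  next
    case False
    then have "\<rho> = kC + 1 + (\<rho> - (kC + 1))" "\<rho> - (kC + 1) \<le> kC" using \<rho>(1) by auto
    then show ?thesis using top[of "\<rho> - (kC + 1)" j] j num_rows(2)[of "\<rho> - (kC + 1)"] by simp
  qed
qed (rule double)

lemma nth_cell_list_map:
  assumes "c < cells"
  shows "cell_list I (\<lambda>i. h (p i)) (\<lambda>i j. h (q i j)) (\<lambda>i j. h (r i j)) ! c = h (cell_list I p q r ! c)"
  using assms by (cases rule: cell_cases) (simp_all add: nth_cell_list[simplified])

lemma cell_width_eq: "c < cells \<Longrightarrow> cell_width c = cell_list I (width_C I) (width_b I) (width_t I) ! c"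
  by (simp add: cell_width_def start_reals array_of_def input_reals_def nth_append length_cell_list)

lemma cell_kinks: "c < cells \<Longrightarrow> nats start 0 (2 * kC + 3 + c) = num_kinks (cell_data c)"
proof -
  assume c: "c < cells"
  have "nats start 0 (2 * kC + 3 + c) = cell_list I (\<lambda>i. num_kinks (data_C D i))
       (\<lambda>i j. num_kinks (data_b D i j)) (\<lambda>i j. num_kinks (data_t D i j)) ! c"
    using c by (simp add: start_nats array_of_def input_nats_def nth_append length_cell_list del: upt_Suc)
  then show ?thesis unfolding cell_data_def nth_cell_list_map[OF c] .
qed

lemma cell_represents: assumes "c < cells" shows "pq_represents (cell_data c) (cell_fun c)"
  using assms data_ok by (cases rule: cell_cases)
    (auto simp: cell_data_def cell_fun_def nth_cell_list[simplified] costs_represented_def)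

lemma cell_convex: assumes "c < cells" shows "convex_on UNIV (cell_fun c)"
  using assms instance_ok by (cases rule: cell_cases)
    (auto simp: cell_fun_def nth_cell_list[simplified] double_row_instance_def cost_function_def)

lemma cell_width_pos: assumes "c < cells" shows "0 < cell_width c"
  unfolding cell_width_eq[OF assms] using assms instance_ok by (cases rule: cell_cases)
    (auto simp: nth_cell_list[simplified] double_row_instance_def)

text \<open>Two wall positions and one width per cell come first; a cost with \<open>k\<close> kinks
  occupies \<open>k + 3 * (k + 1)\<close> reals.\<close>

definition data_start :: "nat \<Rightarrow> nat" where
  "data_start c = 2 + cells + (\<Sum>d<c. 4 * num_kinks (cell_data d) + 3)"

lemma length_pq_reals: "pq_represents d g \<Longrightarrow> length (pq_reals d) = 4 * num_kinks d + 3"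
  by (cases d) (simp add: pq_reals_def num_kinks_def length_concat comp_def case_prod_unfold sum_list_triv)

lemma cell_data_stored: assumes c: "c < cells" "j < 4 * num_kinks (cell_data c) + 3"
  shows "reals start 0 (data_start c + j) = pq_reals (cell_data c) ! j"
proof -
  let ?xss = "cell_list I (\<lambda>i. pq_reals (data_C D i)) (\<lambda>i j. pq_reals (data_b D i j)) (\<lambda>i j. pq_reals (data_t D i j))"
  have n: "?xss ! d = pq_reals (cell_data d)" if "d < cells" for d
    unfolding cell_data_def nth_cell_list_map[OF that] ..
  have s: "(\<Sum>d<c. length (?xss ! d)) = (\<Sum>d<c. 4 * num_kinks (cell_data d) + 3)"
    using c(1) by (intro sum.cong) (auto simp: n length_pq_reals[OF cell_represents])
  have "j < length (?xss ! c)" using c by (simp add: n length_pq_reals[OF cell_represents])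
  then have "(\<Sum>d<c. 4 * num_kinks (cell_data d) + 3) + j < length (concat ?xss)"
    "concat ?xss ! ((\<Sum>d<c. 4 * num_kinks (cell_data d) + 3) + j) = pq_reals (cell_data c) ! j"
    using nth_concat[of c ?xss j] c(1) unfolding s by (simp_all add: length_cell_list n)
  then show ?thesis
    by (simp add: start_reals array_of_def input_reals_def nth_append length_cell_list data_start_def)
qed

lemma cell_stored: assumes c: "c < cells"
  shows "stored_cost (reals start 0) (data_start c) (num_kinks (cell_data c)) (cell_fun c)"
proof -
  obtain ps qs where d: "cell_data c = (ps, qs)" by (cases "cell_data c")
  define k where "k = length ps"
  have rep: "sorted_wrt (<) ps" "length qs = k + 1"
    and pieces: "\<And>j u. j \<le> k \<Longrightarrow> (0 < j \<longrightarrow> ps ! (j - 1) \<le> u) \<and> (j < k \<longrightarrow> u \<le> ps ! j) \<Longrightarrow>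
        (case qs ! j of (a, b, e) \<Rightarrow> cell_fun c u = a * u^2 + b * u + e)"
    using cell_represents[OF c] unfolding d k_def by auto
  have k: "num_kinks (cell_data c) = k" by (simp add: d num_kinks_def k_def)
  have kink: "reals start 0 (data_start c + j) = ps ! j" if "j < k" for j
    using cell_data_stored[OF c, of j] that k by (simp add: d pq_reals_def nth_append k_def)
  have coeff: "reals start 0 (data_start c + k + 3 * j + i) = (case qs ! j of (a, b, c) \<Rightarrow> [a, b, c] ! i)"
    if "j \<le> k" "i < 3" for i j
  proof -
    let ?xss = "map (\<lambda>(a, b, c). [a, b, c]) qs"
    have n: "length (?xss ! d) = 3" if "d < length qs" for d using that by (simp add: case_prod_unfold)
    have "(\<Sum>d<j. length (?xss ! d)) = (\<Sum>d<j. 3)"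
      by (intro sum.cong refl n) (use that rep in auto)
    then have s: "(\<Sum>d<j. length (?xss ! d)) = 3 * j" by simp
    have "concat ?xss ! (3 * j + i) = ?xss ! j ! i"
      using nth_concat(2)[of j ?xss i] that rep n[of j] unfolding s by simp
    moreover have "reals start 0 (data_start c + (k + (3 * j + i))) = concat ?xss ! (3 * j + i)"
      using cell_data_stored[OF c, of "k + (3 * j + i)"] that k by (simp add: d pq_reals_def nth_append k_def)
    ultimately show ?thesis using that rep by (simp add: add.assoc case_prod_unfold)
  qed
  show ?thesis
    unfolding stored_cost_def k
  proof (intro conjI allI impI)
    fix j assume "Suc j < k"
    then show "reals start 0 (data_start c + j) \<le> reals start 0 (data_start c + Suc j)"
      using rep(1) kink[of j] kink[of "Suc j"] by (simp add: sorted_wrt_iff_nth_less k_def less_imp_le)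
  next
    fix j u assume j: "j \<le> k"
      and u: "(0 < j \<longrightarrow> reals start 0 (data_start c + (j - 1)) \<le> u) \<and> (j < k \<longrightarrow> u \<le> reals start 0 (data_start c + j))"
    have "(0 < j \<longrightarrow> ps ! (j - 1) \<le> u) \<and> (j < k \<longrightarrow> u \<le> ps ! j)"
      using u kink[of "j - 1"] kink[of j] j by auto
    from pieces[OF j this]
    show "cell_fun c u = quad (reals start 0 (data_start c + k + 3 * j)) (reals start 0 (data_start c + k + 3 * j + 1)) u +
        reals start 0 (data_start c + k + 3 * j + 2)"
      using coeff[OF j, of 0] coeff[OF j, of 1] coeff[OF j, of 2] by (simp add: quad_def case_prod_unfold)
  qed
qed

lemma sum_cells:
  "(\<Sum>c<cells. g c) = (\<Sum>c<kC. g c) + (\<Sum>i<Suc kC. \<Sum>j<num_b I i. g (row_start i + j)) +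
     (\<Sum>i<Suc kC. \<Sum>j<num_t I i. (g (row_start (kC + 1 + i) + j) :: real))"
proof -
  have row: "(\<Sum>c\<in>{row_start \<rho>..<row_start (Suc \<rho>)}. g c) = (\<Sum>j<row_size \<rho>. g (row_start \<rho> + j))" for \<rho>
    using sum.shift_bounds_nat_ivl[of g 0 "row_start \<rho>" "row_size \<rho>"]
    by (simp add: row_start_Suc atLeast0LessThan add.commute)
  show ?thesis
    unfolding sum_lessThan_split[OF k_le_cells] sum_rows sum_two_rows row sum.distrib
    using num_rows by simp
qed

lemma sum_from_1: "(\<Sum>j = 1..n::nat. g j) = (\<Sum>j<n. g (j + 1))"
  by (rule sum.reindex_bij_witness[of _ "\<lambda>j. j + 1" "\<lambda>j. j - 1"]) auto

lemma row_width_eq: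
  assumes "i \<le> kC"
  shows "row_width i = (\<Sum>j = 1..num_b I i. width_b I i j)" "row_width (kC + 1 + i) = (\<Sum>j = 1..num_t I i. width_t I i j)"
proof -
  have row: "row_width \<rho> = (\<Sum>j<row_size \<rho>. cell_width (row_start \<rho> + j))" for \<rho>
    using sum.shift_bounds_nat_ivl[of cell_width 0 "row_start \<rho>" "row_size \<rho>"]
    by (simp add: row_width_def row_start_Suc atLeast0LessThan add.commute)
  have c: "row_start \<rho> + j < cells" if "\<rho> < 2 * kC + 2" "j < row_size \<rho>" for \<rho> j
    using row_start_le_cells[OF that(1)] that(2) by (simp add: row_start_Suc)
  show "row_width i = (\<Sum>j = 1..num_b I i. width_b I i j)"
    unfolding row sum_from_1 using assms c[of i] by (simp add: cell_width_eq nth_cell_list(2) num_rows(1))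
  show "row_width (kC + 1 + i) = (\<Sum>j = 1..num_t I i. width_t I i j)"
    unfolding row sum_from_1 num_rows(2)[OF assms]
  proof (rule sum.cong)
    fix j assume "j \<in> {..<num_t I i}"
    then show "cell_width (row_start (kC + 1 + i) + j) = width_t I i (j + 1)"
      using c[of "kC + 1 + i" j] num_rows(2)[OF assms] nth_cell_list(3)[OF assms, of j, where 'a = real] assms
      by (simp add: cell_width_eq)
  qed simp
qed

lemma double_width_eq: "i \<le> kC \<Longrightarrow> double_width i = width_C_ext I i"
  using k_le_cells by (simp add: double_width_def width_C_ext_def cell_width_eq nth_cell_list(1))

text \<open>At \<open>m = Suc kC\<close> this is the total width demanded by the space condition of
  the instance, which therefore becomes the assumption \<open>fits\<close>.\<close>

lemma double_offset_eq:
  "m \<le> Suc kC \<Longrightarrow> double_offset m = (\<Sum>i<m. width_C_ext I i) +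
     (\<Sum>i<m. max (\<Sum>j = 1..num_b I i. width_b I i j) (\<Sum>j = 1..num_t I i. width_t I i j))"
  by (induction m) (simp_all add: double_width_eq row_width_eq[simplified])

sublocale flat_instance_ok kC row_size cell_width "x_min I" "x_max I" cell_fun
proof
  show "1 \<le> kC" using instance_ok by (simp add: double_row_instance_def)
  have "(\<Sum>i<Suc kC. width_C_ext I i) = (\<Sum>i = 1..kC. width_C I i)"
    unfolding sum_from_1 by (subst sum.lessThan_Suc_shift) (simp add: width_C_ext_def)
  then show "x_min I + double_offset (Suc kC) \<le> x_max I"
    using instance_ok unfolding double_offset_eq[OF order_refl]
    by (simp add: double_row_instance_def atLeast0AtMost lessThan_Suc_atMost del: sum.lessThan_Suc)
qed (use cell_width_pos cell_convex in auto)

lemma total_cost_flat: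
  "total_cost I x y z = (\<Sum>c<cells. cell_fun c (cell_list I x y z ! c))"
  unfolding sum_cells total_cost_def sum_from_1 atLeast0AtMost lessThan_Suc_atMost[symmetric]
  by (simp add: cell_fun_def nth_cell_list[simplified] sum.distrib del: sum.lessThan_Suc)

lemma row_feasible_cong:
  "(\<And>j. 1 \<le> j \<Longrightarrow> j \<le> n \<Longrightarrow> w j = w' j \<and> p j = p' j) \<Longrightarrow> row_feasible l r n w p = row_feasible l r n w' p'"
  unfolding row_feasible_def by (intro arg_cong2[where f = "(\<and>)"]) auto

text \<open>The instance speaks of columns with two rows each, the flat version of single rows;
  \<open>rows\<close> splits the latter into pairs belonging to the same column.\<close>

lemma feasible_solution_flat:
  assumes X: "\<And>c. c < cells \<Longrightarrow> X c = cell_list I x y z ! c"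
  shows "feasible_solution I x y z \<longleftrightarrow> flat_feasible X"
proof -
  have c: "row_start \<rho> + j < cells" if "\<rho> < 2 * kC + 2" "j < row_size \<rho>" for \<rho> j
    using row_start_le_cells[OF that(1)] that(2) by (simp add: row_start_Suc)
  have pos: "double_pos X i = x_ext I x i" if "i \<le> Suc kC" for i
    using that k_le_cells X[of "i - 1"] by (simp add: double_pos_def x_ext_def nth_cell_list(1))
  have bot: "row_feasible l r (num_b I i) (width_b I i) (y i) \<longleftrightarrow>
      row_feasible l r (row_size i) (\<lambda>j. cell_width (row_start i + j - 1)) (\<lambda>j. X (row_start i + j - 1))"
    if "i \<le> kC" for i l r
    unfolding num_rows(1)[OF that]
  proof (rule row_feasible_cong)
    fix j assume j: "1 \<le> j" "j \<le> num_b I i"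
    then have "j - 1 < num_b I i" by linarith
    moreover from j have "row_start i + (j - 1) < cells" using c[of i "j - 1"] that num_rows(1)[OF that] by simp
    ultimately show "width_b I i j = cell_width (row_start i + j - 1) \<and> y i j = X (row_start i + j - 1)"
      using nth_cell_list(2)[OF that, of "j - 1", where 'a = real] j X[of "row_start i + (j - 1)"]
        cell_width_eq[of "row_start i + (j - 1)"] by simp
  qed
  have top: "row_feasible l r (num_t I i) (width_t I i) (z i) \<longleftrightarrow>
      row_feasible l r (row_size (kC + 1 + i)) (\<lambda>j. cell_width (row_start (kC + 1 + i) + j - 1))
        (\<lambda>j. X (row_start (kC + 1 + i) + j - 1))"
    if "i \<le> kC" for i l r
    unfolding num_rows(2)[OF that]
  proof (rule row_feasible_cong)
    fix j assume j: "1 \<le> j" "j \<le> num_t I i"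
    let ?c = "row_start (kC + 1 + i) + (j - 1)"
    have "j - 1 < num_t I i" using j by linarith
    moreover have "?c < cells" using c[of "kC + 1 + i" "j - 1"] that num_rows(2)[OF that] j by simp
    ultimately show "width_t I i j = cell_width (row_start (kC + 1 + i) + j - 1) \<and> z i j = X (row_start (kC + 1 + i) + j - 1)"
      using nth_cell_list(3)[OF that, of "j - 1", where 'a = real] j X[of ?c] cell_width_eq[of ?c]
      by (simp del: add_Suc)
  qed
  have rows: "(\<forall>\<rho><2 * kC + 2. P \<rho>) \<longleftrightarrow> (\<forall>i\<le>kC. P i \<and> P (kC + 1 + i))" for P
  proof (intro iffI allI impI)
    fix \<rho> assume h: "\<forall>i\<le>kC. P i \<and> P (kC + 1 + i)" and \<rho>: "\<rho> < 2 * kC + 2"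
    show "P \<rho>"
      using h[rule_format, of \<rho>] h[rule_format, of "\<rho> - (kC + 1)"] \<rho> by (cases "\<rho> \<le> kC") auto
  qed auto
  have cols: "col i = i" "col (kC + 1 + i) = i" if "i \<le> kC" for i using that by (auto simp: col_def)
  show ?thesis
    unfolding feasible_solution_def flat_feasible_def rows
    using pos double_width_eq bot top cols by (auto simp del: add_Suc)
qed

end

section \<open>The program\<close>

abbreviation (input) "RST \<equiv> 15 :: nat"
abbreviation (input) "vk \<equiv> 31 :: nat"
abbreviation (input) "vn \<equiv> 32 :: nat"
abbreviation (input) "vR \<equiv> 33 :: nat"
abbreviation (input) "vC \<equiv> 34 :: nat"
abbreviation (input) "vI \<equiv> 35 :: nat"
abbreviation (input) "vRows \<equiv> 36 :: nat"
abbreviation (input) "OFF \<equiv> 42 :: nat"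
abbreviation (input) "RWD \<equiv> 43 :: nat"
abbreviation (input) "SH \<equiv> 44 :: nat"
abbreviation (input) "xAcc \<equiv> 50 :: nat"
abbreviation (input) "xSh \<equiv> 51 :: nat"
abbreviation (input) "for_prog v e c \<equiv> While (NLess (nvar v) e) (Seq c (nassign v (NAdd (nvar v) (NLit 1))))"

text \<open>The test takes \<open>4 + ntime e\<close> and the increment 6 time units.
  \<open>bound\<close> keeps the end of the range fixed although \<open>e\<close> is evaluated anew
  in every round.\<close>

lemma run_for:
  assumes "I a t s" "nats s v 0 = a" "a \<le> b"
    and bound: "\<And>i t s. I i t s \<Longrightarrow> nval e s = b"
    and body: "\<And>i t s. a \<le> i \<Longrightarrow> i < b \<Longrightarrow> I i t s \<Longrightarrow> nats s v 0 = i \<Longrightarrow>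
        run c s (t + (4 + ntime e)) (\<lambda>t' s'. nats s' v 0 = i \<and> I (Suc i) (t' + 6) (set_nat s' v 0 (Suc i)))"
    and exit: "\<And>t s. I b t s \<Longrightarrow> nats s v 0 = b \<Longrightarrow> Q (t + (4 + ntime e)) s"
  shows "run (for_prog v e c) s t Q"
proof (rule run_While[where I = "\<lambda>t s. \<exists>i\<ge>a. i \<le> b \<and> I i t s \<and> nats s v 0 = i" and \<mu> = "\<lambda>s. b - nats s v 0"], goal_cases)
  case 1
  show ?case using assms(1,2,3) by auto
next
  case (2 t1 s1)
  then obtain i where i: "a \<le> i" "I i t1 s1" "nats s1 v 0 = i" "i \<le> b" by auto
  then have "i < b" using 2(2) bound[OF i(2)] by simp
  show ?case
  proof (rule run_Seq, rule run_mono)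
    have "1 + btime (NLess (nvar v) e) = 4 + ntime e" by simp
    then show "run c s1 (t1 + (1 + btime (NLess (nvar v) e)))
        (\<lambda>t' s'. nats s' v 0 = i \<and> I (Suc i) (t' + 6) (set_nat s' v 0 (Suc i)))"
      using body[OF i(1) \<open>i < b\<close> i(2,3)] by (simp only:)
    fix t' s' assume h: "nats s' v 0 = i \<and> I (Suc i) (t' + 6) (set_nat s' v 0 (Suc i))"
    show "run (nassign v (NAdd (nvar v) (NLit 1))) s' t'
        (\<lambda>t' s'. (\<exists>i\<ge>a. i \<le> b \<and> I i t' s' \<and> nats s' v 0 = i) \<and> b - nats s' v 0 < b - nats s1 v 0)"
    proof (rule run_NStore)
      have "t' + (1 + ntime (NLit 0) + ntime (NAdd (nvar v) (NLit 1))) = t' + 6"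
        "set_nat s' v (nval (NLit 0) s') (nval (NAdd (nvar v) (NLit 1)) s') = set_nat s' v 0 (Suc i)"
        using h by simp_all
      then show "(\<exists>i\<ge>a. i \<le> b \<and> I i (t' + (1 + ntime (NLit 0) + ntime (NAdd (nvar v) (NLit 1))))
             (set_nat s' v (nval (NLit 0) s') (nval (NAdd (nvar v) (NLit 1)) s')) \<and>
            nats (set_nat s' v (nval (NLit 0) s') (nval (NAdd (nvar v) (NLit 1)) s')) v 0 = i) \<and>
          b - nats (set_nat s' v (nval (NLit 0) s') (nval (NAdd (nvar v) (NLit 1)) s')) v 0 < b - nats s1 v 0"
        using h i \<open>i < b\<close> by (auto simp only: intro!: exI[of _ "Suc i"]) (auto simp only: nats_set_nat fun_upd_same)
    qed
  qed
next
  case (3 t1 s1)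
  then obtain i where i: "I i t1 s1" "nats s1 v 0 = i" "i \<le> b" by auto
  then have "i = b" using 3(2) bound[OF i(1)] by simp
  then have "Q (t1 + (4 + ntime e)) s1" using exit[of t1 s1] i by (simp only:)
  moreover have "1 + btime (NLess (nvar v) e) = 4 + ntime e" by simp
  ultimately show ?case by (simp only:)
qed

definition rows_prog :: com where
  "rows_prog = seq [nassign vk (NLoad 0 (NLit 0)), nassign vRows (NAdd (NAdd (nvar vk) (nvar vk)) (NLit 2)),
     nassign vKB (NAdd (NAdd (nvar vk) (nvar vk)) (NLit 3)), NStore RST (NLit 0) (nvar vk), nassign vR (NLit 0),
     for_prog vR (nvar vRows) (NStore RST (NAdd (nvar vR) (NLit 1))
        (NAdd (NLoad RST (nvar vR)) (NLoad 0 (NAdd (nvar vR) (NLit 1))))),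
     nassign vn (NLoad RST (nvar vRows))]"

text \<open>The factors 4 and 3 are written as sums, as naturals cannot be multiplied. The parent
  table is filled from the parents, by storing \<open>v\<close> at \<open>2 * v\<close> and
  \<open>2 * v + 1\<close>, which avoids division.\<close>

definition data_prog :: com where
  "data_prog = seq [NStore PS (NLit 0) (NAdd (NLit 2) (nvar vn)), nassign vC (NLit 0),
     for_prog vC (nvar vn) (seq [nassign vI (NLoad 0 (NAdd (nvar vKB) (nvar vC))),
       NStore PS (NAdd (nvar vC) (NLit 1)) (NAdd (NLoad PS (nvar vC))
         (NAdd (NAdd (NAdd (nvar vI) (nvar vI)) (NAdd (nvar vI) (nvar vI))) (NLit 3)))]),
     nassign vM (NAdd (NAdd (NLoad PS (nvar vn)) (NLoad PS (nvar vn))) (NLoad PS (nvar vn))),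
     nassign vV (NLit 1),
     for_prog vV (nvar vM) (seq [NStore PAR (NAdd (nvar vV) (nvar vV)) (nvar vV),
       NStore PAR (NAdd (NAdd (nvar vV) (nvar vV)) (NLit 1)) (nvar vV)])]"

text \<open>\<open>vC\<close> is not reset between rows: the rows are consecutive, so each inner
  loop starts where the previous one ended.\<close>

definition offsets_prog :: com where
  "offsets_prog = seq [nassign vC (NLit 0),
     for_prog vC (nvar vk) (seq [RStore LO (nvar vC) (RLoad 0 (NLit 0)), RStore HI (nvar vC) (RLoad 0 (NLit 0))]),
     nassign vR (NLit 0), rassign xSh (RLit 0),
     for_prog vR (nvar vRows) (seq [RStore SH (nvar vR) (rvar xSh), rassign xAcc (RLit 0),
       for_prog vC (NLoad RST (NAdd (nvar vR) (NLit 1))) (seq [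
         RStore OFF (nvar vC) (RSub (rvar xAcc) (rvar xSh)),
         RStore LO (nvar vC) (RAdd (RLoad 0 (NLit 0)) (rvar xSh)),
         RStore HI (nvar vC) (RAdd (RLoad 0 (NLit 1)) (rvar xSh)),
         rassign xAcc (RAdd (rvar xAcc) (RLoad 0 (NAdd (NLit 2) (nvar vC))))]),
       RStore RWD (nvar vR) (rvar xAcc),
       rassign xSh (RAdd (rvar xSh) (RSub (RLoad 0 (NLit 1)) (RLoad 0 (NLit 0))))])]"

abbreviation (input) "DO \<equiv> 45 :: nat"
abbreviation (input) "LB \<equiv> 46 :: nat"
abbreviation (input) "RB \<equiv> 47 :: nat"
abbreviation (input) "U1 \<equiv> 48 :: nat"
abbreviation (input) "xS \<equiv> 52 :: nat"
abbreviation (input) "xRR \<equiv> 53 :: nat"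

text \<open>One stage with one job for each cell. \<open>OFF\<close> is not computed for double-row
  cells, so the dummies carry an arbitrary offset; their box is a point, so this only contributes a
  constant.\<close>

definition rows_table_prog :: com where
  "rows_table_prog = seq [nassign vC (NLit 0),
     for_prog vC (nvar vn) (seq [NStore JC (nvar vC) (nvar vC), NStore JE (nvar vC) (NAdd (nvar vC) (NLit 1)),
       RStore JO (nvar vC) (RLoad OFF (nvar vC)), RStore JA (nvar vC) (RLoad LO (nvar vC)),
       RStore JB (nvar vC) (RLoad HI (nvar vC))]),
     nassign vNS (nvar vn)]"

text \<open>The second run of the solver overwrites \<open>UU\<close>, but \<open>U\<close> is
  needed again for the output.\<close>

definition copy_prog :: com where
  "copy_prog = seq [nassign vC (NLit 0), for_prog vC (nvar vn) (RStore U1 (nvar vC) (RLoad UU (nvar vC)))]"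

text \<open>Within a round \<open>xS\<close> is first the least distance of the right edge of the
  double-row cell \<open>i\<close> (or the left wall) from the left wall, and then that of the next
  double-row cell.\<close>

definition double_prog :: com where
  "double_prog = seq [RStore DO (NLit 0) (RLit 0), nassign vI (NLit 0),
     for_prog vI (NAdd (nvar vk) (NLit 1)) (seq [
       Cond (NLess (NLit 0) (nvar vI))
         (rassign xS (RAdd (RLoad DO (nvar vI)) (RLoad 0 (NAdd (nvar vI) (NLit 1)))))
         (rassign xS (RLoad DO (nvar vI))),
       nassign vR (NAdd (NAdd (nvar vk) (NLit 1)) (nvar vI)),
       RStore LB (nvar vI) (RAdd (rvar xS) (RLoad SH (nvar vI))),
       RStore LB (nvar vR) (RAdd (rvar xS) (RLoad SH (nvar vR))),
       Cond (RLess (RLoad RWD (nvar vI)) (RLoad RWD (nvar vR)))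
         (rassign xS (RAdd (rvar xS) (RLoad RWD (nvar vR))))
         (rassign xS (RAdd (rvar xS) (RLoad RWD (nvar vI)))),
       RStore DO (NAdd (nvar vI) (NLit 1)) (rvar xS),
       RStore RB (nvar vI) (RAdd (RSub (rvar xS) (RLoad RWD (nvar vI))) (RLoad SH (nvar vI))),
       RStore RB (nvar vR) (RAdd (RSub (rvar xS) (RLoad RWD (nvar vR))) (RLoad SH (nvar vR)))]),
     rassign xRR (RSub (RLoad 0 (NLit 1)) (RLoad DO (NAdd (nvar vk) (NLit 1))))]"

section \<open>Preprocessing: prefix sums, tree tables, boxes and offsets\<close>

context program_input
begin

text \<open>A multiple of a prefix sum that is computed anyway; \<open>capacity_bound\<close> shows
  that it covers the slots of either run of the solver.\<close>

definition tree_size :: nat where "tree_size = 3 * data_start cells"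

definition input_kept :: "ram_state \<Rightarrow> bool" where
  "input_kept s \<longleftrightarrow> nats s 0 = nats start 0 \<and> reals s 0 = reals start 0"

lemma input_kept_unchanged: "unchanged A B s s' \<Longrightarrow> 0 \<notin> A \<Longrightarrow> 0 \<notin> B \<Longrightarrow> input_kept s \<Longrightarrow> input_kept s'"
  by (simp add: input_kept_def unchanged_def)

lemma input_kept_nats:
  assumes "input_kept s"
  shows "nats s 0 0 = kC" "nats s 0 (Suc \<rho>) = row_size \<rho>"
    "c < cells \<Longrightarrow> nats s 0 (2 * kC + 3 + c) = num_kinks (cell_data c)"
    "reals s 0 0 = x_min I" "reals s 0 (Suc 0) = x_max I" "reals s 0 (Suc (Suc c)) = cell_width c"
  using assms cell_kinks[of c] by (simp_all add: input_kept_def row_size_def cell_width_def)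

lemma sizes_le: "2 * kC + 2 \<le> 4 * cells" "cells \<le> tree_size" "12 * cells \<le> tree_size" "6 \<le> tree_size"
proof -
  have "1 \<le> kC" by (rule k)
  then show "2 * kC + 2 \<le> 4 * cells" using k_le_cells by simp
  have "(\<Sum>d<cells. 3) \<le> (\<Sum>d<cells. 4 * num_kinks (cell_data d) + 3)" by (rule sum_mono) simp
  then have "3 * cells \<le> (\<Sum>d<cells. 4 * num_kinks (cell_data d) + 3)" by simp
  then show "cells \<le> tree_size" "12 * cells \<le> tree_size" "6 \<le> tree_size" by (simp_all add: tree_size_def data_start_def)
qed

lemma run_rows:
  assumes inp: "input_kept s"
    and Q: "\<And>t' s'. t' \<le> t + 200 * cells + 100 \<Longrightarrow> unchanged {vk, vRows, vKB, RST, vR, vn} {} s s' \<Longrightarrow>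
      nats s' vk 0 = kC \<Longrightarrow> nats s' vRows 0 = 2 * kC + 2 \<Longrightarrow> nats s' vKB 0 = 2 * kC + 3 \<Longrightarrow>
      nats s' vn 0 = cells \<Longrightarrow> (\<And>\<rho>. \<rho> \<le> 2 * kC + 2 \<Longrightarrow> nats s' RST \<rho> = row_start \<rho>) \<Longrightarrow> Q t' s'"
  shows "run rows_prog s t Q"
  unfolding rows_prog_def seq.simps
  apply (intro run_Seq run_NStore)
  apply (rule run_for[where a = 0 and b = "2 * kC + 2" and I = "\<lambda>i t' s'. t' \<le> t + 50 + 40 * i \<and>
      unchanged {vk, vRows, vKB, RST, vR, vn} {} s s' \<and> nats s' vk 0 = kC \<and> nats s' vRows 0 = 2 * kC + 2 \<and>
      nats s' vKB 0 = 2 * kC + 3 \<and> (\<forall>\<rho>\<le>i. nats s' RST \<rho> = row_start \<rho>)"])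
  subgoal by (simp add: unchanged_set_nat input_kept_nats[OF inp])
  subgoal by simp
  subgoal by simp
  subgoal by simp
  subgoal for i t1 s1
    using input_kept_nats(2)[OF input_kept_unchanged[OF _ _ _ inp], of "{vk, vRows, vKB, RST, vR, vn}" "{}" s1 i]
    by (intro run_NStore) (auto simp: unchanged_set_nat le_Suc_eq row_start_Suc)
  subgoal for t1 s1
    using sizes_le(1) by (intro run_NStore Q) (auto simp: unchanged_set_nat cells_def)
  done

lemma run_data:
  assumes inp: "input_kept s" and vn: "nats s vn 0 = cells" and vKB: "nats s vKB 0 = 2 * kC + 3"
    and Q: "\<And>t' s'. t' \<le> t + 200 * tree_size + 100 \<Longrightarrow> unchanged {PS, vC, vI, vM, vV, PAR} {} s s' \<Longrightarrow>
      (\<And>c. c \<le> cells \<Longrightarrow> nats s' PS c = data_start c) \<Longrightarrow> nats s' vM 0 = tree_size \<Longrightarrow>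
      pars_ok tree_size s' \<Longrightarrow> Q t' s'"
  shows "run data_prog s t Q"
  unfolding data_prog_def seq.simps
  apply (intro run_Seq run_NStore)
  apply (rule run_for[where a = 0 and b = cells and I = "\<lambda>i t' s'. t' \<le> t + 20 + 60 * i \<and>
      unchanged {PS, vC, vI, vM, vV, PAR} {} s s' \<and> (\<forall>c\<le>i. nats s' PS c = data_start c)"])
  subgoal by (simp add: unchanged_set_nat vn data_start_def)
  subgoal by simp
  subgoal by simp
  subgoal using vn by (auto dest: unchanged_nats[where a = vn])
  subgoal for i t1 s1
    using input_kept_nats(3)[OF input_kept_unchanged[OF _ _ _ inp], of "{PS, vC, vI, vM, vV, PAR}" "{}" s1 i]
      unchanged_nats[of "{PS, vC, vI, vM, vV, PAR}" "{}" s s1 vKB] vKB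
    by (intro run_Seq run_NStore) (auto simp: unchanged_set_nat le_Suc_eq data_start_def)
  subgoal for t1 s1
    apply (intro run_Seq run_NStore)
    apply (rule run_for[where a = 1 and b = tree_size and I = "\<lambda>i t' s'. t' \<le> t + 60 + 60 * tree_size + 60 * i \<and>
      unchanged {PS, vC, vI, vM, vV, PAR} {} s s' \<and> (\<forall>c\<le>cells. nats s' PS c = data_start c) \<and> nats s' vM 0 = tree_size \<and>
      (\<forall>v. 1 < v \<and> v < 2 * i \<longrightarrow> nats s' PAR v = v div 2)"])
    subgoal using unchanged_nats[of "{PS, vC, vI, vM, vV, PAR}" "{}" s s1 vn] vn sizes_le(2)
      by (auto simp: unchanged_set_nat tree_size_def)
    subgoal by simp
    subgoal using sizes_le(4) by simp
    subgoal by simp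
    subgoal for i t2 s2
      apply (intro run_Seq run_NStore)
      apply (auto simp: unchanged_set_nat less_Suc_eq)
      done
    subgoal for t2 s2
      by (intro Q) (auto simp: pars_ok_def)
    done
  done

lemma run_offsets:
  assumes inp: "input_kept s" and vk: "nats s vk 0 = kC" and vRows: "nats s vRows 0 = 2 * kC + 2"
    and rst: "\<And>\<rho>. \<rho> \<le> 2 * kC + 2 \<Longrightarrow> nats s RST \<rho> = row_start \<rho>"
    and Q: "\<And>t' s'. t' \<le> t + 600 * cells + 100 \<Longrightarrow>
      unchanged {vC, vR} {LO, HI, SH, xSh, xAcc, OFF, RWD} s s' \<Longrightarrow>
      (\<And>\<rho>. \<rho> < 2 * kC + 2 \<Longrightarrow> reals s' SH \<rho> = shift \<rho> \<and> reals s' RWD \<rho> = row_width \<rho>) \<Longrightarrow>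
      (\<And>c. c < cells \<Longrightarrow> reals s' LO c = row_lo c \<and> reals s' HI c = row_hi c) \<Longrightarrow>
      (\<And>c. kC \<le> c \<Longrightarrow> c < cells \<Longrightarrow> reals s' OFF c = offset c) \<Longrightarrow> Q t' s'"
  shows "run offsets_prog s t Q"
proof -
  let ?N = "{vC, vR}" and ?B = "{LO, HI, SH, xSh, xAcc, OFF, RWD}"
  note inp' = input_kept_nats[OF input_kept_unchanged[OF _ _ _ inp], of ?N ?B]
  define boxes :: "nat \<Rightarrow> ram_state \<Rightarrow> bool" where "boxes n s' \<longleftrightarrow> (\<forall>c<n. reals s' LO c = row_lo c \<and> reals s' HI c = row_hi c) \<and>
      (\<forall>c. kC \<le> c \<and> c < n \<longrightarrow> reals s' OFF c = offset c)" for n s'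
  define rows :: "nat \<Rightarrow> ram_state \<Rightarrow> bool" where "rows n s' \<longleftrightarrow> (\<forall>\<rho><n. reals s' SH \<rho> = shift \<rho> \<and> reals s' RWD \<rho> = row_width \<rho>)" for n s'
  show ?thesis
  unfolding offsets_prog_def seq.simps
  apply (intro run_Seq run_NStore)
  apply (rule run_for[where a = 0 and b = kC and I = "\<lambda>i t' s'. t' \<le> t + 10 + 60 * i \<and> unchanged ?N ?B s s' \<and> boxes i s'"])
  subgoal by (simp add: unchanged_set_nat boxes_def)
  subgoal by simp
  subgoal by simp
  subgoal using vk by (auto dest: unchanged_nats[where a = vk])
  subgoal for i t1 s1
    using inp'(4)[of s1]
    by (intro run_Seq run_RStore)
      (auto simp: unchanged_set_nat unchanged_set_real less_Suc_eq boxes_def row_lo_def row_hi_def)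
  subgoal for t1 s1
    apply (intro run_Seq run_NStore run_RStore)
    \<comment> \<open>Processed cells enter the time bound through \<open>row_start i\<close> and
      processed rows through \<open>i\<close>, so the nested loops are seen to be linear.\<close>
    apply (rule run_for[where a = 0 and b = "2 * kC + 2" and I = "\<lambda>i t' s'. t' \<le> t + 50 + 60 * row_start i + 60 * i \<and>
       unchanged ?N ?B s s' \<and> nats s' vC 0 = row_start i \<and> reals s' xSh 0 = shift i \<and> boxes (row_start i) s' \<and> rows i s'"])
    subgoal by (simp add: unchanged_set_nat unchanged_set_real boxes_def rows_def shift_def)
    subgoal by simp
    subgoal by simp
    subgoal using vRows by (auto dest: unchanged_nats[where a = vRows])
    subgoal for \<rho> t2 s2
      apply (intro run_Seq run_RStore)
      apply (rule run_for[where a = "row_start \<rho>" and b = "row_start (Suc \<rho>)" and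
          I = "\<lambda>i t' s'. t' \<le> t + 60 + 60 * i + 60 * \<rho> + 15 \<and> nats s' vR 0 = \<rho> \<and>
         unchanged ?N ?B s s' \<and> reals s' xSh 0 = shift \<rho> \<and> boxes i s' \<and> rows \<rho> s' \<and> reals s' SH \<rho> = shift \<rho> \<and>
         reals s' xAcc 0 = (\<Sum>d\<in>{row_start \<rho>..<i}. cell_width d)"])
      subgoal by (simp add: unchanged_set_nat unchanged_set_real boxes_def rows_def)
      subgoal by simp
      subgoal by (simp add: row_start_Suc)
      subgoal for i t3 s3 using rst[of "Suc \<rho>"] by (auto dest: unchanged_nats[where a = RST])
      subgoal for c t3 s3
        using inp'(4,5)[of s3] inp'(6)[of s3 c] row_eqI[of \<rho> c] k_le_row_start[of \<rho>]
        by (intro run_Seq run_RStore)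
          (auto simp: unchanged_set_nat unchanged_set_real less_Suc_eq boxes_def rows_def row_lo_def row_hi_def offset_def)
      subgoal for t3 s3
        using inp'(4,5)[of s3]
        by (intro run_Seq run_RStore)
          (auto simp: unchanged_set_nat unchanged_set_real less_Suc_eq boxes_def rows_def row_width_def shift_Suc)
      done
    subgoal for t2 s2
      using sizes_le(1) cells_def by (intro Q) (auto simp: boxes_def rows_def)
    done
  done
qed

lemma run_rows_table:
  assumes vn: "nats s vn 0 = cells"
    and Q: "\<And>t' s'. t' \<le> t + 100 * cells + 100 \<Longrightarrow> unchanged {vC, JC, JE, vNS} {JO, JA, JB} s s' \<Longrightarrow>
      nats s' vNS 0 = cells \<Longrightarrow>
      (\<And>c. c < cells \<Longrightarrow> nats s' JC c = c \<and> nats s' JE c = Suc c \<and> reals s' JO c = reals s OFF c \<and>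
         reals s' JA c = reals s LO c \<and> reals s' JB c = reals s HI c) \<Longrightarrow> Q t' s'"
  shows "run rows_table_prog s t Q"
  unfolding rows_table_prog_def seq.simps
  apply (intro run_Seq run_NStore)
  apply (rule run_for[where a = 0 and b = cells and I = "\<lambda>i t' s'. t' \<le> t + 10 + 60 * i \<and>
      unchanged {vC, JC, JE, vNS} {JO, JA, JB} s s' \<and>
      (\<forall>c<i. nats s' JC c = c \<and> nats s' JE c = Suc c \<and> reals s' JO c = reals s OFF c \<and>
         reals s' JA c = reals s LO c \<and> reals s' JB c = reals s HI c)"])
  subgoal by (simp add: unchanged_set_nat)
  subgoal by simp
  subgoal by simp
  subgoal using vn by (auto dest: unchanged_nats[where a = vn])
  subgoal for i t1 s1
    using unchanged_reals[of "{vC, JC, JE, vNS}" "{JO, JA, JB}" s s1]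
    by (intro run_Seq run_NStore run_RStore) (auto simp: unchanged_set_nat unchanged_set_real less_Suc_eq)
  subgoal for t1 s1
    using unchanged_nats[of "{vC, JC, JE, vNS}" "{JO, JA, JB}" s s1 vn] vn
    by (intro run_NStore Q) (auto simp: unchanged_set_nat)
  done

lemma run_copy:
  assumes vn: "nats s vn 0 = cells"
    and Q: "\<And>t' s'. t' \<le> t + 100 * cells + 100 \<Longrightarrow> unchanged {vC} {U1} s s' \<Longrightarrow>
      (\<And>c. c < cells \<Longrightarrow> reals s' U1 c = reals s UU c) \<Longrightarrow> Q t' s'"
  shows "run copy_prog s t Q"
  unfolding copy_prog_def seq.simps
  apply (intro run_Seq run_NStore)
  apply (rule run_for[where a = 0 and b = cells and I = "\<lambda>i t' s'. t' \<le> t + 10 + 60 * i \<and>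
      unchanged {vC} {U1} s s' \<and> (\<forall>c<i. reals s' U1 c = reals s UU c)"])
  subgoal by (simp add: unchanged_set_nat)
  subgoal by simp
  subgoal by simp
  subgoal using vn by (auto dest: unchanged_nats[where a = vn])
  subgoal for i t1 s1
    using unchanged_reals[of "{vC}" "{U1}" s s1 UU]
    by (intro run_Seq run_NStore run_RStore) (auto simp: unchanged_set_nat unchanged_set_real less_Suc_eq)
  subgoal for t1 s1 by (intro Q) auto
  done

lemma run_double:
  assumes inp: "input_kept s" and vk: "nats s vk 0 = kC"
    and rows: "\<And>\<rho>. \<rho> < 2 * kC + 2 \<Longrightarrow> reals s SH \<rho> = shift \<rho> \<and> reals s RWD \<rho> = row_width \<rho>"
    and Q: "\<And>t' s'. t' \<le> t + 400 * cells + 300 \<Longrightarrow> unchanged {vI, vR} {DO, LB, RB, xS, xRR} s s' \<Longrightarrow>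
      (\<And>i. i \<le> Suc kC \<Longrightarrow> reals s' DO i = double_offset i) \<Longrightarrow> reals s' xRR 0 = max_shifted \<Longrightarrow>
      (\<And>\<rho>. \<rho> < 2 * kC + 2 \<Longrightarrow> reals s' LB \<rho> = left_bound \<rho> \<and> reals s' RB \<rho> = right_bound \<rho>) \<Longrightarrow> Q t' s'"
  shows "run double_prog s t Q"
proof -
  let ?N = "{vI, vR}" and ?B = "{DO, LB, RB, xS, xRR}"
  note inp' = input_kept_nats[OF input_kept_unchanged[OF _ _ _ inp], of ?N ?B]
  define bounds :: "nat \<Rightarrow> ram_state \<Rightarrow> bool" where "bounds n s' \<longleftrightarrow> (\<forall>i<n. reals s' LB i = left_bound i \<and> reals s' RB i = right_bound i \<and>
      reals s' LB (kC + 1 + i) = left_bound (kC + 1 + i) \<and> reals s' RB (kC + 1 + i) = right_bound (kC + 1 + i))" for n s'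
  show ?thesis
    unfolding double_prog_def seq.simps
    apply (intro run_Seq run_NStore run_RStore)
    apply (rule run_for[where a = 0 and b = "Suc kC" and I = "\<lambda>i t' s'. t' \<le> t + 20 + 200 * i \<and>
        unchanged ?N ?B s s' \<and> (\<forall>j\<le>i. reals s' DO j = double_offset j) \<and> bounds i s'"])
    subgoal by (simp add: unchanged_set_nat unchanged_set_real bounds_def)
    subgoal by simp
    subgoal by simp
    subgoal using vk by (auto dest: unchanged_nats[where a = vk])
    subgoal premises h for i t1 s1
    proof -
      have un: "unchanged ?N ?B s s1" and do_i: "reals s1 DO i = double_offset i" using h by auto
      have i: "i \<le> kC" using h by simp
      have vk1: "nats s1 vk 0 = kC" using unchanged_nats[OF un, of vk] vk by simp
      have sh: "reals s1 SH i = shift i" "reals s1 SH (Suc (kC + i)) = shift (Suc (kC + i))"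
        "reals s1 RWD i = row_width i" "reals s1 RWD (Suc (kC + i)) = row_width (Suc (kC + i))"
        using unchanged_reals[OF un] rows[of i] rows[of "Suc (kC + i)"] i by simp_all
      have cl: "col i = i" "col (Suc (kC + i)) = i" using i by (auto simp: col_def)
      have dw: "double_width i = (if 0 < i then reals s1 0 (Suc i) else 0)"
        using inp'(6)[OF un, of "i - 1"] by (cases i) (simp_all add: double_width_def)
      define x where "x = double_offset i + double_width i"
      show ?thesis
        apply (rule run_Seq, rule run_Cond;
            (rule run_RStore, intro run_Seq run_NStore run_RStore, rule run_Cond; (intro run_Seq run_RStore)))
           apply (use h(3) vk1 do_i sh dw cl i h(4) in
             \<open>auto simp: unchanged_set_nat unchanged_set_real bounds_def less_Suc_eq le_Suc_eq left_bound_def right_bound_def max_def\<close>)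
        done
    qed
    subgoal premises h for t1 s1
    proof -
      have un: "unchanged ?N ?B s s1" and d: "\<And>j. j \<le> Suc kC \<Longrightarrow> reals s1 DO j = double_offset j"
        and b: "bounds (Suc kC) s1" and t1: "t1 \<le> t + 20 + 200 * Suc kC" using h by auto
      have vk1: "nats s1 vk 0 = kC" using unchanged_nats[OF un, of vk] vk by simp
      show ?thesis
      proof (intro run_RStore Q)
        show "unchanged ?N ?B s (set_real s1 xRR (nval (NLit 0) s1)
            (rval (RSub (RLoad 0 (NLit 1)) (RLoad DO (NAdd (nvar vk) (NLit 1)))) s1))"
          by (rule unchanged_set_real[OF un]) simp
        fix \<rho> assume "\<rho> < 2 * kC + 2"
        then have "\<rho> < Suc kC \<or> (\<exists>i<Suc kC. \<rho> = kC + 1 + i)"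
          by (cases "\<rho> < Suc kC") (auto intro!: exI[of _ "\<rho> - Suc kC"])
        then show "reals (set_real s1 xRR (nval (NLit 0) s1)
            (rval (RSub (RLoad 0 (NLit 1)) (RLoad DO (NAdd (nvar vk) (NLit 1)))) s1)) LB \<rho> = left_bound \<rho> \<and>
          reals (set_real s1 xRR (nval (NLit 0) s1)
            (rval (RSub (RLoad 0 (NLit 1)) (RLoad DO (NAdd (nvar vk) (NLit 1)))) s1)) RB \<rho> = right_bound \<rho>"
          using b by (auto simp: bounds_def)
      qed (use d t1 vk1 inp'(5)[OF un] sizes_le(1) in \<open>simp_all add: max_shifted_def del: double_offset.simps\<close>)
    qed
    done
qed

end

section \<open>The job table of the second chain, and the output\<close>

abbreviation (input) "VX \<equiv> 49 :: nat"
abbreviation (input) "OUT \<equiv> 1 :: nat"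
abbreviation (input) "xl \<equiv> 54 :: nat"
abbreviation (input) "xr \<equiv> 55 :: nat"

type_synonym job = "nat \<times> real \<times> real \<times> real"

definition job_table :: "job list \<Rightarrow> ram_state \<Rightarrow> bool" where
  "job_table js s \<longleftrightarrow> nats s vJ 0 = length js \<and>
     (\<forall>j<length js. (nats s JC j, reals s JO j, reals s JA j, reals s JB j) = js ! j)"

definition append_prog :: "nexp \<Rightarrow> rexp \<Rightarrow> rexp \<Rightarrow> rexp \<Rightarrow> com" where
  "append_prog c x a b = seq [NStore JC (nvar vJ) c, RStore JO (nvar vJ) x, RStore JA (nvar vJ) a,
     RStore JB (nvar vJ) b, nassign vJ (NAdd (nvar vJ) (NLit 1))]"

definition row_jobs_prog :: "nexp \<Rightarrow> rexp \<Rightarrow> rexp \<Rightarrow> rexp \<Rightarrow> com" where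
  "row_jobs_prog \<rho> x a b = seq [nassign vR \<rho>, nassign vC (NLoad RST (nvar vR)),
     for_prog vC (NLoad RST (NAdd (nvar vR) (NLit 1))) (append_prog (nvar vC) x a b)]"

definition left_jobs_prog :: "nexp \<Rightarrow> com" where
  "left_jobs_prog \<rho> = row_jobs_prog \<rho> (RAdd (RLoad LB (nvar vR)) (RLoad OFF (nvar vC)))
     (RSub (RLoad U1 (nvar vC)) (RLoad LB (nvar vR))) (rvar xRR)"

definition right_jobs_prog :: "nexp \<Rightarrow> com" where
  "right_jobs_prog \<rho> = row_jobs_prog \<rho> (RAdd (RLoad RB (nvar vR)) (RLoad OFF (nvar vC)))
     (RLoad 0 (NLit 0)) (RSub (RLoad U1 (nvar vC)) (RLoad RB (nvar vR)))"

definition double_table_prog :: com where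
  "double_table_prog = seq [nassign vJ (NLit 0), nassign vI (NLit 0),
     for_prog vI (nvar vk) (seq [
       append_prog (nvar vI) (RLoad DO (NAdd (nvar vI) (NLit 1))) (RLoad 0 (NLit 0)) (rvar xRR),
       left_jobs_prog (NAdd (nvar vI) (NLit 1)),
       left_jobs_prog (NAdd (NAdd (nvar vk) (NLit 1)) (NAdd (nvar vI) (NLit 1))),
       right_jobs_prog (nvar vI), right_jobs_prog (NAdd (NAdd (nvar vk) (NLit 1)) (nvar vI)),
       NStore JE (nvar vI) (nvar vJ), RStore LO (nvar vI) (RLoad 0 (NLit 0)), RStore HI (nvar vI) (rvar xRR)]),
     nassign vNS (nvar vk)]"

definition clip_prog :: com where
  "clip_prog = Seq (Cond (RLess (rvar xr) (rvar xS)) (rassign xS (rvar xr)) Skip)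
     (Cond (RLess (rvar xS) (rvar xl)) (rassign xS (rvar xl)) Skip)"

definition output_prog :: com where
  "output_prog = seq [RStore VX (NLit 0) (RLoad 0 (NLit 0)), nassign vC (NLit 0),
     for_prog vC (nvar vk) (seq [RStore VX (NAdd (nvar vC) (NLit 1)) (RLoad UU (nvar vC)),
       RStore OUT (nvar vC) (RAdd (RLoad UU (nvar vC)) (RLoad DO (NAdd (nvar vC) (NLit 1))))]),
     RStore VX (NAdd (nvar vk) (NLit 1)) (rvar xRR), nassign vR (NLit 0),
     for_prog vR (nvar vRows) (seq [
       Cond (NLess (nvar vk) (nvar vR)) (nassign vI (NSub (nvar vR) (NAdd (nvar vk) (NLit 1)))) (nassign vI (nvar vR)),
       rassign xl (RAdd (RLoad VX (nvar vI)) (RLoad LB (nvar vR))),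
       rassign xr (RAdd (RLoad VX (NAdd (nvar vI) (NLit 1))) (RLoad RB (nvar vR))),
       for_prog vC (NLoad RST (NAdd (nvar vR) (NLit 1))) (seq [rassign xS (RLoad U1 (nvar vC)), clip_prog,
         RStore OUT (nvar vC) (RAdd (rvar xS) (RLoad OFF (nvar vC)))])])]"

abbreviation (input) "TN \<equiv> {vR, vC, vI, vJ, vNS, JC, JE} :: nat set"
abbreviation (input) "JN \<equiv> {vR, vC, vJ, JC} :: nat set"
abbreviation (input) "JR \<equiv> {JO, JA, JB} :: nat set"
abbreviation (input) "TR \<equiv> {JO, JA, JB, LO, HI} :: nat set"

text \<open>The four entries are stored one after the other, and \<open>indep\<close> guarantees
  that the expressions still to be evaluated do not see the earlier stores.\<close>

lemma run_append:
  assumes tab: "job_table js s"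
    and x: "(nval c s, rval x s, rval a s, rval b s) = job"
    and indep: "\<And>i y u v. rval x (set_nat s JC i y) = rval x s \<and>
      rval a (set_real (set_nat s JC i y) JO i u) = rval a s \<and>
      rval b (set_real (set_real (set_nat s JC i y) JO i u) JA i v) = rval b s"
    and Q: "\<And>t' s'. t' \<le> t + (40 + ntime c + rtime x + rtime a + rtime b) \<Longrightarrow>
      unchanged {JC, vJ} {JO, JA, JB} s s' \<Longrightarrow> job_table (js @ [job]) s' \<Longrightarrow> Q t' s'"
  shows "run (append_prog c x a b) s t Q"
  unfolding append_prog_def seq.simps
proof (intro run_Seq run_NStore run_RStore Q, goal_cases)
  case 1
  show ?case by simp
next
  case 2
  show ?case by (simp add: unchanged_set_nat unchanged_set_real)
next
  case 3
  show ?case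
    using tab indep by (auto simp: job_table_def nth_append less_Suc_eq x[symmetric])
qed

lemma run_clip:
  assumes "\<And>t'. t' \<le> t + 30 \<Longrightarrow> Q t' (set_real s xS 0 (clip (reals s xl 0) (reals s xr 0) (reals s xS 0)))"
  shows "run clip_prog s t Q"
proof -
  have triv: "set_real s a i (reals s a i) = s" for a i by (simp add: set_real_def)
  have fin: "Q t' s'" if "t' \<le> t + 30" "s' = set_real s xS 0 (clip (reals s xl 0) (reals s xr 0) (reals s xS 0))" for t' s'
    using assms that by simp
  have twice: "set_real (set_real s a i x) a i y = set_real s a i y" for a i x y by (simp add: set_real_def)
  show ?thesis
    unfolding clip_prog_def
    apply (rule run_Seq, rule run_Cond)
    subgoal by (rule run_RStore, rule run_Cond; (rule run_RStore | rule run_Skip), rule fin)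
      (auto simp: clip_def min_def max_def triv twice)
    subgoal by (rule run_Skip, rule run_Cond; (rule run_RStore | rule run_Skip), rule fin)
      (auto simp: clip_def min_def max_def triv twice)
    done
qed

context program_input
begin

text \<open>\<open>max (x + left_bound \<rho>) (U c)\<close> is \<open>left_bound \<rho>\<close>
  plus the maximum of \<open>x\<close> and \<open>U c - left_bound \<rho>\<close>. Each summand of
  \<open>left_cost\<close> is thus a clip followed by a shift, as a job requires.\<close>

definition left_jobs :: "(nat \<Rightarrow> real) \<Rightarrow> nat \<Rightarrow> job list" where
  "left_jobs U \<rho> = map (\<lambda>c. (c, left_bound \<rho> + offset c, U c - left_bound \<rho>, max_shifted))
     [row_start \<rho>..<row_start (Suc \<rho>)]"
text \<open>The same transformation for the minimum. If \<open>U c - right_bound \<rho>\<close> is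
  less than \<open>x_min I\<close>, the job differs from the summand of \<open>right_cost\<close> by
  a constant, which \<open>right_jobs_cost\<close> determines.\<close>

definition right_jobs :: "(nat \<Rightarrow> real) \<Rightarrow> nat \<Rightarrow> job list" where
  "right_jobs U \<rho> = map (\<lambda>c. (c, right_bound \<rho> + offset c, x_min I, U c - right_bound \<rho>))
     [row_start \<rho>..<row_start (Suc \<rho>)]"
text \<open>The cost of a row, as a function of the positions of the two double-row cells next to it, is the sum
  of a function of the left one and a function of the right one.\<close>

definition stage_jobs :: "(nat \<Rightarrow> real) \<Rightarrow> nat \<Rightarrow> job list" where
  "stage_jobs U \<sigma> = (\<sigma>, double_offset (Suc \<sigma>), x_min I, max_shifted) # left_jobs U (Suc \<sigma>) @
     left_jobs U (kC + 1 + Suc \<sigma>) @ right_jobs U \<sigma> @ right_jobs U (kC + 1 + \<sigma>)"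

definition bounds_known :: "(nat \<Rightarrow> real) \<Rightarrow> ram_state \<Rightarrow> bool" where
  "bounds_known U s \<longleftrightarrow> input_kept s \<and> nats s vk 0 = kC \<and> nats s vRows 0 = 2 * kC + 2 \<and> reals s xRR 0 = max_shifted \<and>
     (\<forall>\<rho>\<le>2 * kC + 2. nats s RST \<rho> = row_start \<rho>) \<and>
     (\<forall>\<rho><2 * kC + 2. reals s LB \<rho> = left_bound \<rho> \<and> reals s RB \<rho> = right_bound \<rho>) \<and>
     (\<forall>i\<le>Suc kC. reals s DO i = double_offset i) \<and>
     (\<forall>c. kC \<le> c \<and> c < cells \<longrightarrow> reals s OFF c = offset c \<and> reals s U1 c = U c)"

lemma bounds_known_unchanged:
  assumes "unchanged A B s s'" "bounds_known U s"
    and "0 \<notin> A" "vk \<notin> A" "vRows \<notin> A" "RST \<notin> A" "0 \<notin> B" "xRR \<notin> B" "LB \<notin> B" "RB \<notin> B" "DO \<notin> B" "OFF \<notin> B" "U1 \<notin> B"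
  shows "bounds_known U s'"
  using assms by (simp add: bounds_known_def input_kept_def unchanged_def)

lemma run_row_jobs:
  assumes bk: "bounds_known U s" and tab: "job_table js s" and \<rho>: "nval e s = \<rho>" "\<rho> < 2 * kC + 2"
    and jobs: "\<And>s' c. bounds_known U s' \<Longrightarrow> nats s' vR 0 = \<rho> \<Longrightarrow> nats s' vC 0 = c \<Longrightarrow> c \<in> {row_start \<rho>..<row_start (Suc \<rho>)} \<Longrightarrow>
        (c, rval x s', rval a s', rval b s') = job c"
    and time: "ntime e + rtime x + rtime a + rtime b \<le> 40"
    and Q: "\<And>t' s'. t' \<le> t + 200 * row_size \<rho> + 100 \<Longrightarrow> unchanged JN JR s s' \<Longrightarrow> bounds_known U s' \<Longrightarrow>
        job_table (js @ map job [row_start \<rho>..<row_start (Suc \<rho>)]) s' \<Longrightarrow> Q t' s'"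
  shows "run (row_jobs_prog e x a b) s t Q"
  unfolding row_jobs_prog_def seq.simps
proof (intro run_Seq run_NStore, rule run_for[where a = "row_start \<rho>" and b = "row_start (Suc \<rho>)" and
    I = "\<lambda>i t' s'. t' \<le> t + 60 + 200 * (i - row_start \<rho>) \<and> unchanged JN JR s s' \<and> nats s' vR 0 = \<rho> \<and>
      job_table (js @ map job [row_start \<rho>..<i]) s'"], goal_cases)
  case 1
  show ?case using time \<rho>(1) tab by (simp add: unchanged_set_nat job_table_def)
next
  case 2
  show ?case using bk \<rho> by (simp add: bounds_known_def)
next
  case 3
  show ?case by (simp add: row_start_Suc)
next
  case (4 i t1 s1)
  have "bounds_known U s1" by (rule bounds_known_unchanged[of JN JR s]) (use 4 bk in auto)
  then show ?case using 4 \<rho> by (simp add: bounds_known_def)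
next
  case (5 c t1 s1)
  then have un: "unchanged JN JR s s1" and vR: "nats s1 vR 0 = \<rho>" and t1: "t1 \<le> t + 60 + 200 * (c - row_start \<rho>)"
    and tab1: "job_table (js @ map job [row_start \<rho>..<c]) s1" by auto
  have bk1: "bounds_known U s'" if "unchanged JN JR s s'" for s' by (rule bounds_known_unchanged[OF that bk]) auto
  have j: "(c, rval x s', rval a s', rval b s') = job c"
    if "unchanged JN JR s s'" "nats s' vR 0 = \<rho>" "nats s' vC 0 = c" for s'
    by (rule jobs[OF bk1[OF that(1)] that(2,3)]) (use 5 in simp)
  note un' = unchanged_set_nat[OF un] unchanged_set_real[OF unchanged_set_nat[OF un]]
    unchanged_set_real[OF unchanged_set_real[OF unchanged_set_nat[OF un]]]
  show ?case
  proof (rule run_append[OF tab1, where job = "job c"], goal_cases)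
    case 1
    show ?case using j[OF un vR 5(4)] 5(4) by simp
  next
    case (2 i y u v)
    have c0: "nats s1 vC 0 = c" by (rule 5(4))
    show ?case
      using j[OF un vR c0] j[OF un'(1)[of JC i y]] j[OF un'(2)[of JC JO i y i u]] j[OF un'(3)[of JC JO JA i y i u i v]] vR c0
      by (simp add: prod_eq_iff)
  next
    case (3 t2 s2)
    have u2: "unchanged JN JR s s2" by (rule unchanged_trans[OF un 3(2)]) auto
    have "nats s2 vC 0 = c" "nats s2 vR 0 = \<rho>"
      using unchanged_nats[OF 3(2)] 5(4) vR by simp_all
    then show ?case
      using u2 3(1,3) t1 time 5(1) by (simp add: unchanged_set_nat job_table_def Suc_diff_le)
  qed
next
  case (6 t1 s1)
  then show ?case
    by (intro Q) (auto simp: row_start_Suc intro: bounds_known_unchanged[OF _ bk])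
qed

lemma run_left_jobs:
  assumes bk: "bounds_known U s" and tab: "job_table js s" and \<rho>: "nval e s = \<rho>" "\<rho> < 2 * kC + 2" and time: "ntime e \<le> 10"
    and Q: "\<And>t' s'. t' \<le> t + 200 * row_size \<rho> + 100 \<Longrightarrow> unchanged JN JR s s' \<Longrightarrow> bounds_known U s' \<Longrightarrow>
        job_table (js @ left_jobs U \<rho>) s' \<Longrightarrow> Q t' s'"
  shows "run (left_jobs_prog e) s t Q"
  unfolding left_jobs_prog_def
proof (rule run_row_jobs[OF bk tab \<rho>, where job = "\<lambda>c. (c, left_bound \<rho> + offset c, U c - left_bound \<rho>, max_shifted)"], goal_cases)
  case (1 s' c)
  have "kC \<le> c" "c < cells" using 1(4) k_le_row_start[of \<rho>] row_start_le_cells[OF \<rho>(2)] by auto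
  then show ?case using 1(1-3) \<rho>(2) by (simp add: bounds_known_def)
next
  case 2 show ?case using time by simp
next
  case (3 t' s') then show ?case by (intro Q) (simp_all add: left_jobs_def)
qed

lemma run_right_jobs:
  assumes bk: "bounds_known U s" and tab: "job_table js s" and \<rho>: "nval e s = \<rho>" "\<rho> < 2 * kC + 2" and time: "ntime e \<le> 10"
    and Q: "\<And>t' s'. t' \<le> t + 200 * row_size \<rho> + 100 \<Longrightarrow> unchanged JN JR s s' \<Longrightarrow> bounds_known U s' \<Longrightarrow>
        job_table (js @ right_jobs U \<rho>) s' \<Longrightarrow> Q t' s'"
  shows "run (right_jobs_prog e) s t Q"
  unfolding right_jobs_prog_def
proof (rule run_row_jobs[OF bk tab \<rho>, where job = "\<lambda>c. (c, right_bound \<rho> + offset c, x_min I, U c - right_bound \<rho>)"], goal_cases)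
  case (1 s' c)
  have "kC \<le> c" "c < cells" using 1(4) k_le_row_start[of \<rho>] row_start_le_cells[OF \<rho>(2)] by auto
  then show ?case using 1(1-3) \<rho>(2) by (simp add: bounds_known_def input_kept_nats(4))
next
  case 2 show ?case using time by simp
next
  case (3 t' s') then show ?case by (intro Q) (simp_all add: right_jobs_def)
qed

text \<open>A row has at most one double-row cell on each side, so it is counted at most
  twice.\<close>

lemma sum_neighbour_rows:
  fixes g :: "nat \<Rightarrow> real"
  assumes "\<And>\<rho>. 0 \<le> g \<rho>"
  shows "(\<Sum>\<sigma><kC. g (Suc \<sigma>) + g (kC + 1 + Suc \<sigma>) + g \<sigma> + g (kC + 1 + \<sigma>)) \<le> 2 * (\<Sum>\<rho><2 * kC + 2. g \<rho>)"
proof -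
  define h where "h i = g i + g (kC + 1 + i)" for i
  have "(\<Sum>\<sigma><kC. h (Suc \<sigma>)) \<le> (\<Sum>i<Suc kC. h i)"
    unfolding sum.lessThan_Suc_shift using assms by (simp add: h_def)
  moreover have "(\<Sum>\<sigma><kC. h \<sigma>) \<le> (\<Sum>i<Suc kC. h i)" using assms by (simp add: h_def)
  moreover have "(\<Sum>\<sigma><kC. g (Suc \<sigma>) + g (kC + 1 + Suc \<sigma>) + g \<sigma> + g (kC + 1 + \<sigma>)) = (\<Sum>\<sigma><kC. h (Suc \<sigma>)) + (\<Sum>\<sigma><kC. h \<sigma>)"
    unfolding sum.distrib[symmetric] by (simp add: h_def add.assoc)
  ultimately show ?thesis unfolding sum_two_rows h_def[symmetric] by simp
qed

text \<open>A row is traversed once for each neighbouring double-row cell, so by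
  \<open>sum_neighbour_rows\<close> the nested loops take linear time.\<close>

lemma run_double_table:
  assumes bk: "bounds_known U s"
    and Q: "\<And>t' s'. t' \<le> t + 2000 * cells + 100 \<Longrightarrow> unchanged TN TR s s' \<Longrightarrow> bounds_known U s' \<Longrightarrow>
        job_table (concat (map (stage_jobs U) [0..<kC])) s' \<Longrightarrow> nats s' vNS 0 = kC \<Longrightarrow>
        (\<And>\<sigma>. \<sigma> < kC \<Longrightarrow> nats s' JE \<sigma> = length (concat (map (stage_jobs U) [0..<Suc \<sigma>])) \<and>
           reals s' LO \<sigma> = x_min I \<and> reals s' HI \<sigma> = max_shifted) \<Longrightarrow> Q t' s'"
  shows "run double_table_prog s t Q"
proof -
  define js where "js \<sigma> = concat (map (stage_jobs U) [0..<\<sigma>])" for \<sigma>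
  have js_Suc: "js (Suc \<sigma>) = (((js \<sigma> @ [(\<sigma>, double_offset (Suc \<sigma>), x_min I, max_shifted)]) @ left_jobs U (Suc \<sigma>)) @
     left_jobs U (kC + 1 + Suc \<sigma>)) @ right_jobs U \<sigma> @ right_jobs U (kC + 1 + \<sigma>)" for \<sigma>
    by (simp add: js_def stage_jobs_def)
  define ends :: "nat \<Rightarrow> ram_state \<Rightarrow> bool" where "ends n s' \<longleftrightarrow> (\<forall>\<sigma><n. nats s' JE \<sigma> = length (js (Suc \<sigma>)) \<and>
      reals s' LO \<sigma> = x_min I \<and> reals s' HI \<sigma> = max_shifted)" for n s'
  have ends_unchanged: "ends n s''" if "unchanged JN JR s' s''" "ends n s'" for n s' s''
    using that unchanged_nats[OF that(1), of JE] unchanged_reals[OF that(1), of LO] unchanged_reals[OF that(1), of HI]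
    by (simp add: ends_def)
  define size4 where "size4 \<sigma> = row_size (Suc \<sigma>) + row_size (kC + 1 + Suc \<sigma>) + row_size \<sigma> + row_size (kC + 1 + \<sigma>)" for \<sigma>
  have total: "(\<Sum>\<sigma><kC. size4 \<sigma>) \<le> 2 * cells"
  proof -
    have "(\<Sum>\<sigma><kC. real (size4 \<sigma>)) \<le> 2 * (\<Sum>\<rho><2 * kC + 2. real (row_size \<rho>))"
      unfolding size4_def of_nat_add by (rule sum_neighbour_rows) simp
    also have "(\<Sum>\<rho><2 * kC + 2. real (row_size \<rho>)) \<le> real cells"
      by (simp add: cells_def row_start_def)
    finally have "real (\<Sum>\<sigma><kC. size4 \<sigma>) \<le> real (2 * cells)" by simp
    then show ?thesis by (simp only: of_nat_le_iff)
  qed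
  let ?stores = "seq [NStore JE (nvar vI) (nvar vJ), RStore LO (nvar vI) (RLoad 0 (NLit 0)), RStore HI (nvar vI) (rvar xRR)]"
  let ?I = "\<lambda>i t' s'. t' \<le> t + 20 + 1000 * i + 200 * (\<Sum>\<sigma><i. size4 \<sigma>) \<and> unchanged TN TR s s' \<and> bounds_known U s' \<and>
      job_table (js i) s' \<and> ends i s'"
  have body: "run (seq [append_prog (nvar vI) (RLoad DO (NAdd (nvar vI) (NLit 1))) (RLoad 0 (NLit 0)) (rvar xRR),
       left_jobs_prog (NAdd (nvar vI) (NLit 1)),
       left_jobs_prog (NAdd (NAdd (nvar vk) (NLit 1)) (NAdd (nvar vI) (NLit 1))),
       right_jobs_prog (nvar vI), right_jobs_prog (NAdd (NAdd (nvar vk) (NLit 1)) (nvar vI)),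
       NStore JE (nvar vI) (nvar vJ), RStore LO (nvar vI) (RLoad 0 (NLit 0)), RStore HI (nvar vI) (rvar xRR)]) s1 t1'
      (\<lambda>t' s'. nats s' vI 0 = \<sigma> \<and> ?I (Suc \<sigma>) (t' + 6) (set_nat s' vI 0 (Suc \<sigma>)))"
    if \<sigma>: "\<sigma> < kC" and t1: "t1' \<le> t1 + 10" "t1 \<le> t + 20 + 1000 * \<sigma> + 200 * (\<Sum>\<sigma><\<sigma>. size4 \<sigma>)"
      and un1: "unchanged TN TR s s1" and bk1: "bounds_known U s1" and tab1: "job_table (js \<sigma>) s1"
      and en1: "ends \<sigma> s1" and vI1: "nats s1 vI 0 = \<sigma>" for \<sigma> t1 t1' s1
    unfolding seq.simps
  proof (rule run_Seq, rule run_append[OF tab1, where job = "(\<sigma>, double_offset (Suc \<sigma>), x_min I, max_shifted)"])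
    show "(nval (nvar vI) s1, rval (RLoad DO (NAdd (nvar vI) (NLit 1))) s1, rval (RLoad 0 (NLit 0)) s1, rval (rvar xRR) s1)
        = (\<sigma>, double_offset (Suc \<sigma>), x_min I, max_shifted)"
      using bk1 vI1 \<sigma> by (simp add: bounds_known_def input_kept_nats(4) del: double_offset.simps)
    fix t2 s2
    assume t2: "t2 \<le> t1' + (40 + ntime (nvar vI) + rtime (RLoad DO (NAdd (nvar vI) (NLit 1))) + rtime (RLoad 0 (NLit 0)) + rtime (rvar xRR))"
      and un2: "unchanged {JC, vJ} {JO, JA, JB} s1 s2" and tab2: "job_table (js \<sigma> @ [(\<sigma>, double_offset (Suc \<sigma>), x_min I, max_shifted)]) s2"
    have un12: "unchanged JN JR s1 s2" by (rule unchanged_trans[OF un2 unchanged_refl]) auto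
    have bk2: "bounds_known U s2" by (rule bounds_known_unchanged[OF un2 bk1]) auto
    have vI2: "nats s2 vI 0 = \<sigma>" using unchanged_nats[OF un12, of vI] vI1 by simp
    have vk: "nats s' vk 0 = kC" if "bounds_known U s'" for s' using that by (simp add: bounds_known_def)
    show "run (Seq (left_jobs_prog (NAdd (nvar vI) (NLit 1)))
         (Seq (left_jobs_prog (NAdd (NAdd (nvar vk) (NLit 1)) (NAdd (nvar vI) (NLit 1))))
         (Seq (right_jobs_prog (nvar vI)) (Seq (right_jobs_prog (NAdd (NAdd (nvar vk) (NLit 1)) (nvar vI)))
         (Seq (NStore JE (nvar vI) (nvar vJ)) (Seq (RStore LO (nvar vI) (RLoad 0 (NLit 0))) (RStore HI (nvar vI) (rvar xRR)))))))) s2 t2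
       (\<lambda>t' s'. nats s' vI 0 = \<sigma> \<and> ?I (Suc \<sigma>) (t' + 6) (set_nat s' vI 0 (Suc \<sigma>)))"
    proof (rule run_Seq, rule run_left_jobs[OF bk2 tab2, where \<rho> = "Suc \<sigma>"], goal_cases)
      case 1 show ?case using vI2 by simp
    next
      case 2 show ?case using \<sigma> by simp
    next
      case 3 show ?case by simp
    next
      case (4 t3 s3)
      note h3 = 4
      have vI3: "nats s3 vI 0 = \<sigma>" using unchanged_nats[OF h3(2), of vI] vI2 by simp
      have un13: "unchanged JN JR s1 s3" by (rule unchanged_trans[OF un12 h3(2)]) auto
      show ?case
      proof (rule run_Seq, rule run_left_jobs[OF h3(3,4), where \<rho> = "kC + 1 + Suc \<sigma>"], goal_cases)
        case 1 show ?case using vI3 vk[OF h3(3)] by simp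
      next
        case 2 show ?case using \<sigma> by simp
      next
        case 3 show ?case by simp
      next
        case (4 t4 s4)
        note h4 = 4
        have vI4: "nats s4 vI 0 = \<sigma>" using unchanged_nats[OF h4(2), of vI] vI3 by simp
        have un14: "unchanged JN JR s1 s4" by (rule unchanged_trans[OF un13 h4(2)]) auto
        show ?case
        proof (rule run_Seq, rule run_right_jobs[OF h4(3,4), where \<rho> = \<sigma>], goal_cases)
          case 1 show ?case using vI4 by simp
        next
          case 2 show ?case using \<sigma> by simp
        next
          case 3 show ?case by simp
        next
          case (4 t5 s5)
          note h5 = 4
          have vI5: "nats s5 vI 0 = \<sigma>" using unchanged_nats[OF h5(2), of vI] vI4 by simp
          have un15: "unchanged JN JR s1 s5" by (rule unchanged_trans[OF un14 h5(2)]) auto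
          show ?case
          proof (rule run_Seq, rule run_right_jobs[OF h5(3,4), where \<rho> = "kC + 1 + \<sigma>"], goal_cases)
            case 1 show ?case using vI5 vk[OF h5(3)] by simp
          next
            case 2 show ?case using \<sigma> by simp
          next
            case 3 show ?case by simp
          next
            case (4 t6 s6)
            note h6 = 4
            have vI6: "nats s6 vI 0 = \<sigma>" using unchanged_nats[OF h6(2), of vI] vI5 by simp
            have un16: "unchanged JN JR s1 s6" by (rule unchanged_trans[OF un15 h6(2)]) auto
            have tab6: "job_table (js (Suc \<sigma>)) s6" using h6(4) by (simp add: js_Suc)
            have len: "nats s6 vJ 0 = length (js (Suc \<sigma>))" using tab6 by (simp add: job_table_def)
            have en6: "ends \<sigma> s6" by (rule ends_unchanged[OF un16 en1])
            have r6: "reals s6 0 0 = x_min I" "reals s6 xRR 0 = max_shifted"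
              using h6(3) by (auto simp: bounds_known_def input_kept_nats(4))
            define s7 where "s7 = set_nat (set_real (set_real (set_nat s6 JE \<sigma> (length (js (Suc \<sigma>)))) LO \<sigma> (x_min I))
              HI \<sigma> max_shifted) vI 0 (Suc \<sigma>)"
            have un67: "unchanged {JE, vI} {LO, HI} s6 s7" unfolding s7_def
              by (intro unchanged_set_nat unchanged_set_real) auto
            have "unchanged TN TR s s6" by (rule unchanged_trans[OF un1 un16]) auto
            then have u7: "unchanged TN TR s s7" by (rule unchanged_trans[OF _ un67]) auto
            have bk7: "bounds_known U s7" by (rule bounds_known_unchanged[OF un67 h6(3)]) auto
            have tab7: "job_table (js (Suc \<sigma>)) s7" using tab6 by (simp add: job_table_def s7_def)
            have en7: "ends (Suc \<sigma>) s7" using en6 by (auto simp: ends_def s7_def less_Suc_eq)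
            have "t6 + 60 \<le> t + 20 + 1000 * Suc \<sigma> + 200 * (\<Sum>\<sigma><Suc \<sigma>. size4 \<sigma>)"
              using t1 t2 h3(1) h4(1) h5(1) h6(1) by (simp add: size4_def)
            then have fin: "?I (Suc \<sigma>) t7 s7'" if "s7' = s7" "t7 \<le> t6 + 60" for t7 s7'
              using that u7 bk7 tab7 en7 by auto
            show ?case
              by (intro run_Seq run_NStore run_RStore, rule conjI, simp add: vI6, rule fin)
                (simp_all add: vI6 len r6 s7_def)
          qed
        qed
      qed
    qed
  qed simp
  show ?thesis
    unfolding double_table_prog_def seq.simps(3)[of _ "for_prog vI e c" for e c] seq.simps(2)
      seq.simps(3)[of _ "nassign vI (NLit 0)"] seq.simps(3)[of _ "nassign vNS (nvar vk)"]
  proof (intro run_Seq run_NStore, rule run_for[where a = 0 and b = kC and I = ?I], goal_cases)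
    case 1
    have un: "unchanged TN TR s (set_nat (set_nat s vJ 0 0) vI 0 0)" by (simp add: unchanged_set_nat)
    have "bounds_known U (set_nat (set_nat s vJ 0 0) vI 0 0)" by (rule bounds_known_unchanged[OF un bk]) auto
    then show ?case using un by (simp add: js_def ends_def job_table_def)
  next
    case 2 show ?case by simp
  next
    case 3 show ?case by simp
  next
    case (4 i t1 s1) then show ?case by (simp add: bounds_known_def)
  next
    case (5 \<sigma> t1 s1)
    show ?case by (rule body[where ?t1.0 = t1]) (use 5 in simp_all)
  next
    case (6 t1 s1)
    then have un1: "unchanged TN TR s s1" and bk1: "bounds_known U s1" and tab1: "job_table (js kC) s1"
      and en1: "ends kC s1" and t1: "t1 \<le> t + 20 + 1000 * kC + 200 * (\<Sum>\<sigma><kC. size4 \<sigma>)" by auto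
    define s2 where "s2 = set_nat s1 vNS 0 kC"
    have un2: "unchanged {vNS} {} s1 s2" unfolding s2_def by (intro unchanged_set_nat) auto
    have "Q t2 s2" if "t2 \<le> t1 + 20" for t2
    proof (rule Q)
      show "t2 \<le> t + 2000 * cells + 100" using that t1 total k_le_cells by simp
      show "unchanged TN TR s s2" by (rule unchanged_trans[OF un1 un2]) auto
      show "bounds_known U s2" by (rule bounds_known_unchanged[OF un2 bk1]) auto
      show "job_table (concat (map (stage_jobs U) [0..<kC])) s2" using tab1 by (simp add: job_table_def s2_def js_def)
      show "nats s2 vNS 0 = kC" by (simp add: s2_def)
      show "nats s2 JE \<sigma> = length (concat (map (stage_jobs U) [0..<Suc \<sigma>])) \<and>
           reals s2 LO \<sigma> = x_min I \<and> reals s2 HI \<sigma> = max_shifted" if "\<sigma> < kC" for \<sigma>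
        using en1 that unfolding ends_def js_def by (simp add: s2_def)
    qed
    then show ?case using bk1 by (intro run_NStore) (simp add: s2_def bounds_known_def)
  qed
qed

lemma run_output:
  assumes bk: "bounds_known U s" and uu: "\<And>\<sigma>. \<sigma> < kC \<Longrightarrow> reals s UU \<sigma> = v \<sigma>"
    and Q: "\<And>t' s'. t' \<le> t + 1000 * cells + 200 \<Longrightarrow> (\<And>c. c < cells \<Longrightarrow> reals s' OUT c = assemble v U c) \<Longrightarrow> Q t' s'"
  shows "run output_prog s t Q"
proof -
  let ?N = "{vC, vR, vI}" and ?B = "{VX, OUT, xl, xr, xS}"
  have bk': "bounds_known U s'" if "unchanged ?N ?B s s'" for s' by (rule bounds_known_unchanged[OF that bk]) auto
  have L: "reals s' 0 0 = x_min I" if "bounds_known U s'" for s'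
    using that by (simp add: bounds_known_def input_kept_nats(4))
  let ?rows = "for_prog vR (nvar vRows) (seq [
       Cond (NLess (nvar vk) (nvar vR)) (nassign vI (NSub (nvar vR) (NAdd (nvar vk) (NLit 1)))) (nassign vI (nvar vR)),
       rassign xl (RAdd (RLoad VX (nvar vI)) (RLoad LB (nvar vR))),
       rassign xr (RAdd (RLoad VX (NAdd (nvar vI) (NLit 1))) (RLoad RB (nvar vR))),
       for_prog vC (NLoad RST (NAdd (nvar vR) (NLit 1))) (seq [rassign xS (RLoad U1 (nvar vC)), clip_prog,
         RStore OUT (nvar vC) (RAdd (rvar xS) (RLoad OFF (nvar vC)))])])"
  define outs :: "nat \<Rightarrow> ram_state \<Rightarrow> bool" where "outs n s' \<longleftrightarrow> (\<forall>c<n. reals s' OUT c = assemble v U c)" for n s'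
  define exts :: "ram_state \<Rightarrow> bool" where "exts s' \<longleftrightarrow> (\<forall>i\<le>Suc kC. reals s' VX i = ext v i)" for s'
  have row_body: "run (for_prog vC (NLoad RST (NAdd (nvar vR) (NLit 1))) (seq [rassign xS (RLoad U1 (nvar vC)), clip_prog,
         RStore OUT (nvar vC) (RAdd (rvar xS) (RLoad OFF (nvar vC)))])) s1 t1
      (\<lambda>t' s'. t' \<le> t1 + 10 + 100 * row_size \<rho> \<and> unchanged ?N ?B s s' \<and> nats s' vR 0 = \<rho> \<and>
         nats s' vC 0 = row_start (Suc \<rho>) \<and> outs (row_start (Suc \<rho>)) s' \<and> exts s')"
    if un: "unchanged ?N ?B s s1" and \<rho>: "nats s1 vR 0 = \<rho>" "\<rho> < 2 * kC + 2" and vC: "nats s1 vC 0 = row_start \<rho>"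
      and o1: "outs (row_start \<rho>) s1" and e1: "exts s1"
      and lr: "reals s1 xl 0 = ext v (col \<rho>) + left_bound \<rho>" "reals s1 xr 0 = ext v (Suc (col \<rho>)) + right_bound \<rho>"
    for \<rho> s1 t1
  proof (rule run_for[where a = "row_start \<rho>" and b = "row_start (Suc \<rho>)" and
        I = "\<lambda>c t' s'. t' \<le> t1 + 100 * (c - row_start \<rho>) \<and> unchanged ?N ?B s s' \<and> nats s' vR 0 = \<rho> \<and>
         outs c s' \<and> exts s' \<and> reals s' xl 0 = ext v (col \<rho>) + left_bound \<rho> \<and>
         reals s' xr 0 = ext v (Suc (col \<rho>)) + right_bound \<rho>"], goal_cases)
    case 1 show ?case using that by simp
  next
    case 2 show ?case by (rule vC)
  next
    case 3 show ?case by (simp add: row_start_Suc)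
  next
    case (4 i t2 s2)
    then have "bounds_known U s2" using bk' by blast
    then show ?case using 4 \<rho>(2) by (simp add: bounds_known_def)
  next
    case (5 c t2 s2)
    then have un2: "unchanged ?N ?B s s2" and t2: "t2 \<le> t1 + 100 * (c - row_start \<rho>)" and vR2: "nats s2 vR 0 = \<rho>"
      and o2: "outs c s2" and e2: "exts s2" and lr2: "reals s2 xl 0 = ext v (col \<rho>) + left_bound \<rho>"
        "reals s2 xr 0 = ext v (Suc (col \<rho>)) + right_bound \<rho>" by auto
    have c: "kC \<le> c" "c < cells" "row c = \<rho>"
      using 5(1,2) k_le_row_start[of \<rho>] row_start_le_cells[OF \<rho>(2)] row_eqI[of \<rho> c] by auto
    have uo: "reals s2 U1 c = U c" "reals s2 OFF c = offset c"
      using bk'[OF un2] c by (auto simp: bounds_known_def)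
    show ?case
      unfolding seq.simps
      apply (rule run_Seq, rule run_RStore, rule run_Seq, rule run_clip, rule run_RStore)
      using un2 t2 vR2 o2 e2 lr2 c uo 5(1,4)
      apply (auto simp: unchanged_set_nat unchanged_set_real outs_def exts_def less_Suc_eq assemble_def Suc_diff_le)
      done
  next
    case (6 t2 s2)
    then show ?case by (simp add: row_start_Suc)
  qed
  have rows: "run ?rows s1 t1 Q"
    if un1: "unchanged ?N ?B s s1" and vR1: "nats s1 vR 0 = 0" and vC1: "nats s1 vC 0 = kC" and o1: "outs kC s1" and e1: "exts s1"
      and t1: "t1 \<le> t + 60 + 60 * kC" for s1 t1
  \<comment> \<open>The summand \<open>100 * kC\<close> on the left offsets the initial value
    \<open>row_start 0 = kC\<close> on the right.\<close>
  proof (rule run_for[where a = 0 and b = "2 * kC + 2" and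
        I = "\<lambda>\<rho> t' s'. t' + 100 * kC \<le> t + 60 + 60 * kC + 100 * row_start \<rho> + 100 * \<rho> \<and> unchanged ?N ?B s s' \<and>
         nats s' vC 0 = row_start \<rho> \<and> outs (row_start \<rho>) s' \<and> exts s'"], goal_cases)
    case 1 show ?case using that by simp
  next
    case 2 show ?case by (rule vR1)
  next
    case 3 show ?case by simp
  next
    case (4 i t2 s2)
    then have "bounds_known U s2" using bk' by blast
    then show ?case by (simp add: bounds_known_def)
  next
    case (5 \<rho> t2 s2)
    then have un2: "unchanged ?N ?B s s2" and t2: "t2 + 100 * kC \<le> t + 60 + 60 * kC + 100 * row_start \<rho> + 100 * \<rho>"
      and vC2: "nats s2 vC 0 = row_start \<rho>" and o2: "outs (row_start \<rho>) s2" and e2: "exts s2" and vR2: "nats s2 vR 0 = \<rho>"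
      by auto
    note b2 = bk'[OF un2]
    define s3 where "s3 = set_real (set_real (set_nat s2 vI 0 (col \<rho>)) xl 0 (ext v (col \<rho>) + left_bound \<rho>))
      xr 0 (ext v (Suc (col \<rho>)) + right_bound \<rho>)"
    have vk2: "nats s2 vk 0 = kC" using b2 by (simp add: bounds_known_def)
    have lb: "reals s2 LB \<rho> = left_bound \<rho>" "reals s2 RB \<rho> = right_bound \<rho>"
      "reals s2 VX (col \<rho>) = ext v (col \<rho>)" "reals s2 VX (Suc (col \<rho>)) = ext v (Suc (col \<rho>))"
      using b2 e2 5(2) col_le[of \<rho>] by (auto simp: bounds_known_def exts_def)
    have colS: "kC < \<rho> \<Longrightarrow> col \<rho> = \<rho> - Suc kC" and colN: "\<not> kC < \<rho> \<Longrightarrow> col \<rho> = \<rho>"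
      by (simp_all add: col_def)
    have un3: "unchanged ?N ?B s s3" unfolding s3_def by (intro unchanged_set_nat unchanged_set_real un2) auto
    have fin: "run (for_prog vC (NLoad RST (NAdd (nvar vR) (NLit 1))) (seq [rassign xS (RLoad U1 (nvar vC)), clip_prog,
         RStore OUT (nvar vC) (RAdd (rvar xS) (RLoad OFF (nvar vC)))])) s3' t3
        (\<lambda>t' s'. nats s' vR 0 = \<rho> \<and> (t' + 6 + 100 * kC \<le> t + 60 + 60 * kC + 100 * row_start (Suc \<rho>) + 100 * Suc \<rho> \<and>
         unchanged ?N ?B s (set_nat s' vR 0 (Suc \<rho>)) \<and> nats (set_nat s' vR 0 (Suc \<rho>)) vC 0 = row_start (Suc \<rho>) \<and>
         outs (row_start (Suc \<rho>)) (set_nat s' vR 0 (Suc \<rho>)) \<and> exts (set_nat s' vR 0 (Suc \<rho>))))"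
      if s3': "s3' = s3" and t3: "t3 \<le> t2 + 60" for s3' t3
      unfolding s3'
    proof (rule run_mono[OF row_body[OF un3, where \<rho> = \<rho>]], goal_cases)
      case (8 t' s')
      then show ?case
        using t2 t3 by (auto simp: unchanged_set_nat outs_def exts_def row_start_Suc)
    qed (use vR2 vC2 o2 e2 5(2) in \<open>simp_all add: s3_def outs_def exts_def\<close>)
    show ?case
      unfolding seq.simps
      apply (rule run_Seq, rule run_Cond)
      subgoal
        by (rule run_NStore, intro run_Seq run_RStore, rule fin[unfolded seq.simps])
          (use lb(3,4) in \<open>auto simp: s3_def vk2 vR2 lb(1,2) colS\<close>)
      subgoal
        by (rule run_NStore, intro run_Seq run_RStore, rule fin[unfolded seq.simps])
          (use lb(3,4) in \<open>auto simp: s3_def vk2 vR2 lb(1,2) colN\<close>)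
      done
  next
    case (6 t2 s2)
    then have t2: "t2 + 100 * kC \<le> t + 60 + 60 * kC + 100 * row_start (2 * kC + 2) + 100 * (2 * kC + 2)"
      and o2: "outs (row_start (2 * kC + 2)) s2" by auto
    have "t2 + (4 + ntime (nvar vRows)) \<le> t + 1000 * cells + 200"
      using t2 sizes_le(1) k_le_cells unfolding cells_def[symmetric] by simp
    then show ?case using o2 unfolding cells_def[symmetric] outs_def by (intro Q) auto
  qed
  show ?thesis
    unfolding output_prog_def seq.simps(3)[of _ "nassign vC (NLit 0)"] seq.simps(3)[of _ "for_prog v e c" for v e c]
      seq.simps(3)[of _ "RStore VX e x" for e x] seq.simps(3)[of _ "nassign vR (NLit 0)"] seq.simps(2)
  proof (intro run_Seq run_RStore run_NStore, rule run_for[where a = 0 and b = kC and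
        I = "\<lambda>i t' s'. t' \<le> t + 20 + 60 * i \<and> unchanged ?N ?B s s' \<and> reals s' VX 0 = x_min I \<and>
          (\<forall>\<sigma><i. reals s' VX (Suc \<sigma>) = v \<sigma> \<and> reals s' OUT \<sigma> = v \<sigma> + double_offset (Suc \<sigma>))"], goal_cases)
    case 1
    show ?case by (simp add: unchanged_set_nat unchanged_set_real L[OF bk])
  next
    case 2 show ?case by simp
  next
    case 3 show ?case by simp
  next
    case (4 i t1 s1)
    then have "bounds_known U s1" using bk' by blast
    then show ?case by (simp add: bounds_known_def)
  next
    case (5 \<sigma> t1 s1)
    then have un1: "unchanged ?N ?B s s1" by simp
    have "reals s1 UU \<sigma> = v \<sigma>" "reals s1 DO (Suc \<sigma>) = double_offset (Suc \<sigma>)"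
      using unchanged_reals[OF un1, of UU] uu[OF 5(2)] bk'[OF un1] 5(2) by (simp_all add: bounds_known_def del: double_offset.simps)
    then show ?case
      unfolding seq.simps using 5 by (intro run_Seq run_RStore)
        (auto simp: unchanged_set_nat unchanged_set_real less_Suc_eq simp del: double_offset.simps)
  next
    case (6 t1 s1)
    then have un1: "unchanged ?N ?B s s1" and t1: "t1 \<le> t + 20 + 60 * kC" and v0: "reals s1 VX 0 = x_min I"
      and vs: "\<And>\<sigma>. \<sigma> < kC \<Longrightarrow> reals s1 VX (Suc \<sigma>) = v \<sigma> \<and> reals s1 OUT \<sigma> = v \<sigma> + double_offset (Suc \<sigma>)"
      and vC1: "nats s1 vC 0 = kC" by auto
    note b1 = bk'[OF un1]
    have n1: "nats s1 vk 0 = kC" "reals s1 xRR 0 = max_shifted" using b1 by (auto simp: bounds_known_def)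
    define s2 where "s2 = set_nat (set_real s1 VX (Suc kC) max_shifted) vR 0 0"
    have un2: "unchanged ?N ?B s s2" unfolding s2_def by (intro unchanged_set_nat unchanged_set_real un1) auto
    have e2: "exts s2"
      unfolding exts_def
    proof (intro allI impI)
      fix i assume "i \<le> Suc kC"
      then show "reals s2 VX i = ext v i" using v0 vs[of "i - 1"] by (cases i) (auto simp: s2_def ext_def)
    qed
    have o2: "outs kC s2" using vs by (simp add: outs_def s2_def assemble_def)
    show ?case
      by (intro run_Seq run_RStore run_NStore, rule run_state[OF _ rows[OF un2]])
        (use vC1 o2 e2 t1 n1 in \<open>simp_all add: s2_def\<close>)
  qed
qed

end

section \<open>Correctness and running time\<close>

definition double_row_prog :: com where
  "double_row_prog = seq [rows_prog, data_prog, offsets_prog, rows_table_prog, solve_prog, copy_prog, double_prog,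
     double_table_prog, solve_prog, output_prog]"

lemma chain_boxes_cong:
  assumes "\<And>s. s < S \<Longrightarrow> lo s = lo' s \<and> hi s = hi' s"
    and "\<And>s x. s < S \<Longrightarrow> lo' s \<le> x \<Longrightarrow> x \<le> hi' s \<Longrightarrow> F s x = G s x + C s"
    and "chain_boxes S lo' hi' G"
  shows "chain_boxes S lo hi F"
  unfolding chain_boxes_def
proof (intro conjI allI impI)
  fix s assume s: "s < S"
  show "lo s \<le> hi s" using assms(1)[OF s] assms(3) s by (simp add: chain_boxes_def)
  have "convex_on {lo' s..hi' s} (\<lambda>x. G s x + C s)"
    using assms(3) s convex_on_add[OF _ convex_on_const[THEN iffD2, of "{lo' s..hi' s}" "C s"], of "G s"]
    by (simp add: chain_boxes_def)
  then show "convex_on {lo s..hi s} (F s)"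
    using convex_on_eq[of "lo' s" "hi' s" "\<lambda>x. G s x + C s" "F s"] assms(1)[OF s] assms(2)[OF s] by simp
next
  fix s assume "Suc s < S"
  then show "lo s \<le> lo (Suc s)" "hi s \<le> hi (Suc s)"
    using assms(1)[of s] assms(1)[of "Suc s"] assms(3) by (simp_all add: chain_boxes_def)
qed

lemma chain_optimal_box_cong:
  assumes "\<And>s. s < S \<Longrightarrow> lo s = lo' s \<and> hi s = hi' s"
  shows "chain_optimal S lo hi F u \<longleftrightarrow> chain_optimal S lo' hi' F u"
proof -
  have "chain_feasible S lo hi w \<longleftrightarrow> chain_feasible S lo' hi' w" for w
    using assms by (auto simp: chain_feasible_def)
  then show ?thesis by (simp add: chain_optimal_def)
qed

lemma sum_concat_segment:
  fixes g :: "'b \<Rightarrow> real"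
  assumes "\<sigma> < K"
  shows "(\<Sum>j\<in>{length (concat (map xs [0..<\<sigma>]))..<length (concat (map xs [0..<Suc \<sigma>]))}. g (concat (map xs [0..<K]) ! j)) =
    sum_list (map g (xs \<sigma>))"
proof -
  let ?a = "length (concat (map xs [0..<\<sigma>]))"
  have "[0..<K] = [0..<\<sigma>] @ \<sigma> # [Suc \<sigma>..<K]"
    using assms by (metis less_imp_add_positive upt_add_eq_append upt_conv_Cons zero_le less_imp_le_nat le_add_diff_inverse)
  then have split: "concat (map xs [0..<K]) = concat (map xs [0..<\<sigma>]) @ xs \<sigma> @ concat (map xs [Suc \<sigma>..<K])"
    by simp
  have "(\<Sum>j\<in>{?a..<?a + length (xs \<sigma>)}. g (concat (map xs [0..<K]) ! j)) = (\<Sum>i<length (xs \<sigma>). g (xs \<sigma> ! i))"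
    by (rule sum.reindex_bij_witness[of _ "\<lambda>i. ?a + i" "\<lambda>j. j - ?a"]) (auto simp: split nth_append)
  then show ?thesis by (simp add: sum_list_sum_nth atLeast0LessThan)
qed

lemma sum_list_concat_upt:
  fixes g :: "'b \<Rightarrow> real"
  shows "sum_list (map g (concat (map xs [0..<K]))) = (\<Sum>\<sigma><K. sum_list (map g (xs \<sigma>)))"
  by (induction K) simp_all

lemma length_concat_upt_mono:
  "i \<le> j \<Longrightarrow> length (concat (map xs [0..<i])) \<le> length (concat (map xs [0..<j]))"
  by (induction j rule: dec_induct) simp_all

section \<open>Slot counts, the two runs of the solver, and the total time\<close>

context program_input
begin

text \<open>The part of the memory that the solver needs in both runs and that no phase in between
  overwrites, so it is set up only once.\<close>

definition solver_ready :: "nat \<Rightarrow> ram_state \<Rightarrow> bool" where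
  "solver_ready L s \<longleftrightarrow> input_kept s \<and> nats s vKB 0 = 2 * kC + 3 \<and> (\<forall>c\<le>cells. nats s PS c = data_start c) \<and>
     nats s vM 0 = tree_size \<and> pars_ok tree_size s \<and> 2 * tree_size \<le> 2 ^ L"

abbreviation (input) "SN \<equiv> {WIN, vV, vNX, vW, vP, vE, vD, vJ, vS} :: nat set"
abbreviation (input) "SR \<equiv> {KEY, AL, BE, xK, xA, xB, xK1, xK2, xCA, xCB, xO, xJA, xJB, xLo, xHi, xCur, xSA, xSB,
  xKap, xM, xU, MM, UU} :: nat set"

definition job_weight :: "nat \<Rightarrow> real" where "job_weight c = 2 * (real (num_kinks (cell_data c)) + 1)"

text \<open>The factor 2 allows for the two jobs of a row cell in the second chain.
  \<open>2 * job_weight c\<close> exceeds the number of stored reals of the cost of \<open>c\<close>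
  by only 1, so it is covered by \<open>data_start cells\<close>.\<close>

lemma capacity_bound:
  assumes "real w \<le> 2 * (\<Sum>c<cells. job_weight c)" "n \<le> cells"
  shows "1 + w + n \<le> tree_size"
proof -
  have "2 * (\<Sum>c<cells. job_weight c) = (\<Sum>c<cells. 4 * real (num_kinks (cell_data c)) + 3) + real cells"
    by (simp add: job_weight_def sum_distrib_left sum.distrib algebra_simps)
  also have "\<dots> = real ((\<Sum>c<cells. 4 * num_kinks (cell_data c) + 3) + cells)"
    by simp
  finally have "w \<le> (\<Sum>c<cells. 4 * num_kinks (cell_data c) + 3) + cells" using assms(1) by (simp only: of_nat_le_iff)
  then show ?thesis using assms(2) by (simp add: tree_size_def data_start_def)
qed

lemma run_rows_solve:
  assumes r: "solver_ready L s" and vNS: "nats s vNS 0 = cells"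
    and tab: "\<And>c. c < cells \<Longrightarrow> nats s JC c = c \<and> nats s JE c = Suc c \<and> reals s JA c = row_lo c \<and> reals s JB c = row_hi c \<and>
      reals s LO c = row_lo c \<and> reals s HI c = row_hi c"
    and off: "\<And>c. kC \<le> c \<Longrightarrow> c < cells \<Longrightarrow> reals s JO c = offset c"
    and Q: "\<And>t' s'. t' \<le> t + 2000 * (L + 1) * tree_size \<Longrightarrow> unchanged SN SR s s' \<Longrightarrow>
      chain_optimal cells row_lo row_hi row_cost (reals s' UU) \<Longrightarrow> Q t' s'"
  shows "run solve_prog s t Q"
proof -
  interpret chain_solver s tree_size L cells cell_fun
    by unfold_locales (use r vNS in \<open>simp_all add: solver_ready_def\<close>)
  have fj: "first_job \<sigma> = \<sigma>" if "\<sigma> \<le> cells" for \<sigma>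
    using that tab[of "\<sigma> - 1"] by (cases \<sigma>) (simp_all add: first_job_def)
  have jc: "job_cell j = j" if "j < cells" for j using tab[OF that] by (simp add: job_cell_def)
  have jk: "job_kinks j = num_kinks (cell_data j)" if "j < cells" for j
    using r that jc[OF that] input_kept_nats(3)[OF _ that] by (simp add: job_kinks_def solver_ready_def)
  \<comment> \<open>The box of a dummy is the point \<open>x_min I\<close>, so its job is evaluated
    at one fixed argument and costs a constant.\<close>
  define C where "C c = (if c < kC then cell_fun c (x_min I + reals s JO c) else 0)" for c
  have sc: "stage_cost c x = row_cost c x + C c" if "c < cells" "row_lo c \<le> x" "x \<le> row_hi c" for c x
  proof -
    have "stage_cost c x = job_cost c x" using that(1) fj[of c] fj[of "Suc c"] by (simp add: stage_cost_def)
    also have "\<dots> = cell_fun c (clip (row_lo c) (row_hi c) x + reals s JO c)"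
      using tab[OF that(1)] jc[OF that(1)] by (simp add: job_cost_def)
    also have "clip (row_lo c) (row_hi c) x = x" using that by (simp add: clip_def)
    finally show ?thesis using that off[of c] by (auto simp: row_cost_def C_def row_lo_def row_hi_def)
  qed
  have lohi: "reals s LO c = row_lo c \<and> reals s HI c = row_hi c" if "c < cells" for c using tab[OF that] by simp
  interpret chain_solver_ok s tree_size L cells cell_fun
  proof
    show "first_job \<sigma> \<le> first_job (Suc \<sigma>)" if "\<sigma> < cells" for \<sigma> using fj[of \<sigma>] fj[of "Suc \<sigma>"] that by simp
    show "stored_cost (reals s 0) (nats s PS (job_cell j)) (job_kinks j) (cell_fun (job_cell j))"
      if "j < first_job cells" for j
    proof -
      have j: "j < cells" using that fj[of cells] by simp
      have "nats s PS j = data_start j" "reals s 0 = reals start 0" using r j by (simp_all add: solver_ready_def input_kept_def)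
      then show ?thesis using cell_stored[OF j] jc[OF j] jk[OF j] by simp
    qed
    have "real (weight (first_job cells)) = (\<Sum>c<cells. job_weight c)"
      using fj[of cells] by (simp add: weight_def jk job_weight_def sum.distrib)
    moreover have "0 \<le> (\<Sum>c<cells. job_weight c)" by (intro sum_nonneg) (simp add: job_weight_def)
    ultimately show "1 + weight (first_job cells) + cells \<le> tree_size" by (intro capacity_bound) simp_all
    show "chain_boxes cells (reals s LO) (reals s HI) stage_cost"
      by (rule chain_boxes_cong[OF lohi sc rows_chain_boxes])
  qed
  show ?thesis
  proof (rule run_solve)
    fix t' s'
    assume h: "t' \<le> t + 2000 * (L + 1) * tree_size" "unchanged SN SR s s'"
      "chain_optimal cells (reals s LO) (reals s HI) stage_cost (reals s' UU)"
    have "chain_optimal cells row_lo row_hi row_cost (reals s' UU)"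
      by (rule chain_optimal_cong[OF sc]) (use h(3) chain_optimal_box_cong[OF lohi] in simp_all)
    then show "Q t' s'" using Q h by blast
  qed
qed

definition job_fun :: "job \<Rightarrow> real \<Rightarrow> real" where
  "job_fun = (\<lambda>(c, h, a, b) x. cell_fun c (clip a b x + h))"

lemma left_jobs_cost:
  assumes "x \<le> max_shifted"
  shows "sum_list (map (\<lambda>j. job_fun j x) (left_jobs U \<rho>)) = left_cost U \<rho> x"
proof -
  have eq: "max (U c - left_bound \<rho>) (min max_shifted x) + (left_bound \<rho> + offset c) = max (x + left_bound \<rho>) (U c) + offset c" for c
    using assms by (simp add: max_def min_def)
  show ?thesis
    by (simp add: left_jobs_def left_cost_def job_fun_def clip_def comp_def interv_sum_list_conv_sum_set_nat eq)
qed

text \<open>\<open>clip\<close> lets its left bound prevail. If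
  \<open>U c - right_bound \<rho>\<close> lies left of \<open>x_min I\<close>, the job is constant
  in \<open>x\<close>, and so is the summand of \<open>right_cost\<close>, but at another argument;
  their difference is the correction. For \<open>left_jobs\<close> the prevailing bound is the
  desired one.\<close>

lemma right_jobs_cost:
  assumes "x_min I \<le> x"
  shows "sum_list (map (\<lambda>j. job_fun j x) (right_jobs U \<rho>)) = right_cost U \<rho> x +
    (\<Sum>c\<in>{row_start \<rho>..<row_start (Suc \<rho>)}. if x_min I \<le> U c - right_bound \<rho> then 0
       else cell_fun c (x_min I + right_bound \<rho> + offset c) - cell_fun c (U c + offset c))"
proof -
  have "cell_fun c (max (x_min I) (min (U c - right_bound \<rho>) x) + (right_bound \<rho> + offset c)) =
      cell_fun c (min (x + right_bound \<rho>) (U c) + offset c) + (if x_min I \<le> U c - right_bound \<rho> then 0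
       else cell_fun c (x_min I + right_bound \<rho> + offset c) - cell_fun c (U c + offset c))" for c
  proof (cases "x_min I \<le> U c - right_bound \<rho>")
    case True
    then have eq: "max (x_min I) (min (U c - right_bound \<rho>) x) + (right_bound \<rho> + offset c) = min (x + right_bound \<rho>) (U c) + offset c"
      using assms by (simp add: max_def min_def)
    show ?thesis unfolding eq using True by simp
  next
    case False
    then have eq: "max (x_min I) (min (U c - right_bound \<rho>) x) + (right_bound \<rho> + offset c) = x_min I + right_bound \<rho> + offset c"
      "min (x + right_bound \<rho>) (U c) = U c"
      using assms by (simp_all add: max_def min_def)
    show ?thesis unfolding eq using False by simp
  qed
  then show ?thesis
    by (simp add: right_jobs_def right_cost_def job_fun_def clip_def comp_def interv_sum_list_conv_sum_set_nat sum.distrib)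
qed

lemma stage_jobs_cost:
  "\<exists>C. \<forall>x. x_min I \<le> x \<longrightarrow> x \<le> max_shifted \<longrightarrow>
     sum_list (map (\<lambda>j. job_fun j x) (stage_jobs U \<sigma>)) = double_cost U \<sigma> x + C"
proof -
  define R where "R \<rho> = (\<Sum>c\<in>{row_start \<rho>..<row_start (Suc \<rho>)}. if x_min I \<le> U c - right_bound \<rho> then 0
       else cell_fun c (x_min I + right_bound \<rho> + offset c) - cell_fun c (U c + offset c))" for \<rho>
  have "sum_list (map (\<lambda>j. job_fun j x) (stage_jobs U \<sigma>)) = double_cost U \<sigma> x + (R \<sigma> + R (kC + 1 + \<sigma>))"
    if "x_min I \<le> x" "x \<le> max_shifted" for x
  proof -
    have "clip (x_min I) max_shifted x = x" using that by (simp add: clip_def)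
    then show ?thesis
      unfolding stage_jobs_def double_cost_def
      using left_jobs_cost[OF that(2), of U] right_jobs_cost[OF that(1), of U, folded R_def]
      by (simp add: job_fun_def del: double_offset.simps)
  qed
  then show ?thesis by blast
qed

text \<open>A double-row cell has one job, and a row cell has at most one job for each side of its
  row.\<close>

lemma stage_jobs_weight:
  "(\<Sum>\<sigma><kC. sum_list (map (\<lambda>j. job_weight (fst j)) (stage_jobs U \<sigma>))) \<le> 2 * (\<Sum>c<cells. job_weight c)"
proof -
  define w where "w \<rho> = (\<Sum>c\<in>{row_start \<rho>..<row_start (Suc \<rho>)}. job_weight c)" for \<rho>
  have nn: "0 \<le> job_weight c" for c by (simp add: job_weight_def)
  have "sum_list (map (\<lambda>j. job_weight (fst j)) (left_jobs U \<rho>)) = w \<rho>"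
    "sum_list (map (\<lambda>j. job_weight (fst j)) (right_jobs U \<rho>)) = w \<rho>" for \<rho>
    by (simp_all add: left_jobs_def right_jobs_def w_def comp_def interv_sum_list_conv_sum_set_nat)
  then have "(\<Sum>\<sigma><kC. sum_list (map (\<lambda>j. job_weight (fst j)) (stage_jobs U \<sigma>))) =
      (\<Sum>\<sigma><kC. job_weight \<sigma>) + (\<Sum>\<sigma><kC. w (Suc \<sigma>) + w (kC + 1 + Suc \<sigma>) + w \<sigma> + w (kC + 1 + \<sigma>))"
    unfolding sum.distrib[symmetric] by (simp add: stage_jobs_def add.assoc)
  also have "\<dots> \<le> (\<Sum>\<sigma><kC. job_weight \<sigma>) + 2 * (\<Sum>\<rho><2 * kC + 2. w \<rho>)"
    by (intro add_left_mono sum_neighbour_rows) (simp add: w_def sum_nonneg nn)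
  also have "(\<Sum>\<rho><2 * kC + 2. w \<rho>) = (\<Sum>c\<in>{kC..<cells}. job_weight c)"
    unfolding sum_rows w_def ..
  also have "(\<Sum>\<sigma><kC. job_weight \<sigma>) + 2 * (\<Sum>c\<in>{kC..<cells}. job_weight c) \<le> 2 * (\<Sum>c<cells. job_weight c)"
    unfolding sum_lessThan_split[OF k_le_cells] using sum_nonneg[of "{..<kC}" job_weight] nn by simp
  finally show ?thesis .
qed

lemma stage_jobs_cells: "\<sigma> < kC \<Longrightarrow> j \<in> set (stage_jobs U \<sigma>) \<Longrightarrow> fst j < cells"
  using row_start_le_cells[of "Suc \<sigma>"] row_start_le_cells[of "kC + 1 + Suc \<sigma>"] row_start_le_cells[of \<sigma>]
    row_start_le_cells[of "kC + 1 + \<sigma>"] k_le_cells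
  by (auto simp: stage_jobs_def left_jobs_def right_jobs_def)

lemma run_double_solve:
  assumes r: "solver_ready L s" and U: "chain_optimal cells row_lo row_hi row_cost U"
    and vNS: "nats s vNS 0 = kC" and tab: "job_table (concat (map (stage_jobs U) [0..<kC])) s"
    and ends: "\<And>\<sigma>. \<sigma> < kC \<Longrightarrow> nats s JE \<sigma> = length (concat (map (stage_jobs U) [0..<Suc \<sigma>])) \<and>
           reals s LO \<sigma> = x_min I \<and> reals s HI \<sigma> = max_shifted"
    and Q: "\<And>t' s'. t' \<le> t + 2000 * (L + 1) * tree_size \<Longrightarrow> unchanged SN SR s s' \<Longrightarrow>
      chain_optimal kC (\<lambda>_. x_min I) (\<lambda>_. max_shifted) (double_cost U) (reals s' UU) \<Longrightarrow> Q t' s'"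
  shows "run solve_prog s t Q"
proof -
  interpret sr: solved_rows kC row_size cell_width "x_min I" "x_max I" cell_fun U
    by unfold_locales (rule U)
  interpret chain_solver s tree_size L kC cell_fun
    by unfold_locales (use r vNS in \<open>simp_all add: solver_ready_def\<close>)
  define js where "js = concat (map (stage_jobs U) [0..<kC])"
  have fj: "first_job \<sigma> = length (concat (map (stage_jobs U) [0..<\<sigma>]))" if "\<sigma> \<le> kC" for \<sigma>
    using that ends[of "\<sigma> - 1"] by (cases \<sigma>) (simp_all add: first_job_def)
  have last: "first_job kC = length js" by (simp add: fj js_def)
  have row: "job_cell j = fst (js ! j) \<and> job_cost j x = job_fun (js ! j) x" if "j < length js" for j x
  proof -
    have "(nats s JC j, reals s JO j, reals s JA j, reals s JB j) = js ! j"
      using tab that by (simp add: job_table_def js_def)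
    then show ?thesis by (simp add: job_cell_def job_cost_def job_fun_def flip: \<open>_ = js ! j\<close>)
  qed
  have cell: "job_cell j < cells" if "j < length js" for j
  proof -
    have "js ! j \<in> set js" using that by simp
    then obtain \<sigma> where "\<sigma> < kC" "js ! j \<in> set (stage_jobs U \<sigma>)" by (auto simp: js_def)
    then show ?thesis using row[OF that] stage_jobs_cells by metis
  qed
  have jk: "job_kinks j = num_kinks (cell_data (job_cell j))" if "j < length js" for j
    using r cell[OF that] input_kept_nats(3)[OF _ cell[OF that], of s] by (simp add: job_kinks_def solver_ready_def)
  have fm: "first_job \<sigma> \<le> first_job (Suc \<sigma>)" if "\<sigma> < kC" for \<sigma>
    using fj[of \<sigma>] fj[of "Suc \<sigma>"] that by simp
  have fle: "first_job \<sigma> \<le> length js" if "\<sigma> \<le> kC" for \<sigma>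
    using fj[OF that] length_concat_upt_mono[OF that, of "stage_jobs U"] by (simp add: js_def)
  have cost: "stage_cost \<sigma> x = sum_list (map (\<lambda>j. job_fun j x) (stage_jobs U \<sigma>))" if "\<sigma> < kC" for \<sigma> x
  proof -
    have "stage_cost \<sigma> x = (\<Sum>j\<in>{first_job \<sigma>..<first_job (Suc \<sigma>)}. job_fun (js ! j) x)"
      unfolding stage_cost_def by (rule sum.cong) (use row fle[of "Suc \<sigma>"] that in auto)
    also have "\<dots> = sum_list (map (\<lambda>j. job_fun j x) (stage_jobs U \<sigma>))"
      using sum_concat_segment[OF that, of "\<lambda>j. job_fun j x" "stage_jobs U"] fj[of \<sigma>] fj[of "Suc \<sigma>"] that
      by (simp only: js_def less_imp_le Suc_leI)
    finally show ?thesis .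
  qed
  obtain C where C: "\<And>\<sigma> x. x_min I \<le> x \<Longrightarrow> x \<le> max_shifted \<Longrightarrow>
     sum_list (map (\<lambda>j. job_fun j x) (stage_jobs U \<sigma>)) = double_cost U \<sigma> x + C \<sigma>"
    using stage_jobs_cost by metis
  have sc: "stage_cost \<sigma> x = double_cost U \<sigma> x + C \<sigma>" if "\<sigma> < kC" "x_min I \<le> x" "x \<le> max_shifted" for \<sigma> x
    using cost[OF that(1)] C[OF that(2,3)] by simp
  have lohi: "reals s LO \<sigma> = x_min I \<and> reals s HI \<sigma> = max_shifted" if "\<sigma> < kC" for \<sigma> using ends[OF that] by simp
  interpret chain_solver_ok s tree_size L kC cell_fun
  proof
    show "first_job \<sigma> \<le> first_job (Suc \<sigma>)" if "\<sigma> < kC" for \<sigma> by (rule fm[OF that])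
    show "stored_cost (reals s 0) (nats s PS (job_cell j)) (job_kinks j) (cell_fun (job_cell j))"
      if "j < first_job kC" for j
    proof -
      have j: "j < length js" using that last by simp
      have "nats s PS (job_cell j) = data_start (job_cell j)" "reals s 0 = reals start 0"
        using r cell[OF j] by (simp_all add: solver_ready_def input_kept_def)
      then show ?thesis using cell_stored[OF cell[OF j]] jk[OF j] by simp
    qed
    have "real (weight (first_job kC)) = (\<Sum>j<length js. job_weight (fst (js ! j)))"
      unfolding weight_def last of_nat_sum
      by (rule sum.cong) (use row in \<open>auto simp: jk job_weight_def\<close>)
    also have "\<dots> = sum_list (map (\<lambda>j. job_weight (fst j)) js)"
      by (simp add: sum_list_sum_nth atLeast0LessThan)
    also have "\<dots> = (\<Sum>\<sigma><kC. sum_list (map (\<lambda>j. job_weight (fst j)) (stage_jobs U \<sigma>)))"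
      unfolding js_def by (rule sum_list_concat_upt)
    finally show "1 + weight (first_job kC) + kC \<le> tree_size"
      using stage_jobs_weight[of U] k_le_cells by (intro capacity_bound) simp_all
    show "chain_boxes kC (reals s LO) (reals s HI) stage_cost"
      by (rule chain_boxes_cong[OF lohi sc sr.double_chain_boxes])
  qed
  show ?thesis
  proof (rule run_solve)
    fix t' s'
    assume h: "t' \<le> t + 2000 * (L + 1) * tree_size" "unchanged SN SR s s'"
      "chain_optimal kC (reals s LO) (reals s HI) stage_cost (reals s' UU)"
    have "chain_optimal kC (\<lambda>_. x_min I) (\<lambda>_. max_shifted) (double_cost U) (reals s' UU)"
      by (rule chain_optimal_cong[OF sc]) (use h(3) chain_optimal_box_cong[OF lohi] in simp_all)
    then show "Q t' s'" using Q h by blast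
  qed
qed

lemma run_double_row:
  assumes L: "2 * tree_size \<le> 2 ^ L"
  shows "run double_row_prog start 0 (\<lambda>t s. t \<le> 6000 * (L + 1) * tree_size \<and>
    (\<exists>U v. chain_optimal cells row_lo row_hi row_cost U \<and>
       chain_optimal kC (\<lambda>_. x_min I) (\<lambda>_. max_shifted) (double_cost U) v \<and>
       (\<forall>c<cells. reals s OUT c = assemble v U c)))" (is "run _ _ _ ?post")
  unfolding double_row_prog_def seq.simps
proof (rule run_Seq, rule run_rows)
  show "input_kept start" by (simp add: input_kept_def)
  fix t1 s1
  assume t1: "t1 \<le> 0 + 200 * cells + 100" and un1: "unchanged {vk, vRows, vKB, RST, vR, vn} {} start s1"
    and vk1: "nats s1 vk 0 = kC" and vRows1: "nats s1 vRows 0 = 2 * kC + 2" and vKB1: "nats s1 vKB 0 = 2 * kC + 3"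
    and vn1: "nats s1 vn 0 = cells" and rst1: "\<And>\<rho>. \<rho> \<le> 2 * kC + 2 \<Longrightarrow> nats s1 RST \<rho> = row_start \<rho>"
  have in1: "input_kept s1" by (rule input_kept_unchanged[OF un1]) (simp_all add: input_kept_def)
  show "run (Seq data_prog (Seq offsets_prog (Seq rows_table_prog (Seq solve_prog (Seq copy_prog (Seq double_prog
      (Seq double_table_prog (Seq solve_prog output_prog)))))))) s1 t1 ?post"
  proof (rule run_Seq, rule run_data[OF in1 vn1 vKB1])
    fix t2 s2
    assume t2: "t2 \<le> t1 + 200 * tree_size + 100" and un2: "unchanged {PS, vC, vI, vM, vV, PAR} {} s1 s2"
      and ps2: "\<And>c. c \<le> cells \<Longrightarrow> nats s2 PS c = data_start c" and vM2: "nats s2 vM 0 = tree_size"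
      and par2: "pars_ok tree_size s2"
    have in2: "input_kept s2" by (rule input_kept_unchanged[OF un2 _ _ in1]) simp_all
    note n2 = unchanged_nats[OF un2]
    have vk2: "nats s2 vk 0 = kC" and vRows2: "nats s2 vRows 0 = 2 * kC + 2" and vKB2: "nats s2 vKB 0 = 2 * kC + 3"
      and vn2: "nats s2 vn 0 = cells" and rst2: "\<And>\<rho>. \<rho> \<le> 2 * kC + 2 \<Longrightarrow> nats s2 RST \<rho> = row_start \<rho>"
      using n2 vk1 vRows1 vKB1 vn1 rst1 by simp_all
    have sr2: "solver_ready L s2"
      using in2 vKB2 ps2 vM2 par2 L by (simp add: solver_ready_def)
    have ready: "solver_ready L s'" if "unchanged A B s s'" "solver_ready L s" "0 \<notin> A" "vKB \<notin> A" "PS \<notin> A" "vM \<notin> A"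
        "PAR \<notin> A" "0 \<notin> B" for A B s s'
      using that by (simp add: solver_ready_def input_kept_def pars_ok_def unchanged_def)
    show "run (Seq offsets_prog (Seq rows_table_prog (Seq solve_prog (Seq copy_prog (Seq double_prog
      (Seq double_table_prog (Seq solve_prog output_prog))))))) s2 t2 ?post"
    proof (rule run_Seq, rule run_offsets[OF in2 vk2 vRows2 rst2])
      fix t3 s3
      assume t3: "t3 \<le> t2 + 600 * cells + 100" and un3: "unchanged {vC, vR} {LO, HI, SH, xSh, xAcc, OFF, RWD} s2 s3"
        and rows3: "\<And>\<rho>. \<rho> < 2 * kC + 2 \<Longrightarrow> reals s3 SH \<rho> = shift \<rho> \<and> reals s3 RWD \<rho> = row_width \<rho>"
        and box3: "\<And>c. c < cells \<Longrightarrow> reals s3 LO c = row_lo c \<and> reals s3 HI c = row_hi c"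
        and off3: "\<And>c. kC \<le> c \<Longrightarrow> c < cells \<Longrightarrow> reals s3 OFF c = offset c"
      have vn3: "nats s3 vn 0 = cells" using unchanged_nats[OF un3] vn2 by simp
      have sr3: "solver_ready L s3" by (rule ready[OF un3 sr2]) simp_all
      show "run (Seq rows_table_prog (Seq solve_prog (Seq copy_prog (Seq double_prog
        (Seq double_table_prog (Seq solve_prog output_prog)))))) s3 t3 ?post"
      proof (rule run_Seq, rule run_rows_table[OF vn3])
        fix t4 s4
        assume t4: "t4 \<le> t3 + 100 * cells + 100" and un4: "unchanged {vC, JC, JE, vNS} {JO, JA, JB} s3 s4"
          and vNS4: "nats s4 vNS 0 = cells"
          and tab4: "\<And>c. c < cells \<Longrightarrow> nats s4 JC c = c \<and> nats s4 JE c = Suc c \<and> reals s4 JO c = reals s3 OFF c \<and>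
            reals s4 JA c = reals s3 LO c \<and> reals s4 JB c = reals s3 HI c"
        have sr4: "solver_ready L s4" by (rule ready[OF un4 sr3]) simp_all
        have r4: "reals s4 LO = reals s3 LO" "reals s4 HI = reals s3 HI" using unchanged_reals[OF un4] by simp_all
        show "run (Seq solve_prog (Seq copy_prog (Seq double_prog
          (Seq double_table_prog (Seq solve_prog output_prog))))) s4 t4 ?post"
        proof (rule run_Seq, rule run_rows_solve[OF sr4 vNS4])
          show "nats s4 JC c = c \<and> nats s4 JE c = Suc c \<and> reals s4 JA c = row_lo c \<and> reals s4 JB c = row_hi c \<and>
            reals s4 LO c = row_lo c \<and> reals s4 HI c = row_hi c" if "c < cells" for c
            using tab4[OF that] box3[OF that] r4 by simp
          show "reals s4 JO c = offset c" if "kC \<le> c" "c < cells" for c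
            using tab4[OF that(2)] off3[OF that] by simp
          fix t5 s5
          assume t5: "t5 \<le> t4 + 2000 * (L + 1) * tree_size" and un5: "unchanged SN SR s4 s5"
            and U5: "chain_optimal cells row_lo row_hi row_cost (reals s5 UU)"
          have sr5: "solver_ready L s5" by (rule ready[OF un5 sr4]) simp_all
          have vn5: "nats s5 vn 0 = cells" using unchanged_nats[OF un5] unchanged_nats[OF un4] vn3 by simp
          show "run (Seq copy_prog (Seq double_prog (Seq double_table_prog (Seq solve_prog output_prog)))) s5 t5 ?post"
          proof (rule run_Seq, rule run_copy[OF vn5])
            fix t6 s6
            assume t6: "t6 \<le> t5 + 100 * cells + 100" and un6: "unchanged {vC} {U1} s5 s6"
              and u6: "\<And>c. c < cells \<Longrightarrow> reals s6 U1 c = reals s5 UU c"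
            define U where "U = reals s5 UU"
            have sr6: "solver_ready L s6" by (rule ready[OF un6 sr5]) simp_all
            then have in6: "input_kept s6" by (simp add: solver_ready_def)
            note n36 = unchanged_nats[OF un6] unchanged_nats[OF un5] unchanged_nats[OF un4] unchanged_nats[OF un3]
            note r36 = unchanged_reals[OF un6] unchanged_reals[OF un5] unchanged_reals[OF un4]
            have vk6: "nats s6 vk 0 = kC" using n36 vk2 by simp
            have vRows6: "nats s6 vRows 0 = 2 * kC + 2" using n36 vRows2 by simp
            have rst6: "nats s6 RST \<rho> = row_start \<rho>" if "\<rho> \<le> 2 * kC + 2" for \<rho> using n36 rst2[OF that] by simp
            have rows6: "reals s6 SH \<rho> = shift \<rho> \<and> reals s6 RWD \<rho> = row_width \<rho>" if "\<rho> < 2 * kC + 2" for \<rho>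
              using r36 rows3[OF that] by simp
            have off6: "reals s6 OFF c = offset c" if "kC \<le> c" "c < cells" for c using r36 off3[OF that] by simp
            show "run (Seq double_prog (Seq double_table_prog (Seq solve_prog output_prog))) s6 t6 ?post"
            proof (rule run_Seq, rule run_double[OF in6 vk6 rows6])
              fix t7 s7
              assume t7: "t7 \<le> t6 + 400 * cells + 300" and un7: "unchanged {vI, vR} {DO, LB, RB, xS, xRR} s6 s7"
                and do7: "\<And>i. i \<le> Suc kC \<Longrightarrow> reals s7 DO i = double_offset i" and rr7: "reals s7 xRR 0 = max_shifted"
                and lb7: "\<And>\<rho>. \<rho> < 2 * kC + 2 \<Longrightarrow> reals s7 LB \<rho> = left_bound \<rho> \<and> reals s7 RB \<rho> = right_bound \<rho>"
              have sr7: "solver_ready L s7" by (rule ready[OF un7 sr6]) simp_all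
              have in7: "input_kept s7" using sr7 by (simp add: solver_ready_def)
              have bk7: "bounds_known U s7"
                unfolding bounds_known_def
              proof (intro conjI allI impI)
                show "nats s7 vk 0 = kC" "nats s7 vRows 0 = 2 * kC + 2"
                  using unchanged_nats[OF un7] vk6 vRows6 by simp_all
                show "nats s7 RST \<rho> = row_start \<rho>" if "\<rho> \<le> 2 * kC + 2" for \<rho>
                  using unchanged_nats[OF un7] rst6[OF that] by simp
                show "reals s7 OFF c = offset c" "reals s7 U1 c = U c" if "kC \<le> c \<and> c < cells" for c
                  using unchanged_reals[OF un7] off6[of c] u6[of c] that by (simp_all add: U_def)
              qed (use in7 rr7 lb7 do7 in auto)
              show "run (Seq double_table_prog (Seq solve_prog output_prog)) s7 t7 ?post"
              proof (rule run_Seq, rule run_double_table[OF bk7])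
                fix t8 s8
                assume t8: "t8 \<le> t7 + 2000 * cells + 100" and un8: "unchanged TN TR s7 s8" and bk8: "bounds_known U s8"
                  and tab8: "job_table (concat (map (stage_jobs U) [0..<kC])) s8" and vNS8: "nats s8 vNS 0 = kC"
                  and ends8: "\<And>\<sigma>. \<sigma> < kC \<Longrightarrow> nats s8 JE \<sigma> = length (concat (map (stage_jobs U) [0..<Suc \<sigma>])) \<and>
                     reals s8 LO \<sigma> = x_min I \<and> reals s8 HI \<sigma> = max_shifted"
                have sr8: "solver_ready L s8" by (rule ready[OF un8 sr7]) simp_all
                note U = U5[folded U_def]
                show "run (Seq solve_prog output_prog) s8 t8 ?post"
                proof (rule run_Seq, rule run_double_solve[OF sr8 U vNS8 tab8 ends8])
                  fix t9 s9
                  assume t9: "t9 \<le> t8 + 2000 * (L + 1) * tree_size" and un9: "unchanged SN SR s8 s9"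
                    and v9: "chain_optimal kC (\<lambda>_. x_min I) (\<lambda>_. max_shifted) (double_cost U) (reals s9 UU)"
                  have bk9: "bounds_known U s9" by (rule bounds_known_unchanged[OF un9 bk8]) simp_all
                  show "run output_prog s9 t9 ?post"
                  proof (rule run_output[OF bk9 refl])
                    fix t10 and s10 :: ram_state
                    assume t10: "t10 \<le> t9 + 1000 * cells + 200"
                      and out: "\<And>c. c < cells \<Longrightarrow> reals s10 OUT c = assemble (reals s9 UU) U c"
                    \<comment> \<open>The two runs of the solver account for
                      \<open>4000 * (L + 1) * tree_size\<close>. All other phases are linear in
                      \<open>cells\<close> and \<open>tree_size\<close> and fit into the
                      rest.\<close>
                    have "tree_size \<le> (L + 1) * tree_size" by simp
                    then have "t10 \<le> 6000 * (L + 1) * tree_size"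
                      using t1 t2 t3 t4 t5 t6 t7 t8 t9 t10 sizes_le(3,4) unfolding mult.assoc[of _ "L + 1"] by linarith
                    then show "?post t10 s10" using U v9 out by blast
                  qed
                qed
              qed
            qed
          qed
        qed
      qed
    qed
  qed
qed

lemma cell_list_flat:
  assumes "\<And>c. c < cells \<Longrightarrow> X c = Y c"
  shows "map X [0..<cells] = cell_list I (\<lambda>i. Y (i - 1)) (\<lambda>i j. Y (row_start i + (j - 1)))
     (\<lambda>i j. Y (row_start (kC + 1 + i) + (j - 1)))"
proof (rule nth_equalityI)
  fix c assume "c < length (map X [0..<cells])"
  then have c: "c < cells" by simp
  then have "map X [0..<cells] ! c = Y c" using assms by simp
  also have "\<dots> = cell_list I (\<lambda>i. Y (i - 1)) (\<lambda>i j. Y (row_start i + (j - 1)))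
     (\<lambda>i j. Y (row_start (kC + 1 + i) + (j - 1))) ! c"
    using c by (cases rule: cell_cases) (simp_all add: nth_cell_list[simplified])
  finally show "map X [0..<cells] ! c = \<dots>" .
qed (simp add: length_cell_list)

lemma output_optimal:
  assumes U: "chain_optimal cells row_lo row_hi row_cost U"
    and v: "chain_optimal kC (\<lambda>_. x_min I) (\<lambda>_. max_shifted) (double_cost U) v"
    and out: "\<And>c. c < cells \<Longrightarrow> reals s 1 c = assemble v U c"
  shows "\<exists>x y z. outputs_solution I s x y z \<and> optimal_solution I x y z"
proof -
  interpret sr: solved_rows kC row_size cell_width "x_min I" "x_max I" cell_fun U
    by unfold_locales (rule U)
  define Y where "Y = assemble v U"
  define x where "x i = Y (i - 1)" for i
  define y where "y i j = Y (row_start i + (j - 1))" for i j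
  define z where "z i j = Y (row_start (kC + 1 + i) + (j - 1))" for i j
  have lst: "map (reals s 1) [0..<cells] = cell_list I x y z" "map Y [0..<cells] = cell_list I x y z"
    unfolding x_def[abs_def] y_def[abs_def] z_def[abs_def] by (rule cell_list_flat; simp add: out[unfolded One_nat_def] Y_def)+
  have Yc: "Y c = cell_list I x y z ! c" if "c < cells" for c
    using that by (simp flip: lst(2))
  have cost: "total_cost I x' y' z' = sr.flat_cost (\<lambda>c. cell_list I x' y' z' ! c)" for x' y' z'
    by (simp add: total_cost_flat sr.flat_cost_def)
  have "sr.flat_cost Y = total_cost I x y z"
    unfolding cost sr.flat_cost_def using Yc by simp
  moreover have "sr.flat_cost Y \<le> total_cost I x' y' z'" if "feasible_solution I x' y' z'" for x' y' z'
    unfolding cost Y_def by (rule sr.assemble_optimal(2)[OF v]) (use feasible_solution_flat that in blast)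
  moreover have "feasible_solution I x y z"
    using feasible_solution_flat[OF Yc] sr.assemble_optimal(1)[OF v] by (simp add: Y_def)
  ultimately have "optimal_solution I x y z" by (simp add: optimal_solution_def)
  moreover have "outputs_solution I s x y z" using lst(1) by (simp add: outputs_solution_def flip: cells_eq)
  ultimately show ?thesis by blast
qed

text \<open>Expanding the sums gives 6 plus 12 for each cell and each kink; since there is at least
  one cell, the 6 is absorbed.\<close>

lemma tree_size_le: "tree_size \<le> 18 * (num_cells I + total_kinks I D)"
proof -
  have "real (total_kinks I D) = (\<Sum>c<cells. real (num_kinks (cell_data c)))"
    unfolding sum_cells total_kinks_def of_nat_add of_nat_sum sum_from_1 atLeast0AtMost lessThan_Suc_atMost[symmetric]
    by (simp add: cell_data_def nth_cell_list[simplified] sum.distrib del: sum.lessThan_Suc)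
  then have "total_kinks I D = (\<Sum>c<cells. num_kinks (cell_data c))"
    by (simp only: of_nat_sum[symmetric] of_nat_eq_iff)
  then have "tree_size = 6 + 12 * cells + 12 * total_kinks I D"
    by (simp add: tree_size_def data_start_def sum.distrib sum_distrib_left[symmetric])
  moreover have "1 \<le> cells" using k k_le_cells by simp
  ultimately show ?thesis by (simp flip: cells_eq)
qed

text \<open>\<open>L\<close> is the rounded-up binary logarithm of \<open>2 * tree_size\<close>.
  With \<open>tree_size \<le> 18 * n\<close> this gives the constants \<open>36 = 2 * 18\<close> and
  \<open>108000 = 6000 * 18\<close>; the summand 2 stems from rounding and from
  \<open>L + 1\<close>.\<close>

lemma double_row_solved:
  defines "n \<equiv> num_cells I + total_kinks I D"
  shows "\<exists>t s. exec double_row_prog start t s \<and> real t \<le> 108000 * (log 2 (36 * real n) + 2) * real n \<and>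
     (\<exists>x y z. outputs_solution I s x y z \<and> optimal_solution I x y z)"
proof -
  define L where "L = nat \<lceil>log 2 (2 * real tree_size)\<rceil>"
  have ts: "6 \<le> tree_size" by (rule sizes_le(4))
  then have pos: "0 \<le> log 2 (2 * real tree_size)" by simp
  have tn: "real tree_size \<le> 18 * real n" using tree_size_le unfolding n_def by (simp flip: of_nat_le_iff[where 'a = real])
  have "log 2 (2 * real tree_size) \<le> real L" unfolding L_def using pos by (simp add: of_nat_ceiling)
  then have "2 * real tree_size \<le> 2 powr real L" using ts by (simp add: log_le_iff)
  then have "real (2 * tree_size) \<le> real (2 ^ L)" by (simp add: powr_realpow)
  then have L: "2 * tree_size \<le> 2 ^ L" by (simp only: of_nat_le_iff)
  obtain t s where ex: "exec double_row_prog start t s" and t: "t \<le> 6000 * (L + 1) * tree_size"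
    and opt: "\<exists>x y z. outputs_solution I s x y z \<and> optimal_solution I x y z"
    using run_double_row[OF L] output_optimal unfolding run_def by auto
  have "real L \<le> log 2 (2 * real tree_size) + 1" unfolding L_def using pos by linarith
  also have "log 2 (2 * real tree_size) \<le> log 2 (36 * real n)" using ts tn by simp
  finally have Ln: "real L + 1 \<le> log 2 (36 * real n) + 2" by simp
  have "real t \<le> 6000 * (real L + 1) * real tree_size"
    using t by (simp flip: of_nat_le_iff[where 'a = real] add: algebra_simps)
  also have "\<dots> \<le> 6000 * (log 2 (36 * real n) + 2) * (18 * real n)"
    using Ln tn by (intro mult_mono) auto
  finally show ?thesis using ex opt by (intro exI[of _ t] exI[of _ s]) (auto simp: algebra_simps)
qed

end

theorem theorem4p2:
  "\<exists>(P :: com) (T :: nat \<Rightarrow> real).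
     T \<in> O(\<lambda>n. real n * ln (real n)) \<and>
     (\<forall>I D. double_row_instance I \<and> costs_represented D I \<longrightarrow>
        (\<exists>t s. exec P (initial_state I D) t s \<and>
               real t \<le> T (num_cells I + total_kinks I D) \<and>
               (\<exists>x y z. outputs_solution I s x y z \<and> optimal_solution I x y z)))"
proof (rule exI[of _ double_row_prog], rule exI[of _ "\<lambda>n. 108000 * (log 2 (36 * real n) + 2) * real n"],
    intro conjI allI impI)
  show "(\<lambda>n. 108000 * (log 2 (36 * real n) + 2) * real n) \<in> O(\<lambda>n. real n * ln (real n))"
    unfolding log_def by real_asymp
  fix I D assume "double_row_instance I \<and> costs_represented D I"
  then interpret program_input I D by unfold_locales auto
  show "\<exists>t s. exec double_row_prog (initial_state I D) t s \<and>
       real t \<le> 108000 * (log 2 (36 * real (num_cells I + total_kinks I D)) + 2) * real (num_cells I + total_kinks I D) \<and>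
       (\<exists>x y z. outputs_solution I s x y z \<and> optimal_solution I x y z)"
    by (rule double_row_solved)
qed

end
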